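(* Let $a,b>0$ be real parameters, and let $L$ be the (unbounded) linear operator in $\mathcal{L}^2=L^2(-\pi,\pi)$ defined in the context. If $2a+b<2$, then the resolvent of $L$ is compact of Hilbert–Schmidt type; that is, the resolvent set of $L$ is nonempty and for every $\lambda$ in the resolvent set of $L$ the operator $(L-\lambda I)^{-1}$ is a Hilbert–Schmidt (in particular compact) operator on $\mathcal{L}^2$.
   Context: $\mathcal{L}^2$ denotes the Lebesgue space $L^2(-\pi,\pi)$ of complex-valued scalar functions. The parameters $a,b$ are real and positive. The operator $L$ in $\mathcal{L}^2$ is $$(Ly)(x)=\frac{d}{dx}\left((1-a\cos x)\,y(x)+b\sin x\cdot\frac{dy(x)}{dx}\right),$$ with domain $\mathfrak{D}(L)$ consisting of all absolutely continuous functions $y$ on $[-\pi,\pi]$ with $y(-\pi)=y(\pi)$ such that $Ly\in\mathcal{L}^2$ (the outer derivative being understood in the distributional sense on $(-\pi,\pi)$, i.e. $(1-a\cos x)y+b\sin x\,y'$ is absolutely continuous with derivative in $\mathcal{L}^2$). *)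

theory Defs
  imports "HOL-Analysis.Analysis"
begin

section \<open>The Hilbert space of square-integrable complex functions on the interval from -pi to pi\<close>

abbreviation mu :: "real measure" where
  "mu \<equiv> lebesgue_on {-pi<..<pi}"

definition sq_int :: "(real \<Rightarrow> complex) \<Rightarrow> bool" where
  "sq_int f \<longleftrightarrow> f \<in> borel_measurable mu \<and> integrable mu (\<lambda>x. (cmod (f x))\<^sup>2)"

definition l2_rel :: "(real \<Rightarrow> complex) \<Rightarrow> (real \<Rightarrow> complex) \<Rightarrow> bool" where
  "l2_rel f g \<longleftrightarrow> sq_int f \<and> sq_int g \<and> (AE x in mu. f x = g x)"

lemma sq_int_zero: "sq_int (\<lambda>_. 0)"
  by (simp add: sq_int_def)

lemma sq_int_cmult: "sq_int f \<Longrightarrow> sq_int (\<lambda>x. c * f x)"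
  by (auto simp: sq_int_def norm_mult power_mult_distrib)

lemma sq_int_add:
  assumes "sq_int f" "sq_int g"
  shows "sq_int (\<lambda>x. f x + g x)"
proof -
  have [measurable]: "f \<in> borel_measurable mu" "g \<in> borel_measurable mu"
    using assms by (auto simp: sq_int_def)
  have *: "(cmod (z + w))\<^sup>2 \<le> 2 * (cmod z)\<^sup>2 + 2 * (cmod w)\<^sup>2" for z w
  proof -
    have "(cmod (z + w))\<^sup>2 \<le> (cmod z + cmod w)\<^sup>2"
      by (intro power_mono norm_triangle_ineq) auto
    also have "\<dots> \<le> 2 * (cmod z)\<^sup>2 + 2 * (cmod w)\<^sup>2"
      using sum_squares_bound[of "cmod z" "cmod w"] by (simp add: power2_sum)
    finally show ?thesis .
  qed
  have "integrable mu (\<lambda>x. (cmod (f x + g x))\<^sup>2)"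
  proof (rule Bochner_Integration.integrable_bound)
    show "integrable mu (\<lambda>x. 2 * (cmod (f x))\<^sup>2 + 2 * (cmod (g x))\<^sup>2)"
      using assms by (auto simp: sq_int_def)
  qed (use * in auto)
  then show ?thesis by (auto simp: sq_int_def)
qed

lemma sq_int_prod:
  assumes "sq_int f" "sq_int g"
  shows "integrable mu (\<lambda>x. f x * cnj (g x))"
proof -
  have [measurable]: "f \<in> borel_measurable mu" "g \<in> borel_measurable mu"
    using assms by (auto simp: sq_int_def)
  show ?thesis
  proof (rule Bochner_Integration.integrable_bound)
    show "integrable mu (\<lambda>x. (cmod (f x))\<^sup>2 + (cmod (g x))\<^sup>2)"
      using assms by (auto simp: sq_int_def)
    have "cmod z * cmod w \<le> (cmod z)\<^sup>2 + (cmod w)\<^sup>2" for z w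
      using sum_squares_bound[of "cmod z" "cmod w"] mult_nonneg_nonneg[OF norm_ge_zero norm_ge_zero, of z w]
      by linarith
    then show "AE x in mu. norm (f x * cnj (g x)) \<le> norm ((cmod (f x))\<^sup>2 + (cmod (g x))\<^sup>2)"
      by (auto simp: norm_mult)
  qed (rule borel_measurable_times, measurable,
       rule borel_measurable_continuous_on[where f = cnj], auto intro: continuous_intros)
qed

quotient_type l2 = "real \<Rightarrow> complex" / partial: l2_rel
proof (rule part_equivpI)
  show "\<exists>x. l2_rel x x" using sq_int_zero by (auto simp: l2_rel_def)
  show "symp l2_rel" by (auto simp: symp_def l2_rel_def)
  show "transp l2_rel"
    unfolding transp_def l2_rel_def by (auto elim: eventually_elim2)
qed

lemma abs_l2_eq_iff:
  "sq_int f \<Longrightarrow> sq_int g \<Longrightarrow> abs_l2 f = abs_l2 g \<longleftrightarrow> (AE x in mu. f x = g x)"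
  using Quotient3_rel[OF Quotient3_l2, of f g] by (auto simp: l2_rel_def)

lift_definition scaleC :: "complex \<Rightarrow> l2 \<Rightarrow> l2" (infixr \<open>*\<^sub>C\<close> 75)
  is "\<lambda>c f x. c * f x"
  by (auto simp: l2_rel_def sq_int_cmult)

lift_definition cinner :: "l2 \<Rightarrow> l2 \<Rightarrow> complex"
  is "\<lambda>f g. LINT x|mu. f x * cnj (g x)"
proof -
  fix f f' g g' assume *: "l2_rel f f'" "l2_rel g g'"
  then have "integrable mu (\<lambda>x. f x * cnj (g x))" "integrable mu (\<lambda>x. f' x * cnj (g' x))"
    by (auto intro: sq_int_prod simp: l2_rel_def)
  moreover have "AE x in mu. f x * cnj (g x) = f' x * cnj (g' x)"
    using * by (auto simp: l2_rel_def elim: eventually_elim2)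
  ultimately show "(LINT x|mu. f x * cnj (g x)) = (LINT x|mu. f' x * cnj (g' x))"
    by (intro integral_cong_AE) auto
qed

instantiation l2 :: real_vector
begin

lift_definition zero_l2 :: l2 is "\<lambda>_. 0"
  by (simp add: l2_rel_def sq_int_zero)

lift_definition plus_l2 :: "l2 \<Rightarrow> l2 \<Rightarrow> l2" is "\<lambda>f g x. f x + g x"
  by (auto simp: l2_rel_def sq_int_add elim: eventually_elim2)

definition uminus_l2 :: "l2 \<Rightarrow> l2" where "- u = (- 1) *\<^sub>C u"

definition minus_l2 :: "l2 \<Rightarrow> l2 \<Rightarrow> l2" where "u - v = u + (- v :: l2)"

definition scaleR_l2 :: "real \<Rightarrow> l2 \<Rightarrow> l2" where "r *\<^sub>R u = complex_of_real r *\<^sub>C u"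

instance
proof
  fix u v w :: l2 and r s :: real
  show "u + v + w = u + (v + w)"
    by transfer (auto simp: l2_rel_def sq_int_add add.assoc)
  show "u + v = v + u"
    by transfer (auto simp: l2_rel_def sq_int_add add.commute)
  show "0 + u = u"
    by transfer (auto simp: l2_rel_def)
  show "- u + u = 0"
    unfolding uminus_l2_def
    by transfer (auto simp: l2_rel_def sq_int_zero)
  show "u - v = u + - v" by (rule minus_l2_def)
  show "r *\<^sub>R (u + v) = r *\<^sub>R u + r *\<^sub>R v"
    unfolding scaleR_l2_def
    by transfer (auto simp: l2_rel_def distrib_left intro!: sq_int_add sq_int_cmult)
  show "(r + s) *\<^sub>R u = r *\<^sub>R u + s *\<^sub>R u"
    unfolding scaleR_l2_def
    by transfer (auto simp: l2_rel_def distrib_right intro!: sq_int_add sq_int_cmult)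
  show "r *\<^sub>R s *\<^sub>R u = (r * s) *\<^sub>R u"
    unfolding scaleR_l2_def
    by transfer (auto simp: l2_rel_def sq_int_cmult mult.assoc)
  show "1 *\<^sub>R u = u"
    unfolding scaleR_l2_def
    by transfer (auto simp: l2_rel_def)
qed

end

lemma cinner_add_left: "cinner (u + v) w = cinner u w + cinner v w"
  by transfer (auto simp: l2_rel_def distrib_right sq_int_prod)

lemma cinner_scaleC_left: "cinner (c *\<^sub>C u) v = c * cinner u v"
  by transfer (auto simp: mult.assoc)

lemma cinner_commute: "cinner u v = cnj (cinner v u)"
proof (transfer, goal_cases)
  case (1 f g)
  have "(\<lambda>x. f x * cnj (g x)) = (\<lambda>x. cnj (g x * cnj (f x)))" by (auto simp: mult.commute)
  then show ?case by (simp only: Bochner_Integration.integral_cnj)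
qed

lemma cinner_self_eq:
  "sq_int f \<Longrightarrow> (LINT x|mu. f x * cnj (f x)) = complex_of_real (LINT x|mu. (cmod (f x))\<^sup>2)"
  by (simp only: complex_norm_square[symmetric] of_real_power[symmetric]
      integral_complex_of_real)

lemma cinner_self_eq_zero_iff: "Re (cinner u u) = 0 \<longleftrightarrow> u = 0"
proof (transfer, goal_cases)
  case (1 f)
  then have f: "sq_int f" by (simp add: l2_rel_def)
  then have i: "integrable mu (\<lambda>x. (cmod (f x))\<^sup>2)" by (simp add: sq_int_def)
  have "(LINT x|mu. (cmod (f x))\<^sup>2) = 0 \<longleftrightarrow> (AE x in mu. f x = 0)"
    using integral_nonneg_eq_0_iff_AE[OF i] by simp
  then show ?case by (simp add: cinner_self_eq f l2_rel_def sq_int_zero)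
qed

instantiation l2 :: real_inner
begin

definition inner_l2 :: "l2 \<Rightarrow> l2 \<Rightarrow> real" where "inner u v = Re (cinner u v)"

definition norm_l2 :: "l2 \<Rightarrow> real" where "norm u = sqrt (inner u (u :: l2))"

definition dist_l2 :: "l2 \<Rightarrow> l2 \<Rightarrow> real" where "dist u v = norm (u - v :: l2)"

definition sgn_l2 :: "l2 \<Rightarrow> l2" where "sgn (u :: l2) = inverse (norm u) *\<^sub>R u"

definition uniformity_l2 :: "(l2 \<times> l2) filter" where
  "uniformity = (INF e\<in>{0<..}. principal {(u :: l2, v). dist u v < e})"

definition open_l2 :: "l2 set \<Rightarrow> bool" where
  "open (U :: l2 set) \<longleftrightarrow> (\<forall>x\<in>U. eventually (\<lambda>(x', y). x' = x \<longrightarrow> y \<in> U) uniformity)"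

instance
proof
  fix u v w :: l2 and r :: real
  show "inner u v = inner v u"
    using cinner_commute[of u v] by (simp add: inner_l2_def)
  show "inner (u + v) w = inner u w + inner v w"
    by (simp add: inner_l2_def cinner_add_left)
  show "inner (r *\<^sub>R u) v = r * inner u v"
    by (simp add: inner_l2_def scaleR_l2_def cinner_scaleC_left)
  show "0 \<le> inner u u"
    unfolding inner_l2_def
    by transfer (auto simp: l2_rel_def cinner_self_eq)
  show "inner u u = 0 \<longleftrightarrow> u = 0"
    by (simp add: inner_l2_def cinner_self_eq_zero_iff)
qed (fact norm_l2_def dist_l2_def sgn_l2_def uniformity_l2_def open_l2_def)+

end


section \<open>Operators\<close>

definition bounded_clinear :: "(l2 \<Rightarrow> l2) \<Rightarrow> bool" where
  "bounded_clinear T \<longleftrightarrow> bounded_linear T \<and> (\<forall>c u. T (c *\<^sub>C u) = c *\<^sub>C T u)"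

definition compact_operator :: "(l2 \<Rightarrow> l2) \<Rightarrow> bool" where
  "compact_operator T \<longleftrightarrow> bounded_clinear T \<and> (\<forall>B. bounded B \<longrightarrow> compact (closure (T ` B)))"

definition orthonormal_basis :: "l2 set \<Rightarrow> bool" where
  "orthonormal_basis E \<longleftrightarrow>
     (\<forall>e\<in>E. \<forall>f\<in>E. cinner e f = (if e = f then 1 else 0)) \<and>
     (\<forall>u. (\<forall>e\<in>E. cinner u e = 0) \<longrightarrow> u = 0)"

definition hilbert_schmidt :: "(l2 \<Rightarrow> l2) \<Rightarrow> bool" where
  "hilbert_schmidt T \<longleftrightarrow> bounded_clinear T \<and>
     (\<exists>E. orthonormal_basis E \<and> (\<lambda>e. (norm (T e))\<^sup>2) summable_on E)"

text \<open>An unbounded operator is a domain \<open>D\<close> together with a map \<open>A\<close>, whose values off \<open>D\<close>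
  are irrelevant.\<close>

definition resolvent :: "l2 set \<Rightarrow> (l2 \<Rightarrow> l2) \<Rightarrow> complex \<Rightarrow> l2 \<Rightarrow> l2" where
  "resolvent D A z = inv_into D (\<lambda>u. A u - z *\<^sub>C u)"

definition resolvent_set :: "l2 set \<Rightarrow> (l2 \<Rightarrow> l2) \<Rightarrow> complex set" where
  "resolvent_set D A = {z. bij_betw (\<lambda>u. A u - z *\<^sub>C u) D UNIV \<and> bounded_clinear (resolvent D A z)}"


section \<open>The differential operator\<close>

definition abs_continuous :: "real \<Rightarrow> real \<Rightarrow> (real \<Rightarrow> complex) \<Rightarrow> bool" where
  "abs_continuous c d f \<longleftrightarrow>
     (\<forall>\<epsilon>>0. \<exists>\<delta>>0. \<forall>(n::nat) s t.
        (\<forall>i<n. c \<le> s i \<and> s i \<le> t i \<and> t i \<le> d) \<and>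
        (\<forall>i<n. \<forall>j<n. i \<noteq> j \<longrightarrow> {s i<..<t i} \<inter> {s j<..<t j} = {}) \<and>
        (\<Sum>i<n. t i - s i) < \<delta>
        \<longrightarrow> (\<Sum>i<n. cmod (f (t i) - f (s i))) < \<epsilon>)"

text \<open>The relation \<open>L_graph a b u v\<close> says that \<open>v = L u\<close>: here \<open>y\<close> is the absolutely
  continuous representative of \<open>u\<close>, and \<open>w\<close> that of
  \<open>(1 - a cos x) y + b sin x y'\<close>. The derivative \<open>y'\<close> exists only almost everywhere, so \<open>w\<close> is
  tied to this expression almost everywhere.\<close>

definition L_graph :: "real \<Rightarrow> real \<Rightarrow> l2 \<Rightarrow> l2 \<Rightarrow> bool" where
  "L_graph a b u v \<longleftrightarrow> (\<exists>y w g.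
     abs_continuous (-pi) pi y \<and> y (-pi) = y pi \<and> u = abs_l2 y \<and>
     abs_continuous (-pi) pi w \<and>
     (AE x in mu. w x = complex_of_real (1 - a * cos x) * y x +
        complex_of_real (b * sin x) * vector_derivative y (at x)) \<and>
     (AE x in mu. (w has_vector_derivative g x) (at x)) \<and> sq_int g \<and> v = abs_l2 g)"

lemma abs_continuous_imp_continuous_on:
  assumes "abs_continuous c d f"
  shows "continuous_on {c..d} f"
proof (rule continuous_onI)
  fix x e :: real assume x: "x \<in> {c..d}" and e: "0 < e"
  obtain \<delta> where D: "\<delta> > 0 \<and> (\<forall>(n::nat) s t.
        (\<forall>i<n. c \<le> s i \<and> s i \<le> t i \<and> t i \<le> d) \<and>
        (\<forall>i<n. \<forall>j<n. i \<noteq> j \<longrightarrow> {s i<..<t i} \<inter> {s j<..<t j} = {}) \<and>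
        (\<Sum>i<n. t i - s i) < \<delta>
        \<longrightarrow> (\<Sum>i<n. cmod (f (t i) - f (s i))) < e)"
    using assms[unfolded abs_continuous_def, THEN spec, THEN mp, OF e] by (rule exE)
  have *: "cmod (f t - f s) < e" if "c \<le> s" "s \<le> t" "t \<le> d" "t - s < \<delta>" for s t
    using D[THEN conjunct2, THEN spec, of 1, THEN spec, of "\<lambda>_. s", THEN spec, of "\<lambda>_. t"] that by simp
  show "\<exists>\<delta>>0. \<forall>x'\<in>{c..d}. dist x' x < \<delta> \<longrightarrow> dist (f x') (f x) \<le> e"
  proof (intro exI conjI ballI impI)
    show "\<delta> > 0" using D by simp
    fix x' assume x': "x' \<in> {c..d}" "dist x' x < \<delta>"
    show "dist (f x') (f x) \<le> e"
    proof (cases "x \<le> x'")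
      case True
      then show ?thesis using *[of x x'] x x' by (simp add: dist_norm)
    next
      case False
      then show ?thesis using *[of x' x] x x' by (simp add: dist_norm norm_minus_commute)
    qed
  qed
qed

lemma abs_continuous_imp_sq_int:
  assumes "abs_continuous (-pi) pi f"
  shows "sq_int f"
proof -
  have c: "continuous_on {-pi..pi} f"
    by (rule abs_continuous_imp_continuous_on[OF assms])
  have m: "f \<in> borel_measurable mu"
    by (intro continuous_imp_measurable_on_sets_lebesgue continuous_on_subset[OF c]) auto
  have "continuous_on {-pi..pi} (\<lambda>x. (cmod (f x))\<^sup>2)"
    using c by (intro continuous_intros)
  then have "(\<lambda>x. (cmod (f x))\<^sup>2) absolutely_integrable_on {-pi..pi}"
    using absolutely_integrable_continuous[of "-pi" pi "\<lambda>x. (cmod (f x))\<^sup>2"] by simp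
  then have "(\<lambda>x. (cmod (f x))\<^sup>2) absolutely_integrable_on {-pi<..<pi}"
    by (rule set_integrable_subset) auto
  then have "integrable mu (\<lambda>x. (cmod (f x))\<^sup>2)"
    by (simp add: set_integrable_def integrable_restrict_space)
  with m show ?thesis by (simp add: sq_int_def)
qed

lemma AE_mu_eq_imp_eq:
  fixes f g :: "real \<Rightarrow> complex"
  assumes "continuous_on {-pi<..<pi} f" "continuous_on {-pi<..<pi} g"
    and ae: "AE x in mu. f x = g x" and x: "x \<in> {-pi<..<pi}"
  shows "f x = g x"
proof (rule ccontr)
  let ?U = "{x \<in> {-pi<..<pi}. f x \<noteq> g x}"
  assume "f x \<noteq> g x"
  have op: "open ?U"
  proof -
    have "open ((\<lambda>x. f x - g x) -` (- {0}) \<inter> {-pi<..<pi})"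
      using assms by (intro continuous_on_open_vimage[THEN iffD1, rule_format] continuous_intros) auto
    also have "(\<lambda>x. f x - g x) -` (- {0}) \<inter> {-pi<..<pi} = ?U" by auto
    finally show ?thesis .
  qed
  have "AE x in lebesgue. x \<in> {-pi<..<pi} \<longrightarrow> f x = g x"
    using ae by (simp add: AE_restrict_space_iff)
  then have "AE x in lebesgue. x \<notin> ?U" by eventually_elim auto
  moreover have "?U \<in> sets lebesgue" using op by (metis borel_open sets_completionI_sets sets_lborel)
  ultimately have "negligible ?U" by (simp add: AE_iff_null_sets negligible_iff_null_sets)
  with \<open>f x \<noteq> g x\<close> show False using open_not_negligible[OF op] x by blast
qed

lemma L_graph_unique:
  assumes "L_graph a b u v" "L_graph a b u v'"
  shows "v = v'"
proof -
  let ?I = "{-pi<..<pi} :: real set"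
  let ?F = "\<lambda>y x. complex_of_real (1 - a * cos x) * y x +
        complex_of_real (b * sin x) * vector_derivative y (at x)"
  obtain y w g where 1: "abs_continuous (-pi) pi y" "u = abs_l2 y" "abs_continuous (-pi) pi w"
     "AE x in mu. w x = ?F y x"
     "AE x in mu. (w has_vector_derivative g x) (at x)" "sq_int g" "v = abs_l2 g"
    using assms(1) unfolding L_graph_def by blast
  obtain y' w' g' where 2: "abs_continuous (-pi) pi y'" "u = abs_l2 y'" "abs_continuous (-pi) pi w'"
     "AE x in mu. w' x = ?F y' x"
     "AE x in mu. (w' has_vector_derivative g' x) (at x)" "sq_int g'" "v' = abs_l2 g'"
    using assms(2) unfolding L_graph_def by blast
  have cont: "continuous_on ?I f" if "abs_continuous (-pi) pi f" for f
    using abs_continuous_imp_continuous_on[OF that] by (rule continuous_on_subset) auto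
  have "AE x in mu. y x = y' x"
    using 1(2) 2(2) abs_l2_eq_iff[OF abs_continuous_imp_sq_int[OF 1(1)] abs_continuous_imp_sq_int[OF 2(1)]]
    by simp
  then have yy: "y x = y' x" if "x \<in> ?I" for x
    using AE_mu_eq_imp_eq[OF cont[OF 1(1)] cont[OF 2(1)] _ that] by simp
  have "vector_derivative y (at x) = vector_derivative y' (at x)" if "x \<in> ?I" for x
  proof -
    have "(y has_vector_derivative d) (at x) \<longleftrightarrow> (y' has_vector_derivative d) (at x)" for d
      using that yy by (auto intro: has_vector_derivative_transform_within_open[of _ _ _ ?I])
    then show ?thesis by (simp add: vector_derivative_def)
  qed
  with yy have "AE x in mu. ?F y x = ?F y' x" by (intro AE_I2) auto
  with 1(4) 2(4) have "AE x in mu. w x = w' x" by eventually_elim simp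
  then have ww: "w x = w' x" if "x \<in> ?I" for x
    using AE_mu_eq_imp_eq[OF cont[OF 1(3)] cont[OF 2(3)] _ that] by simp
  have "AE x in mu. x \<in> ?I" by (intro AE_I2) auto
  with 1(5) 2(5) have "AE x in mu. g x = g' x"
  proof eventually_elim
    case (elim x)
    then have "(w' has_vector_derivative g x) (at x)"
      using ww by (auto intro: has_vector_derivative_transform_within_open[of w _ _ ?I])
    with elim show ?case by (auto intro: vector_derivative_unique_at)
  qed
  with 1 2 show ?thesis
    by (simp add: abs_l2_eq_iff)
qed

definition L_dom :: "real \<Rightarrow> real \<Rightarrow> l2 set" where
  "L_dom a b = {u. \<exists>v. L_graph a b u v}"

definition L_op :: "real \<Rightarrow> real \<Rightarrow> l2 \<Rightarrow> l2" where
  "L_op a b u = (THE v. L_graph a b u v)"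

lemma L_op_eq: "L_graph a b u v \<Longrightarrow> L_op a b u = v"
  unfolding L_op_def by (blast intro: L_graph_unique)

end

(* Let w = (1 - a cos x) y + b sin x y'. The first-order equation for y is singular at 0 and at
   the end points, and for given w it has exactly one solution y = K w that is continuous at 0: with
   the integrating factor phi, y(x) is the mean over r in [0,1] of w / (1 - a cos) at the points
   theta(x,r) = phi^{-1}(r phi(x)). Such means are bounded by the supremum of |w|, preserve monotonicity
   (which gives the absolute continuity of y) and satisfy y(+-pi) = w(+-pi) / (1 + a). Hence L y = f
   means y = K w with w' = f and w periodic, i.e. L is d/dx composed with the inverse of K.

   For small z > 0 the equation w' = z K w + f with periodic w is solved by a contraction, so z lies
   in the resolvent set. For every z in the resolvent set, (L - z)^{-1} h = K (c + integral of f) with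
   c and f bounded by h in norm; this representation is bounded pointwise in terms of the norm of h,
   whence Hilbert-Schmidt by Bessel's inequality, and compact by the Arzela-Ascoli theorem. *)
theory Submission
  imports Defs "HOL-Complex_Analysis.Great_Picard"
begin

section \<open>Absolutely continuous functions and indefinite integrals\<close>

text \<open>Since a < 1, \<open>phi\<close> vanishes at 0 and is infinite at +-pi. On either side of
  0 the homogeneous solutions are the multiples of 1/phi, which blow up at 0 and decay at the ends;
  so continuity at 0 alone selects the solution, and the values at +-pi leave no further freedom.

  The delicate direction leads from \<open>L_graph\<close> to \<open>K\<close>. There the relation
  between w and y holds only almost everywhere, and \<open>vector_derivative\<close> has an
  unspecified value where y has no derivative. The differentiability of y is therefore extracted
  from the relation itself together with absolute continuity, which is why a fundamental theorem of
  calculus with an exceptional closed set, possibly of positive measure, is proved.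

  The point z = 0 cannot serve as a resolvent point: constant w gives L y = 0, and the range
  contains only functions with integral zero. But the kernel function K 1 is positive, hence outside
  the range; this is what lets the periodicity of w determine its additive constant as soon as z is
  nonzero.\<close>

lemma sum_length_disjoint_le:
  fixes s t :: "'i \<Rightarrow> real"
  assumes "finite I" "U \<in> lmeasurable" "\<And>i. i \<in> I \<Longrightarrow> s i \<le> t i" "\<And>i. i \<in> I \<Longrightarrow> {s i<..<t i} \<subseteq> U"
    and "\<And>i j. \<lbrakk>i \<in> I; j \<in> I; i \<noteq> j\<rbrakk> \<Longrightarrow> {s i<..<t i} \<inter> {s j<..<t j} = {}"
  shows "(\<Sum>i\<in>I. t i - s i) \<le> measure lebesgue U"
proof -
  have "(\<Sum>i\<in>I. t i - s i) = (\<Sum>i\<in>I. measure lebesgue {s i<..<t i})"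
    using assms(3) by (intro sum.cong) auto
  also have "\<dots> = measure lebesgue (\<Union>i\<in>I. {s i<..<t i})"
    using assms(1,5) by (intro measure_negligible_finite_Union_image[symmetric]) (auto simp: pairwise_def)
  also have "\<dots> \<le> measure lebesgue U"
    using assms by (intro measure_mono_fmeasurable) auto
  finally show ?thesis .
qed

text \<open>Tagged divisions are sets of pairs, while \<open>abs_continuous\<close> numbers its
  intervals; a bijection with an initial segment of the naturals carries the estimate over.\<close>

lemma abs_continuous_finite_family:
  assumes "abs_continuous c d f" "\<epsilon> > 0"
  shows "\<exists>\<delta>>0. \<forall>(I :: 'i set) s t. finite I \<and> (\<forall>i\<in>I. c \<le> s i \<and> s i \<le> t i \<and> t i \<le> d) \<and>
       (\<forall>i\<in>I. \<forall>j\<in>I. i \<noteq> j \<longrightarrow> {s i<..<t i} \<inter> {s j<..<t j} = {}) \<and>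
       (\<Sum>i\<in>I. t i - s i) < \<delta> \<longrightarrow> (\<Sum>i\<in>I. cmod (f (t i) - f (s i))) < \<epsilon>"
proof -
  obtain \<delta> where D: "\<delta> > 0 \<and> (\<forall>(n::nat) s t.
        (\<forall>i<n. c \<le> s i \<and> s i \<le> t i \<and> t i \<le> d) \<and>
        (\<forall>i<n. \<forall>j<n. i \<noteq> j \<longrightarrow> {s i<..<t i} \<inter> {s j<..<t j} = {}) \<and>
        (\<Sum>i<n. t i - s i) < \<delta>
        \<longrightarrow> (\<Sum>i<n. cmod (f (t i) - f (s i))) < \<epsilon>)"
    using assms(1)[unfolded abs_continuous_def, THEN spec, THEN mp, OF assms(2)] by (rule exE)
  then have \<delta>: "\<delta> > 0" by (rule conjunct1)
  note * = D[THEN conjunct2, THEN spec, THEN spec, THEN spec, THEN mp, OF conjI[OF _ conjI]]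
  show ?thesis
  proof (intro exI[of _ \<delta>] conjI \<delta> allI impI; elim conjE)
    fix I :: "'i set" and s t
    assume I: "finite I" "\<forall>i\<in>I. c \<le> s i \<and> s i \<le> t i \<and> t i \<le> d"
       "\<forall>i\<in>I. \<forall>j\<in>I. i \<noteq> j \<longrightarrow> {s i<..<t i} \<inter> {s j<..<t j} = {}"
       "(\<Sum>i\<in>I. t i - s i) < \<delta>"
    obtain h where h: "bij_betw h {..<card I} I"
      using ex_bij_betw_nat_finite[OF I(1)] by (auto simp: atLeast0LessThan)
    have hI: "h i \<in> I" if "i < card I" for i using h that by (auto simp: bij_betw_def)
    have hne: "h i \<noteq> h j" if "i < card I" "j < card I" "i \<noteq> j" for i j
      using h that by (auto simp: bij_betw_def inj_on_def)
    have "(\<Sum>i<card I. cmod (f (t (h i)) - f (s (h i)))) < \<epsilon>"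
    proof (rule *)
      show "(\<Sum>i<card I. t (h i) - s (h i)) < \<delta>"
        using I(4) sum.reindex_bij_betw[OF h, of "\<lambda>i. t i - s i"] by simp
    qed (use I hI hne in auto)
    then show "(\<Sum>i\<in>I. cmod (f (t i) - f (s i))) < \<epsilon>"
      using sum.reindex_bij_betw[OF h, of "\<lambda>i. cmod (f (t i) - f (s i))"] by simp
  qed
qed

lemma abs_continuous_subinterval:
  assumes "abs_continuous c d f" "c \<le> c'" "d' \<le> d"
  shows "abs_continuous c' d' f"
  unfolding abs_continuous_def
proof (intro allI impI)
  fix \<epsilon> :: real assume "\<epsilon> > 0"
  obtain \<delta> where D: "\<delta> > 0 \<and> (\<forall>(n::nat) s t.
        (\<forall>i<n. c \<le> s i \<and> s i \<le> t i \<and> t i \<le> d) \<and>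
        (\<forall>i<n. \<forall>j<n. i \<noteq> j \<longrightarrow> {s i<..<t i} \<inter> {s j<..<t j} = {}) \<and>
        (\<Sum>i<n. t i - s i) < \<delta>
        \<longrightarrow> (\<Sum>i<n. cmod (f (t i) - f (s i))) < \<epsilon>)"
    using assms(1)[unfolded abs_continuous_def, THEN spec, THEN mp, OF \<open>\<epsilon> > 0\<close>] by (rule exE)
  show "\<exists>\<delta>>0. \<forall>(n::nat) s t.
        (\<forall>i<n. c' \<le> s i \<and> s i \<le> t i \<and> t i \<le> d') \<and>
        (\<forall>i<n. \<forall>j<n. i \<noteq> j \<longrightarrow> {s i<..<t i} \<inter> {s j<..<t j} = {}) \<and>
        (\<Sum>i<n. t i - s i) < \<delta> \<longrightarrow> (\<Sum>i<n. cmod (f (t i) - f (s i))) < \<epsilon>"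
  proof (intro exI[of _ \<delta>] conjI D[THEN conjunct1] allI impI; elim conjE)
    fix n :: nat and s t
    assume *: "\<forall>i<n. c' \<le> s i \<and> s i \<le> t i \<and> t i \<le> d'"
      "\<forall>i<n. \<forall>j<n. i \<noteq> j \<longrightarrow> {s i<..<t i} \<inter> {s j<..<t j} = {}" "(\<Sum>i<n. t i - s i) < \<delta>"
    have "\<forall>i<n. c \<le> s i \<and> s i \<le> t i \<and> t i \<le> d"
      using *(1) assms(2,3) by (meson order_trans)
    from D[THEN conjunct2, THEN spec, THEN spec, THEN spec, THEN mp, OF conjI[OF this conjI[OF *(2,3)]]] show "(\<Sum>i<n. cmod (f (t i) - f (s i))) < \<epsilon>" .
  qed
qed

text \<open>Tags outside \<open>N \<union> Z\<close> contribute little by differentiability. For the others the gauge is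
  confined to an open set \<open>U\<close> such that \<open>U - Z\<close> has small measure: cutting each interval at its
  first and last point of \<open>Z\<close>, where \<open>f\<close> vanishes, leaves only pieces of \<open>U - Z\<close>, which
  contribute little by absolute continuity.\<close>

lemma fundamental_theorem_of_calculus_abs_continuous_zero_set:
  fixes f :: "real \<Rightarrow> complex"
  assumes cd: "c \<le> d" and ac: "abs_continuous c d f" and N: "negligible N"
    and Z: "closed Z" "\<And>x. x \<in> Z \<inter> {c..d} \<Longrightarrow> f x = 0"
    and der: "\<And>x. x \<in> {c..d} - N - Z \<Longrightarrow> (f has_vector_derivative g x) (at x within {c..d})"
  shows "((\<lambda>x. if x \<in> Z then 0 else g x) has_integral (f d - f c)) {c..d}"
proof -
  define g' where "g' x = (if x \<in> N \<union> Z then 0 else g x)" for x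
  have cut: "\<exists>u' v'. u \<le> u' \<and> u' \<le> v \<and> u \<le> v' \<and> v' \<le> v \<and> {u<..<u'} \<subseteq> - Z \<and> {v'<..<v} \<subseteq> - Z \<and>
      cmod (f v - f u) \<le> cmod (f u' - f u) + cmod (f v - f v')"
    if uv: "u \<le> v" "c \<le> u" "v \<le> d" for u v
  proof (cases "Z \<inter> {u..v} = {}")
    case True
    then show ?thesis using uv by (intro exI[of _ v]) auto
  next
    case False
    have k: "compact (Z \<inter> {u..v})" using Z(1) by (intro closed_Int_compact) auto
    obtain u' where u': "u' \<in> Z \<inter> {u..v}" "\<And>z. z \<in> Z \<inter> {u..v} \<Longrightarrow> u' \<le> z"
      using compact_attains_inf[OF k False] by blast
    obtain v' where v': "v' \<in> Z \<inter> {u..v}" "\<And>z. z \<in> Z \<inter> {u..v} \<Longrightarrow> z \<le> v'"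
      using compact_attains_sup[OF k False] by blast
    have "f u' = 0" "f v' = 0" using u' v' uv Z(2) by auto
    moreover have "{u<..<u'} \<subseteq> - Z" "{v'<..<v} \<subseteq> - Z" using u' v' by force+
    ultimately show ?thesis
      using u' v' norm_triangle_ineq4[of "f v" "f u"] by (intro exI[of _ u'] exI[of _ v']) auto
  qed
  have "(g' has_integral (f d - f c)) {c..d}"
    unfolding has_integral_factor_content_real
  proof (intro allI impI)
    fix e :: real assume e: "e > 0"
    show "\<exists>\<gamma>. gauge \<gamma> \<and> (\<forall>p. p tagged_division_of {c..d} \<and> \<gamma> fine p \<longrightarrow>
            norm ((\<Sum>(x, K)\<in>p. measure lborel K *\<^sub>R g' x) - (f d - f c)) \<le> e * measure lborel {c..d})"
    proof (cases "c = d")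
      case True
      then have "(g' has_integral (f d - f c)) {c..d}" using has_integral_refl(2)[of g' d] by simp
      then show ?thesis
        using e unfolding has_integral_factor_content_real by blast
    next
      case False
      with cd have cd': "c < d" by simp
      \<comment> \<open>The total budget is \<open>e * (d - c)\<close>. Half goes to tags in
        \<open>N \<union> Z\<close>, whose intervals leave two pieces each and so cost \<eta> twice;
        the other half goes to the remaining tags through \<open>e' = e / 2\<close>.\<close>
      define \<eta> where "\<eta> = e * (d - c) / 4"
      have \<eta>: "\<eta> > 0" using e cd' by (simp add: \<eta>_def)
      obtain \<delta> where D: "\<delta> > 0 \<and> (\<forall>(I :: (real \<times> real set) set) s t.
         finite I \<and> (\<forall>i\<in>I. c \<le> s i \<and> s i \<le> t i \<and> t i \<le> d) \<and>
         (\<forall>i\<in>I. \<forall>j\<in>I. i \<noteq> j \<longrightarrow> {s i<..<t i} \<inter> {s j<..<t j} = {}) \<and>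
         (\<Sum>i\<in>I. t i - s i) < \<delta> \<longrightarrow> (\<Sum>i\<in>I. cmod (f (t i) - f (s i))) < \<eta>)"
        using abs_continuous_finite_family[OF ac \<eta>, where 'i = "real \<times> real set"] by (rule exE)
      then have \<delta>: "\<delta> > 0" by (rule conjunct1)
      note ac' = D[THEN conjunct2, THEN spec, THEN spec, THEN spec, THEN mp, OF conjI[OF _ conjI[OF _ conjI]]]
      \<comment> \<open>\<open>Z\<close> may have positive measure, so only \<open>U - Z\<close> can
        be made small. As \<open>N - Z\<close> is null, it suffices that \<open>U\<close> exceeds
        \<open>N \<union> Z\<close> by less than \<delta>.\<close>
      obtain U where U: "open U" "N \<union> Z \<subseteq> U" "U - Z \<in> lmeasurable" "measure lebesgue (U - Z) < \<delta>"
      proof -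
        have N0: "N \<in> sets lebesgue" "emeasure lebesgue N = 0"
          using N by (auto simp: negligible_iff_null_sets)
        have "N \<union> Z \<in> sets lebesgue" using N0 Z(1) by auto
        from sets_lebesgue_outer_open[OF this \<delta>]
        obtain U where U: "open U" "N \<union> Z \<subseteq> U" "U - (N \<union> Z) \<in> lmeasurable"
          "emeasure lebesgue (U - (N \<union> Z)) < ennreal \<delta>" by blast
        have NZ: "N - Z \<in> null_sets lebesgue"
          using negligible_diff[OF N, of Z] by (simp add: negligible_iff_null_sets)
        have UZ: "U - Z = (U - (N \<union> Z)) \<union> (N - Z)" using U by blast
        then have "emeasure lebesgue (U - Z) = emeasure lebesgue (U - (N \<union> Z))"
          using NZ U(3) by (metis emeasure_Un_null_set fmeasurableD)
        with U have eU: "emeasure lebesgue (U - Z) < ennreal \<delta>" by simp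
        have lm: "U - Z \<in> lmeasurable"
          unfolding UZ using U(3) NZ by (intro fmeasurable.Un) (auto simp: fmeasurableI_null_sets)
        moreover have "measure lebesgue (U - Z) < \<delta>"
          using eU \<delta> lm by (simp add: emeasure_eq_measure2 ennreal_less_iff)
        ultimately show ?thesis using that U by blast
      qed
      define e' where "e' = e / 2"
      have e': "e' > 0" using e by (simp add: e'_def)
      have "\<forall>x\<in>{c..d} - N - Z. \<exists>r>0. \<forall>y\<in>{c..d}. norm (y - x) < r \<longrightarrow>
               norm (f y - f x - (y - x) *\<^sub>R g x) \<le> e' * norm (y - x)"
        using der e' unfolding has_vector_derivative_def has_derivative_within_alt by blast
      then obtain r where r: "\<And>x. x \<in> {c..d} - N - Z \<Longrightarrow> r x > 0"
        and r': "\<And>x y. \<lbrakk>x \<in> {c..d} - N - Z; y \<in> {c..d}; norm (y - x) < r x\<rbrakk> \<Longrightarrow>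
               norm (f y - f x - (y - x) *\<^sub>R g x) \<le> e' * norm (y - x)"
        by metis
      define \<gamma> where "\<gamma> x = (if x \<in> N \<union> Z then U else if x \<in> {c..d} then ball x (r x) else ball x 1)" for x
      have gauge: "gauge \<gamma>"
        using U r by (auto simp: gauge_def \<gamma>_def)
      have est: "norm ((\<Sum>(x, K)\<in>p. measure lborel K *\<^sub>R g' x) - (f d - f c)) \<le> e * measure lborel {c..d}"
        if p: "p tagged_division_of {c..d}" and fine: "\<gamma> fine p" for p
      proof -
        have fp: "finite p" using p by blast
        have K: "\<exists>u v. K = {u..v} \<and> u \<le> v \<and> c \<le> u \<and> v \<le> d \<and> x \<in> {u..v} \<and> Sup K = v \<and> Inf K = u"
          if "(x, K) \<in> p" for x K
        proof -
          have "x \<in> K" "K \<subseteq> {c..d}" "\<exists>u v. K = cbox u v"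
            using tagged_division_ofD[OF p] that by auto
          then show ?thesis by auto
        qed
        have tele: "(\<Sum>(x,K)\<in>p. f (Sup K) - f (Inf K)) = f d - f c"
          using additive_tagged_division_1[OF cd p, of f] .
        define D where "D z = measure lborel (snd z) *\<^sub>R g' (fst z) - (f (Sup (snd z)) - f (Inf (snd z)))" for z
        define p1 where "p1 = {z\<in>p. fst z \<in> N \<union> Z}"
        define p2 where "p2 = {z\<in>p. fst z \<notin> N \<union> Z}"
        have p12: "p = p1 \<union> p2" "p1 \<inter> p2 = {}" "finite p1" "finite p2"
          using fp by (auto simp: p1_def p2_def)
        have disj: "{Inf (snd i)<..<Sup (snd i)} \<inter> {Inf (snd j)<..<Sup (snd j)} = {}"
          if ij: "i \<in> p1" "j \<in> p1" "i \<noteq> j" for i j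
        proof -
          have "interior (snd i) \<inter> interior (snd j) = {}"
            using ij tagged_division_ofD(5)[OF p, of "fst i" "snd i" "fst j" "snd j"] by (auto simp: p1_def prod_eq_iff)
          moreover have "interior (snd k) = {Inf (snd k)<..<Sup (snd k)}" if "k \<in> p1" for k
            using K[of "fst k" "snd k"] that by (metis (no_types, lifting) interior_atLeastAtMost_real mem_Collect_eq p1_def prod.collapse)
          ultimately show ?thesis using ij by simp
        qed
        have K1: "c \<le> Inf (snd i)" "Inf (snd i) \<le> Sup (snd i)" "Sup (snd i) \<le> d"
            "{Inf (snd i)<..<Sup (snd i)} \<subseteq> U" if i: "i \<in> p1" for i
        proof -
          show "c \<le> Inf (snd i)" "Inf (snd i) \<le> Sup (snd i)" "Sup (snd i) \<le> d"
            using K[of "fst i" "snd i"] i by (auto simp: p1_def)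
          have "snd i \<subseteq> U" using fineD[OF fine, of "fst i" "snd i"] i by (auto simp: p1_def \<gamma>_def)
          then show "{Inf (snd i)<..<Sup (snd i)} \<subseteq> U"
            using K[of "fst i" "snd i"] i by (force simp: p1_def)
        qed
        have "\<forall>i\<in>p1. \<exists>u' v'. Inf (snd i) \<le> u' \<and> u' \<le> Sup (snd i) \<and> Inf (snd i) \<le> v' \<and> v' \<le> Sup (snd i) \<and>
            {Inf (snd i)<..<u'} \<subseteq> - Z \<and> {v'<..<Sup (snd i)} \<subseteq> - Z \<and>
            cmod (f (Sup (snd i)) - f (Inf (snd i))) \<le> cmod (f u' - f (Inf (snd i))) + cmod (f (Sup (snd i)) - f v')"
          using K1 by (intro ballI cut) auto
        then obtain lo hi where cutp: "\<And>i. i \<in> p1 \<Longrightarrow> Inf (snd i) \<le> lo i" "\<And>i. i \<in> p1 \<Longrightarrow> lo i \<le> Sup (snd i)"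
            "\<And>i. i \<in> p1 \<Longrightarrow> Inf (snd i) \<le> hi i" "\<And>i. i \<in> p1 \<Longrightarrow> hi i \<le> Sup (snd i)"
            "\<And>i. i \<in> p1 \<Longrightarrow> {Inf (snd i)<..<lo i} \<subseteq> - Z" "\<And>i. i \<in> p1 \<Longrightarrow> {hi i<..<Sup (snd i)} \<subseteq> - Z"
            "\<And>i. i \<in> p1 \<Longrightarrow> cmod (f (Sup (snd i)) - f (Inf (snd i))) \<le>
               cmod (f (lo i) - f (Inf (snd i))) + cmod (f (Sup (snd i)) - f (hi i))"
          unfolding bchoice_iff by blast
        \<comment> \<open>Used once for the left and once for the right pieces: with one piece per
          interval the family stays disjoint.\<close>
        have small: "(\<Sum>i\<in>p1. cmod (f (t i) - f (s i))) < \<eta>"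
          if st: "\<And>i. i \<in> p1 \<Longrightarrow> Inf (snd i) \<le> s i" "\<And>i. i \<in> p1 \<Longrightarrow> s i \<le> t i"
            "\<And>i. i \<in> p1 \<Longrightarrow> t i \<le> Sup (snd i)" "\<And>i. i \<in> p1 \<Longrightarrow> {s i<..<t i} \<subseteq> - Z" for s t
        proof (rule ac'[OF p12(3)])
          show "\<forall>i\<in>p1. c \<le> s i \<and> s i \<le> t i \<and> t i \<le> d"
            using K1 st by (meson order_trans)
          have sub: "{s i<..<t i} \<subseteq> {Inf (snd i)<..<Sup (snd i)}" if "i \<in> p1" for i
            using st(1,3)[OF that] by auto
          have dj: "{s i<..<t i} \<inter> {s j<..<t j} = {}" if "i \<in> p1" "j \<in> p1" "i \<noteq> j" for i j
            using disj[OF that] sub[OF that(1)] sub[OF that(2)] by blast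
          then show "\<forall>i\<in>p1. \<forall>j\<in>p1. i \<noteq> j \<longrightarrow> {s i<..<t i} \<inter> {s j<..<t j} = {}" by blast
          have "(\<Sum>i\<in>p1. t i - s i) \<le> measure lebesgue (U - Z)"
          proof (rule sum_length_disjoint_le[OF p12(3) U(3) st(2)])
            fix i assume i: "i \<in> p1"
            show "{s i<..<t i} \<subseteq> U - Z" using sub[OF i] K1(4)[OF i] st(4)[OF i] by blast
          qed (use dj in auto)
          also have "\<dots> < \<delta>" by fact
          finally show "(\<Sum>i\<in>p1. t i - s i) < \<delta>" .
        qed
        have "(\<Sum>(x, K)\<in>p. measure lborel K *\<^sub>R g' x) - (f d - f c) = (\<Sum>z\<in>p. D z)"
          unfolding tele[symmetric] by (simp add: D_def split_def sum_subtractf)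
        also have "norm \<dots> \<le> (\<Sum>z\<in>p. norm (D z))" by (rule norm_sum)
        also have "\<dots> = (\<Sum>z\<in>p1. norm (D z)) + (\<Sum>z\<in>p2. norm (D z))"
          using p12 by (metis sum.union_disjoint)
        also have "(\<Sum>z\<in>p1. norm (D z)) = (\<Sum>z\<in>p1. cmod (f (Sup (snd z)) - f (Inf (snd z))))"
          by (intro sum.cong refl) (auto simp: D_def g'_def p1_def norm_minus_commute)
        also have "\<dots> \<le> (\<Sum>z\<in>p1. cmod (f (lo z) - f (Inf (snd z))) + cmod (f (Sup (snd z)) - f (hi z)))"
          by (intro sum_mono cutp(7))
        also have "\<dots> \<le> \<eta> + \<eta>"
          unfolding sum.distrib
        proof (intro add_mono less_imp_le)
          show "(\<Sum>z\<in>p1. cmod (f (lo z) - f (Inf (snd z)))) < \<eta>"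
            using cutp(1,2,5) by (intro small) auto
          show "(\<Sum>z\<in>p1. cmod (f (Sup (snd z)) - f (hi z))) < \<eta>"
            using cutp(3,4,6) by (intro small) auto
        qed
        also have "(\<Sum>z\<in>p2. norm (D z)) \<le> (\<Sum>z\<in>p2. e' * measure lborel (snd z))"
        proof (rule sum_mono)
          fix z assume z: "z \<in> p2"
          obtain x K where xK: "z = (x,K)" by (cases z)
          with z have xp: "(x,K) \<in> p" "x \<notin> N \<union> Z" by (auto simp: p2_def)
          obtain u v where uv: "K = {u..v}" "u \<le> v" "c \<le> u" "v \<le> d" "x \<in> {u..v}" "Sup K = v" "Inf K = u"
            using K[OF xp(1)] by blast
          have x: "x \<in> {c..d} - N - Z" using uv xp by auto
          have "K \<subseteq> ball x (r x)" using fineD[OF fine xp(1)] xp x by (auto simp: \<gamma>_def)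
          then have "u \<in> ball x (r x)" "v \<in> ball x (r x)" using uv by (auto simp: subset_iff)
          then have "norm (f v - f x - (v - x) *\<^sub>R g x) \<le> e' * norm (v - x)"
             "norm (f u - f x - (u - x) *\<^sub>R g x) \<le> e' * norm (u - x)"
            using uv r'[OF x, of v] r'[OF x, of u] by (auto simp: dist_real_def abs_minus_commute)
          \<comment> \<open>Both end points are compared with the tag; as the tag lies between them,
            the two errors add up to at most \<open>e'\<close> times the length of the
            interval.\<close>
          moreover have "D z = (f u - f x - (u - x) *\<^sub>R g x) - (f v - f x - (v - x) *\<^sub>R g x)"
            using uv xp by (simp add: D_def xK g'_def algebra_simps)
          ultimately have "norm (D z) \<le> e' * norm (v - x) + e' * norm (u - x)"
            by (metis (no_types, lifting) add.commute add_mono norm_triangle_ineq4 order_trans)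
          also have "\<dots> = e' * measure lborel K" using uv by (simp add: algebra_simps)
          finally show "norm (D z) \<le> e' * measure lborel (snd z)" by (simp add: xK)
        qed
        also have "\<dots> \<le> (\<Sum>z\<in>p. e' * measure lborel (snd z))"
          using e' by (intro sum_mono2 fp) (auto simp: p2_def)
        also have "\<dots> = e' * measure lborel {c..d}"
          using additive_content_tagged_division[of p c d] p
          by (simp add: sum_distrib_left[symmetric] split_def)
        finally show ?thesis using cd' by (simp add: \<eta>_def e'_def)
      qed
      show ?thesis
      proof (intro exI[of _ \<gamma>] conjI allI impI gauge; elim conjE)
        fix p assume "p tagged_division_of {c..d}" "\<gamma> fine p"
        then show "norm ((\<Sum>(x, K)\<in>p. measure lborel K *\<^sub>R g' x) - (f d - f c)) \<le> e * measure lborel {c..d}"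
          by (rule est)
      qed
    qed
  qed
  then show ?thesis
    by (rule has_integral_spike[OF N, rotated]) (auto simp: g'_def)
qed

lemma fundamental_theorem_of_calculus_abs_continuous:
  fixes f :: "real \<Rightarrow> complex"
  assumes "c \<le> d" "abs_continuous c d f" "negligible N"
    and "\<And>x. x \<in> {c..d} - N \<Longrightarrow> (f has_vector_derivative g x) (at x within {c..d})"
  shows "(g has_integral (f d - f c)) {c..d}"
  using fundamental_theorem_of_calculus_abs_continuous_zero_set[of c d f N "{}" g] assms by simp

text \<open>Absolute continuity of the integral: truncating \<open>h\<close> at a large height
  \<open>n\<close> loses less than \<epsilon>/2 of its integral, and on any family of disjoint
  intervals the truncated function has integral at most \<open>n\<close> times their total
  length.\<close>

lemma abs_continuous_of_integral_bound:
  fixes h :: "real \<Rightarrow> real"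
  assumes h: "h integrable_on {c..d}" and h0: "\<And>x. x \<in> {c..d} \<Longrightarrow> 0 \<le> h x"
    and f: "\<And>s t. \<lbrakk>c \<le> s; s \<le> t; t \<le> d\<rbrakk> \<Longrightarrow> cmod (f t - f s) \<le> integral {s..t} h"
  shows "abs_continuous c d f"
  unfolding abs_continuous_def
proof (intro allI impI)
  fix \<epsilon> :: real assume e: "\<epsilon> > 0"
  have ha: "h absolutely_integrable_on {c..d}"
    using h h0 by (rule nonnegative_absolutely_integrable_1)
  define k where "k n x = min (h x) (real n)" for n x
  have k_int: "k n integrable_on {c..d}" for n
  proof -
    have "(\<lambda>x. h x - real n) absolutely_integrable_on {c..d}"
      using ha by (intro set_integral_diff) auto
    then have "(\<lambda>x. \<bar>h x - real n\<bar>) integrable_on {c..d}"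
      by (simp add: absolutely_integrable_on_def)
    then have "(\<lambda>x. (h x + real n - \<bar>h x - real n\<bar>) / 2) integrable_on {c..d}"
      using h by (intro integrable_on_divide integrable_diff integrable_add) auto
    moreover have "k n = (\<lambda>x. (h x + real n - \<bar>h x - real n\<bar>) / 2)"
      by (auto simp: k_def min_def)
    ultimately show ?thesis by simp
  qed
  have "(\<lambda>n. integral {c..d} (k n)) \<longlonglongrightarrow> integral {c..d} h"
  proof (rule dominated_convergence(2)[OF k_int h])
    show "norm (k n x) \<le> h x" if "x \<in> {c..d}" for n x using h0[OF that] by (auto simp: k_def)
    fix x
    obtain N where "h x < real N" using reals_Archimedean2 by blast
    then have "\<forall>n\<ge>N. k n x = h x" by (auto simp: k_def)
    then show "(\<lambda>n. k n x) \<longlonglongrightarrow> h x"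
      by (intro tendsto_eventually) (auto simp: eventually_sequentially)
  qed
  then obtain n where n: "dist (integral {c..d} (k n)) (integral {c..d} h) < \<epsilon> / 2"
    using e LIMSEQ_D[of _ _ "\<epsilon>/2"] unfolding dist_norm by (meson half_gt_zero order_refl)
  show "\<exists>\<delta>>0. \<forall>(m::nat) s t.
        (\<forall>i<m. c \<le> s i \<and> s i \<le> t i \<and> t i \<le> d) \<and>
        (\<forall>i<m. \<forall>j<m. i \<noteq> j \<longrightarrow> {s i<..<t i} \<inter> {s j<..<t j} = {}) \<and>
        (\<Sum>i<m. t i - s i) < \<delta> \<longrightarrow> (\<Sum>i<m. cmod (f (t i) - f (s i))) < \<epsilon>"
  \<comment> \<open>The added 1 keeps the denominator positive when \<open>n = 0\<close>; what
    matters is that \<open>n\<close> times this length is at most \<epsilon>/2.\<close>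
  proof (intro exI[of _ "\<epsilon> / (2 * (real n + 1))"] conjI allI impI; (elim conjE)?)
    fix m :: nat and s t
    assume st: "\<forall>i<m. c \<le> s i \<and> s i \<le> t i \<and> t i \<le> d"
      and dj: "\<forall>i<m. \<forall>j<m. i \<noteq> j \<longrightarrow> {s i<..<t i} \<inter> {s j<..<t j} = {}"
      and len: "(\<Sum>i<m. t i - s i) < \<epsilon> / (2 * (real n + 1))"
    have sub: "{s i..t i} \<subseteq> {c..d}" if "i < m" for i using st that by auto
    note int_sub = integrable_on_subinterval[OF _ sub]
    have hk: "(\<lambda>x. h x - k n x) integrable_on {c..d}" using h k_int by (intro integrable_diff)
    have hk0: "0 \<le> h x - k n x" for x by (auto simp: k_def)
    have "(\<Sum>i<m. cmod (f (t i) - f (s i))) \<le> (\<Sum>i<m. integral {s i..t i} h)"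
      using st f by (intro sum_mono) auto
    also have "\<dots> = (\<Sum>i<m. integral {s i..t i} (\<lambda>x. h x - k n x) + integral {s i..t i} (k n))"
      using int_sub[OF h] int_sub[OF k_int] by (intro sum.cong refl) (auto simp: integral_diff)
    also have "\<dots> = (\<Sum>i<m. integral {s i..t i} (\<lambda>x. h x - k n x)) + (\<Sum>i<m. integral {s i..t i} (k n))"
      by (rule sum.distrib)
    also have "(\<Sum>i<m. integral {s i..t i} (k n)) \<le> (\<Sum>i<m. real n * (t i - s i))"
    proof (intro sum_mono)
      fix i assume "i \<in> {..<m}"
      then have i: "i < m" by simp
      have "integral {s i..t i} (k n) \<le> integral {s i..t i} (\<lambda>_. real n)"
        using int_sub[OF k_int i] by (intro integral_le) (auto simp: k_def)
      then show "integral {s i..t i} (k n) \<le> real n * (t i - s i)"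
        using st i by (simp add: mult.commute)
    qed
    also have "\<dots> = real n * (\<Sum>i<m. t i - s i)" by (simp add: sum_distrib_left)
    also have "\<dots> \<le> real n * (\<epsilon> / (2 * (real n + 1)))"
      using len by (intro mult_left_mono) auto
    also have "\<dots> \<le> \<epsilon> / 2" using e by (simp add: field_simps)
    also have "(\<Sum>i<m. integral {s i..t i} (\<lambda>x. h x - k n x)) \<le> integral {c..d} (\<lambda>x. h x - k n x)"
    proof -
      have neg: "pairwise (\<lambda>i j. negligible ({s i..t i} \<inter> {s j..t j})) {..<m}"
      proof (clarsimp simp: pairwise_def simp del: Int_atLeastAtMost)
        fix i j assume ij: "i < m" "j < m" "i \<noteq> j"
        have "{s i..t i} \<inter> {s j..t j} \<subseteq> ({s i<..<t i} \<inter> {s j<..<t j}) \<union> {s i, t i, s j, t j}"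
          by (auto simp: not_less)
        then have "{s i..t i} \<inter> {s j..t j} \<subseteq> {s i, t i, s j, t j}" using dj ij by auto
        then show "negligible ({s i..t i} \<inter> {s j..t j})"
          by (rule negligible_subset[rotated]) (auto intro: negligible_finite)
      qed
      have "((\<lambda>x. h x - k n x) has_integral (\<Sum>i<m. integral {s i..t i} (\<lambda>x. h x - k n x))) (\<Union>i<m. {s i..t i})"
        using int_sub[OF hk] neg by (intro has_integral_UN) (auto simp: integrable_integral)
      then show ?thesis
        using hk0 UN_least[of "{..<m}" "\<lambda>i. {s i..t i}" "{c..d}"] sub
        by (intro has_integral_subset_le[OF _ _ integrable_integral[OF hk]]) (simp_all add: lessThan_iff)
    qed
    also have "integral {c..d} (\<lambda>x. h x - k n x) < \<epsilon> / 2"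
      using n integral_diff[OF h k_int[of n]] unfolding dist_real_def by linarith
    finally show "(\<Sum>i<m. cmod (f (t i) - f (s i))) < \<epsilon>" by simp
  qed (use e in auto)
qed

section \<open>Differentiation of indefinite integrals almost everywhere\<close>

text \<open>Intervals on which the difference quotient is bad violate Henstock's lemma in proportion to
  their total length, and the Vitali covering theorem extracts disjoint ones covering the bad set.\<close>

lemma negligible_bad_difference_quotients:
  fixes g :: "real \<Rightarrow> 'a::euclidean_space"
  assumes g: "g integrable_on {c..d}" and \<eta>: "\<eta> > 0"
  shows "negligible {x \<in> {c<..<d}. \<forall>\<delta>>0. \<exists>v\<in>{c..d}. v \<noteq> x \<and> \<bar>v - x\<bar> < \<delta> \<and>
    norm (integral {min x v..max x v} g - \<bar>v - x\<bar> *\<^sub>R g x) > \<eta> * \<bar>v - x\<bar>}" (is "negligible ?S")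
  unfolding negligible_outer_le
proof (intro allI impI)
  fix e :: real assume e: "e > 0"
  have cb: "{c..d} = cbox c d" by simp
  \<comment> \<open>Every bad interval has a Henstock error above \<eta> times its length, so the
    precision \<open>\<eta> * e\<close> bounds the total length of disjoint bad intervals by
    \<open>e\<close>.\<close>
  obtain \<gamma> where \<gamma>: "gauge \<gamma>" and hen: "\<And>p. \<lbrakk>p tagged_partial_division_of {c..d}; \<gamma> fine p\<rbrakk> \<Longrightarrow>
             (\<Sum>(x,k)\<in>p. norm (measure lborel k *\<^sub>R g x - integral k g)) < \<eta> * e"
    by (rule Henstock_lemma[OF g[unfolded cb] mult_pos_pos[OF \<eta> e], folded cb]) (rule that; simp)
  define iv where "iv z = {min (fst z) (snd z)..max (fst z) (snd z)}" for z :: "real \<times> real"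
  \<comment> \<open>A pair consists of a tag in the bad set and the other end of a bad interval;
    midpoint \<open>m\<close> and half-length \<open>r\<close> present this interval as a ball for
    the covering theorem.\<close>
  define K where "K = {z. fst z \<in> ?S \<and> snd z \<in> {c..d} \<and> snd z \<noteq> fst z \<and> iv z \<subseteq> \<gamma> (fst z) \<and>
     norm (integral (iv z) g - \<bar>snd z - fst z\<bar> *\<^sub>R g (fst z)) > \<eta> * \<bar>snd z - fst z\<bar>}"
  define m where "m z = (fst z + snd z) / 2" for z :: "real \<times> real"
  define r where "r z = \<bar>snd z - fst z\<bar> / 2" for z :: "real \<times> real"
  have cball_iv: "cball (m z) (r z) = iv z" for z
    unfolding cball_eq_atLeastAtMost m_def r_def iv_def min_def max_def by (auto simp: field_simps abs_if)
  obtain C where C: "countable C" "C \<subseteq> K"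
     "pairwise (\<lambda>i j. disjnt (cball (m i) (r i)) (cball (m j) (r j))) C"
     "negligible (?S - (\<Union>i \<in> C. cball (m i) (r i)))"
  proof (rule Vitali_covering_theorem_cballs[of K r ?S m])
    show "0 < r z" if "z \<in> K" for z using that by (auto simp: K_def r_def)
    fix x \<delta> assume x: "x \<in> ?S" and d: "(0::real) < \<delta>"
    obtain \<rho> where \<rho>: "\<rho> > 0" "ball x \<rho> \<subseteq> \<gamma> x"
      using \<gamma> unfolding gauge_def by (meson open_contains_ball)
    obtain v where v: "v \<in> {c..d}" "v \<noteq> x" "\<bar>v - x\<bar> < min \<delta> \<rho>"
      "norm (integral {min x v..max x v} g - \<bar>v - x\<bar> *\<^sub>R g x) > \<eta> * \<bar>v - x\<bar>"
    proof -
      have "min \<delta> \<rho> > 0" using d \<rho>(1) by simp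
      then show ?thesis using x that by blast
    qed
    have "iv (x,v) \<subseteq> ball x \<rho>" using v(3) by (auto simp: iv_def dist_real_def)
    then have "(x,v) \<in> K" using v x \<rho> by (auto simp: K_def iv_def)
    moreover have "x \<in> cball (m (x,v)) (r (x,v))" by (auto simp: cball_iv iv_def)
    moreover have "r (x,v) < \<delta>" using v(3) by (auto simp: r_def)
    ultimately show "\<exists>i. i \<in> K \<and> x \<in> cball (m i) (r i) \<and> r i < \<delta>" by blast
  qed
  have fin: "measure lebesgue (\<Union>i\<in>F. iv i) \<le> e" if F: "F \<subseteq> C" "finite F" for F
  proof -
    have FK: "z \<in> K" if "z \<in> F" for z using that F C by blast
    have dj: "iv i \<inter> iv j = {}" if "i \<in> F" "j \<in> F" "i \<noteq> j" for i j
      using that F C(3) unfolding pairwise_def cball_iv disjnt_def by blast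
    define p where "p = (\<lambda>z. (fst z, iv z)) ` F"
    have ne: "fst z \<in> iv z" for z by (auto simp: iv_def)
    have inj: "inj_on (\<lambda>z. (fst z, iv z)) F"
      using dj ne by (fastforce simp: inj_on_def)
    have "p tagged_partial_division_of {c..d}"
      unfolding tagged_partial_division_of_def
    proof (intro conjI allI impI)
      show "finite p" using F by (simp add: p_def)
      fix x k assume "(x,k) \<in> p"
      then obtain z where z: "z \<in> F" "x = fst z" "k = iv z" by (auto simp: p_def)
      show "x \<in> k" using z ne by simp
      show "k \<subseteq> {c..d}" using z FK[OF z(1)] by (auto simp: iv_def K_def)
      show "\<exists>a b. k = cbox a b" using z by (auto simp: iv_def)
    next
      fix x k x' k' assume xk: "(x,k) \<in> p \<and> (x',k') \<in> p \<and> (x, k) \<noteq> (x', k')"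
      then obtain z where z: "z \<in> F" "x = fst z" "k = iv z" by (auto simp: p_def)
      from xk obtain z' where z': "z' \<in> F" "x' = fst z'" "k' = iv z'" by (auto simp: p_def)
      have "k \<inter> k' = {}" using dj[of z z'] z z' xk by auto
      then show "interior k \<inter> interior k' = {}" using interior_subset by blast
    qed
    moreover have "\<gamma> fine p" using FK by (auto simp: fine_def p_def K_def)
    ultimately have "(\<Sum>(x,k)\<in>p. norm (measure lborel k *\<^sub>R g x - integral k g)) < \<eta> * e" by (rule hen)
    then have sum: "(\<Sum>z\<in>F. norm (measure lborel (iv z) *\<^sub>R g (fst z) - integral (iv z) g)) < \<eta> * e"
      unfolding p_def by (subst (asm) sum.reindex[OF inj]) (simp add: o_def)
    have len: "measure lborel (iv z) = \<bar>snd z - fst z\<bar>" for z by (auto simp: iv_def min_def max_def)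
    have "\<eta> * measure lebesgue (\<Union>i\<in>F. iv i) \<le> \<eta> * (\<Sum>z\<in>F. \<bar>snd z - fst z\<bar>)"
      using \<eta> measure_UNION_le[OF F(2), of iv lebesgue] len by (intro mult_left_mono) (auto simp: iv_def)
    also have "\<dots> = (\<Sum>z\<in>F. \<eta> * \<bar>snd z - fst z\<bar>)" by (rule sum_distrib_left)
    also have "\<dots> \<le> (\<Sum>z\<in>F. norm (measure lborel (iv z) *\<^sub>R g (fst z) - integral (iv z) g))"
    proof (rule sum_mono)
      fix z assume "z \<in> F"
      then have "\<eta> * \<bar>snd z - fst z\<bar> < norm (integral (iv z) g - \<bar>snd z - fst z\<bar> *\<^sub>R g (fst z))"
        using FK[of z] by (simp add: K_def)
      then show "\<eta> * \<bar>snd z - fst z\<bar> \<le> norm (measure lborel (iv z) *\<^sub>R g (fst z) - integral (iv z) g)"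
        unfolding len norm_minus_commute[of "integral (iv z) g"] by (rule less_imp_le)
    qed
    also have "\<dots> \<le> \<eta> * e" using sum by simp
    finally show ?thesis using \<eta> by simp
  qed
  have lm: "iv i \<in> lmeasurable" for i by (simp add: iv_def)
  let ?N = "?S - (\<Union>i\<in>C. iv i)" and ?U = "\<Union>i\<in>C. iv i"
  have N: "negligible ?N" using C(4) by (simp only: cball_iv)
  have U: "?U \<in> lmeasurable" "measure lebesgue ?U \<le> e"
    using fmeasurable_UN_bound[OF C(1) lm fin] measure_UN_bound[OF C(1) lm fin] by auto
  show "\<exists>T. ?S \<subseteq> T \<and> T \<in> lmeasurable \<and> measure lebesgue T \<le> e"
  proof (intro exI[of _ "?U \<union> ?N"] conjI)
    show "?S \<subseteq> ?U \<union> ?N" by blast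
    show "?U \<union> ?N \<in> lmeasurable" by (rule fmeasurable.Un[OF U(1) negligible_imp_measurable[OF N]])
    have "measure lebesgue (?U \<union> ?N) \<le> measure lebesgue ?U + measure lebesgue ?N"
      by (rule measure_Un_le[OF fmeasurableD[OF U(1)] negligible_imp_sets[OF N]])
    then show "measure lebesgue (?U \<union> ?N) \<le> e" using U(2) negligible_imp_measure0[OF N] by simp
  qed
qed

text \<open>Lebesgue differentiation for the gauge integral: outside the bad sets for the thresholds
  1, 1/2, 1/3, ... the error of the difference quotient falls below every positive bound.\<close>

lemma indefinite_integral_has_vector_derivative_ae:
  fixes g :: "real \<Rightarrow> 'a::euclidean_space"
  assumes g: "g integrable_on {c..d}"
  obtains N where "negligible N"
    "\<And>x. x \<in> {c<..<d} - N \<Longrightarrow> ((\<lambda>x. integral {c..x} g) has_vector_derivative g x) (at x)"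
proof -
  define S where "S \<eta> = {x \<in> {c<..<d}. \<forall>\<delta>>0. \<exists>v\<in>{c..d}. v \<noteq> x \<and> \<bar>v - x\<bar> < \<delta> \<and>
    norm (integral {min x v..max x v} g - \<bar>v - x\<bar> *\<^sub>R g x) > \<eta> * \<bar>v - x\<bar>}" for \<eta>
  show ?thesis
  proof (rule that)
    show "negligible (\<Union>n. S (inverse (real (Suc n))))"
      unfolding S_def by (intro negligible_Union_nat negligible_bad_difference_quotients[OF g]) simp
    fix x assume x: "x \<in> {c<..<d} - (\<Union>n. S (inverse (real (Suc n))))"
    have "((\<lambda>x. integral {c..x} g) has_vector_derivative g x) (at x within {c<..<d})"
      unfolding has_vector_derivative_def has_derivative_within_alt
    proof (intro conjI allI impI)
      show "bounded_linear (\<lambda>h. h *\<^sub>R g x)" by (rule bounded_linear_scaleR_left)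
      fix e :: real assume "e > 0"
      then obtain n where n: "inverse (real (Suc n)) < e" using reals_Archimedean by blast
      then obtain \<delta> where \<delta>: "\<delta> > 0" and le: "\<And>v. \<lbrakk>v \<in> {c..d}; v \<noteq> x; \<bar>v - x\<bar> < \<delta>\<rbrakk> \<Longrightarrow>
          norm (integral {min x v..max x v} g - \<bar>v - x\<bar> *\<^sub>R g x) \<le> inverse (real (Suc n)) * \<bar>v - x\<bar>"
      proof -
        have "x \<notin> S (inverse (real (Suc n)))" "x \<in> {c<..<d}" using x by blast+
        then obtain \<delta> where "\<delta> > 0" "\<forall>v\<in>{c..d}. \<not> (v \<noteq> x \<and> \<bar>v - x\<bar> < \<delta> \<and>
          norm (integral {min x v..max x v} g - \<bar>v - x\<bar> *\<^sub>R g x) > inverse (real (Suc n)) * \<bar>v - x\<bar>)"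
          unfolding S_def by blast
        then show ?thesis by (intro that) (auto simp: not_less)
      qed
      have "norm (integral {c..y} g - integral {c..x} g - (y - x) *\<^sub>R g x) \<le> e * norm (y - x)"
        if y: "y \<in> {c<..<d}" "norm (y - x) < \<delta>" for y
      proof (cases "y = x")
        case False
        have sub: "g integrable_on {c..v}" if "v \<le> d" for v
          using integrable_on_subinterval[OF g, of c v] that by auto
        have "norm (integral {c..y} g - integral {c..x} g - (y - x) *\<^sub>R g x) =
            norm (integral {min x y..max x y} g - \<bar>y - x\<bar> *\<^sub>R g x)"
        proof (cases "x \<le> y")
          case True
          have "integral {c..x} g + integral {x..y} g = integral {c..y} g"
            using x y True sub[of y] by (intro Henstock_Kurzweil_Integration.integral_combine) auto
          then have "integral {x..y} g = integral {c..y} g - integral {c..x} g" by (simp add: algebra_simps)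
          then show ?thesis using True by (simp add: min_def max_def)
        next
          case le: False
          have "integral {c..y} g + integral {y..x} g = integral {c..x} g"
            using x y le sub[of x] by (intro Henstock_Kurzweil_Integration.integral_combine) auto
          then have "integral {c..y} g - integral {c..x} g - (y - x) *\<^sub>R g x =
              - (integral {min x y..max x y} g - \<bar>y - x\<bar> *\<^sub>R g x)"
            using le by (auto simp: min_def max_def algebra_simps)
          then show ?thesis by (simp only: norm_minus_cancel)
        qed
        also have "\<dots> \<le> inverse (real (Suc n)) * \<bar>y - x\<bar>" using y False by (intro le) auto
        also have "\<dots> \<le> e * norm (y - x)" using n by (simp add: mult_right_mono)
        finally show ?thesis .
      qed simp
      with \<delta> show "\<exists>\<delta>>0. \<forall>y\<in>{c<..<d}. norm (y - x) < \<delta> \<longrightarrow>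
          norm (integral {c..y} g - integral {c..x} g - (y - x) *\<^sub>R g x) \<le> e * norm (y - x)" by blast
    qed
    then show "((\<lambda>x. integral {c..x} g) has_vector_derivative g x) (at x)"
      using x at_within_open[of x "{c<..<d}"] by auto
  qed
qed

lemma abs_continuous_diff:
  assumes "abs_continuous c d f" "abs_continuous c d g"
  shows "abs_continuous c d (\<lambda>x. f x - g x)"
  unfolding abs_continuous_def
proof (intro allI impI)
  fix \<epsilon> :: real assume "\<epsilon> > 0"
  then have e: "\<epsilon> / 2 > 0" by simp
  obtain \<delta>1 where D1: "\<delta>1 > 0 \<and> (\<forall>(n::nat) s t.
        (\<forall>i<n. c \<le> s i \<and> s i \<le> t i \<and> t i \<le> d) \<and>
        (\<forall>i<n. \<forall>j<n. i \<noteq> j \<longrightarrow> {s i<..<t i} \<inter> {s j<..<t j} = {}) \<and>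
        (\<Sum>i<n. t i - s i) < \<delta>1 \<longrightarrow> (\<Sum>i<n. cmod (f (t i) - f (s i))) < \<epsilon> / 2)"
    using assms(1)[unfolded abs_continuous_def, THEN spec, THEN mp, OF e] by (rule exE)
  obtain \<delta>2 where D2: "\<delta>2 > 0 \<and> (\<forall>(n::nat) s t.
        (\<forall>i<n. c \<le> s i \<and> s i \<le> t i \<and> t i \<le> d) \<and>
        (\<forall>i<n. \<forall>j<n. i \<noteq> j \<longrightarrow> {s i<..<t i} \<inter> {s j<..<t j} = {}) \<and>
        (\<Sum>i<n. t i - s i) < \<delta>2 \<longrightarrow> (\<Sum>i<n. cmod (g (t i) - g (s i))) < \<epsilon> / 2)"
    using assms(2)[unfolded abs_continuous_def, THEN spec, THEN mp, OF e] by (rule exE)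
  show "\<exists>\<delta>>0. \<forall>(n::nat) s t.
        (\<forall>i<n. c \<le> s i \<and> s i \<le> t i \<and> t i \<le> d) \<and>
        (\<forall>i<n. \<forall>j<n. i \<noteq> j \<longrightarrow> {s i<..<t i} \<inter> {s j<..<t j} = {}) \<and>
        (\<Sum>i<n. t i - s i) < \<delta> \<longrightarrow> (\<Sum>i<n. cmod (f (t i) - g (t i) - (f (s i) - g (s i)))) < \<epsilon>"
  proof (intro exI[of _ "min \<delta>1 \<delta>2"] conjI allI impI; (elim conjE)?)
    show "0 < min \<delta>1 \<delta>2" using D1[THEN conjunct1] D2[THEN conjunct1] by simp
    fix n :: nat and s t
    assume *: "\<forall>i<n. c \<le> s i \<and> s i \<le> t i \<and> t i \<le> d"
      "\<forall>i<n. \<forall>j<n. i \<noteq> j \<longrightarrow> {s i<..<t i} \<inter> {s j<..<t j} = {}" "(\<Sum>i<n. t i - s i) < min \<delta>1 \<delta>2"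
    have 3: "(\<Sum>i<n. t i - s i) < \<delta>1" "(\<Sum>i<n. t i - s i) < \<delta>2" using *(3) by simp_all
    have "(\<Sum>i<n. cmod (f (t i) - g (t i) - (f (s i) - g (s i)))) =
        (\<Sum>i<n. cmod ((f (t i) - f (s i)) - (g (t i) - g (s i))))"
      by (intro sum.cong) (simp_all add: algebra_simps)
    also have "\<dots> \<le> (\<Sum>i<n. cmod (f (t i) - f (s i)) + cmod (g (t i) - g (s i)))"
      by (intro sum_mono norm_triangle_ineq4)
    also have "\<dots> = (\<Sum>i<n. cmod (f (t i) - f (s i))) + (\<Sum>i<n. cmod (g (t i) - g (s i)))"
      by (rule sum.distrib)
    also have "\<dots> < \<epsilon> / 2 + \<epsilon> / 2"
      by (intro add_strict_mono
          D1[THEN conjunct2, THEN spec, THEN spec, THEN spec, THEN mp, OF conjI[OF *(1) conjI[OF *(2) 3(1)]]]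
          D2[THEN conjunct2, THEN spec, THEN spec, THEN spec, THEN mp, OF conjI[OF *(1) conjI[OF *(2) 3(2)]]])
    finally show "(\<Sum>i<n. cmod (f (t i) - g (t i) - (f (s i) - g (s i)))) < \<epsilon>" by simp
  qed
qed

section \<open>Functions with increments dominated by an integral\<close>

text \<open>The form in which absolute continuity of w is carried along. The primitive of the
  density is a continuous monotone majorant of the variation, on which the mean \<open>avg\<close>
  can act, and the class is stable under differences and under division by 1 - a cos x.\<close>

definition integral_variation :: "(real \<Rightarrow> complex) \<Rightarrow> bool" where
  "integral_variation f \<longleftrightarrow> (\<exists>k. k integrable_on {-pi..pi} \<and> (\<forall>x\<in>{-pi..pi}. 0 \<le> k x) \<and>
     (\<forall>s t. -pi \<le> s \<longrightarrow> s \<le> t \<longrightarrow> t \<le> pi \<longrightarrow> cmod (f t - f s) \<le> integral {s..t} k))"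

lemma integral_variationE:
  assumes "integral_variation f"
  obtains k where "k integrable_on {-pi..pi}" "\<And>x. x \<in> {-pi..pi} \<Longrightarrow> 0 \<le> k x"
    "\<And>s t. \<lbrakk>-pi \<le> s; s \<le> t; t \<le> pi\<rbrakk> \<Longrightarrow> cmod (f t - f s) \<le> integral {s..t} k"
    "continuous_on {-pi..pi} (\<lambda>x. integral {-pi..x} k)"
    "\<And>s t. \<lbrakk>-pi \<le> s; s \<le> t; t \<le> pi\<rbrakk> \<Longrightarrow> integral {s..t} k = integral {-pi..t} k - integral {-pi..s} k"
proof -
  obtain k where k: "k integrable_on {-pi..pi}" "\<forall>x\<in>{-pi..pi}. 0 \<le> k x"
     "\<forall>s t. -pi \<le> s \<longrightarrow> s \<le> t \<longrightarrow> t \<le> pi \<longrightarrow> cmod (f t - f s) \<le> integral {s..t} k"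
    using assms unfolding integral_variation_def by blast
  show ?thesis
  proof (rule that)
    show "continuous_on {-pi..pi} (\<lambda>x. integral {-pi..x} k)"
      by (rule indefinite_integral_continuous_1[OF k(1)])
    fix s t :: real assume st: "-pi \<le> s" "s \<le> t" "t \<le> pi"
    have "k integrable_on {-pi..t}" using k(1) st by (auto intro: integrable_on_subinterval)
    then show "integral {s..t} k = integral {-pi..t} k - integral {-pi..s} k"
      using Henstock_Kurzweil_Integration.integral_combine[of "-pi" s t k] st by simp
  qed (use k in auto)
qed

lemma integral_variation_abs_continuous:
  assumes "integral_variation f"
  shows "abs_continuous (-pi) pi f"
proof -
  obtain k where "k integrable_on {-pi..pi}" "\<And>x. x \<in> {-pi..pi} \<Longrightarrow> 0 \<le> k x"
     "\<And>s t. \<lbrakk>-pi \<le> s; s \<le> t; t \<le> pi\<rbrakk> \<Longrightarrow> cmod (f t - f s) \<le> integral {s..t} k"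
    using integral_variationE[OF assms] by metis
  then show ?thesis by (rule abs_continuous_of_integral_bound)
qed

lemma integral_variation_continuous: "integral_variation f \<Longrightarrow> continuous_on {-pi..pi} f"
  by (intro abs_continuous_imp_continuous_on integral_variation_abs_continuous)

lemma integral_variation_lipschitz:
  assumes "\<And>s t. s \<le> t \<Longrightarrow> cmod (f t - f s) \<le> C * (t - s)"
  shows "integral_variation f"
proof -
  have "0 \<le> C" using assms[of 0 1] norm_ge_zero[of "f 1 - f 0"] by (auto simp del: norm_ge_zero)
  then show ?thesis
    unfolding integral_variation_def using assms
    by (intro exI[of _ "\<lambda>_. C"]) (auto simp: mult.commute)
qed

lemma integral_variation_diff:
  assumes "integral_variation f" "integral_variation g"
  shows "integral_variation (\<lambda>x. f x - g x)"
proof -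
  obtain k where k: "k integrable_on {-pi..pi}" "\<And>x. x \<in> {-pi..pi} \<Longrightarrow> 0 \<le> k x"
     "\<And>s t. \<lbrakk>-pi \<le> s; s \<le> t; t \<le> pi\<rbrakk> \<Longrightarrow> cmod (f t - f s) \<le> integral {s..t} k"
    using integral_variationE[OF assms(1)] by metis
  obtain l where l: "l integrable_on {-pi..pi}" "\<And>x. x \<in> {-pi..pi} \<Longrightarrow> 0 \<le> l x"
     "\<And>s t. \<lbrakk>-pi \<le> s; s \<le> t; t \<le> pi\<rbrakk> \<Longrightarrow> cmod (g t - g s) \<le> integral {s..t} l"
    using integral_variationE[OF assms(2)] by metis
  show ?thesis
    unfolding integral_variation_def
  proof (intro exI[of _ "\<lambda>x. k x + l x"] conjI ballI allI impI integrable_add k(1) l(1))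
    fix s t :: real assume st: "-pi \<le> s" "s \<le> t" "t \<le> pi"
    have "f t - g t - (f s - g s) = (f t - f s) - (g t - g s)" by simp
    then have "cmod (f t - g t - (f s - g s)) \<le> cmod (f t - f s) + cmod (g t - g s)"
      using norm_triangle_ineq4[of "f t - f s" "g t - g s"] by (simp only:)
    also have "\<dots> \<le> integral {s..t} k + integral {s..t} l" using k(3)[OF st] l(3)[OF st] by simp
    also have "\<dots> = integral {s..t} (\<lambda>x. k x + l x)"
      using st by (intro integral_add[symmetric] integrable_on_subinterval[OF k(1)] integrable_on_subinterval[OF l(1)]) auto
    finally show "cmod (f t - g t - (f s - g s)) \<le> integral {s..t} (\<lambda>x. k x + l x)" .
  qed (use k l in auto)
qed

section \<open>Square-integrable functions\<close>

lemma AE_mu_iff_negligible: "(AE x in mu. P x) \<longleftrightarrow> negligible {x \<in> {-pi<..<pi}. \<not> P x}"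
proof -
  have "(AE x in mu. P x) \<longleftrightarrow> (AE x in lebesgue. x \<in> {-pi<..<pi} \<longrightarrow> P x)"
    by (simp add: AE_restrict_space_iff)
  also have "\<dots> \<longleftrightarrow> negligible {x \<in> {-pi<..<pi}. \<not> P x}"
    by (simp add: completion.AE_iff_null_sets negligible_iff_null_sets)
  finally show ?thesis .
qed

lemma integrable_mu_iff:
  fixes f :: "real \<Rightarrow> 'a::euclidean_space"
  shows "integrable mu f \<longleftrightarrow> f absolutely_integrable_on {-pi..pi}"
proof -
  have "integrable mu f \<longleftrightarrow> f absolutely_integrable_on {-pi<..<pi}"
    by (simp add: integrable_restrict_space set_integrable_def)
  then show ?thesis by (simp add: absolutely_integrable_on_def integrable_on_Icc_iff_Ioo)
qed

lemma integral_mu_eq: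
  fixes f :: "real \<Rightarrow> 'a::euclidean_space"
  assumes "integrable mu f"
  shows "integral\<^sup>L mu f = integral {-pi..pi} f"
proof -
  have "f absolutely_integrable_on {-pi<..<pi}"
    using assms by (simp add: integrable_restrict_space set_integrable_def)
  then have "(LINT x:{-pi<..<pi}|lebesgue. f x) = integral {-pi<..<pi} f"
    by (rule set_lebesgue_integral_eq_integral(2))
  then show ?thesis
    by (simp add: integral_restrict_space set_lebesgue_integral_def integral_open_interval_real)
qed

lemma sq_int_absolutely_integrable:
  assumes "sq_int f"
  shows "f absolutely_integrable_on {-pi..pi}" "(\<lambda>x. (cmod (f x))\<^sup>2) absolutely_integrable_on {-pi..pi}"
proof -
  show sq: "(\<lambda>x. (cmod (f x))\<^sup>2) absolutely_integrable_on {-pi..pi}"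
    using assms by (simp add: sq_int_def flip: integrable_mu_iff)
  have "(\<lambda>x. 1 + (cmod (f x))\<^sup>2) absolutely_integrable_on {-pi..pi}"
    by (intro set_integral_add sq) auto
  then have "integrable mu (\<lambda>x. 1 + (cmod (f x))\<^sup>2)" by (simp only: integrable_mu_iff)
  then have "integrable mu f"
  proof (rule Bochner_Integration.integrable_bound)
    show "f \<in> borel_measurable mu" using assms by (simp add: sq_int_def)
    have "cmod z \<le> 1 + (cmod z)\<^sup>2" for z
    proof -
      have "2 * cmod z \<le> 1 + (cmod z)\<^sup>2" using sum_squares_bound[of 1 "cmod z"] by simp
      then show ?thesis using norm_ge_zero[of z] by linarith
    qed
    then show "AE x in mu. norm (f x) \<le> norm (1 + (cmod (f x))\<^sup>2)" by (auto intro!: AE_I2)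
  qed
  then show "f absolutely_integrable_on {-pi..pi}" by (simp only: integrable_mu_iff)
qed

lemma sq_int_integrable_subinterval:
  assumes "sq_int f" "-pi \<le> s" "t \<le> pi"
  shows "f integrable_on {s..t}" "(\<lambda>x. cmod (f x)) integrable_on {s..t}"
    "(\<lambda>x. (cmod (f x))\<^sup>2) integrable_on {s..t}"
  using sq_int_absolutely_integrable[OF assms(1)] assms(2,3)
  by (auto simp: absolutely_integrable_on_def intro: integrable_on_subinterval)

lemma sq_int_continuous:
  assumes "continuous_on {-pi..pi} f"
  shows "sq_int f"
proof -
  have "f \<in> borel_measurable mu"
    by (intro continuous_imp_measurable_on_sets_lebesgue continuous_on_subset[OF assms]) auto
  moreover have "(\<lambda>x. (cmod (f x))\<^sup>2) absolutely_integrable_on {-pi..pi}"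
    using assms by (intro absolutely_integrable_continuous_real continuous_intros)
  ultimately show ?thesis by (simp add: sq_int_def integrable_mu_iff)
qed

lemma l2_rel_refl: "l2_rel f f \<longleftrightarrow> sq_int f"
  by (simp add: l2_rel_def)

lemma l2_representative: obtains f where "sq_int f" "u = abs_l2 f"
  using Quotient3_abs_rep[OF Quotient3_l2, of u] Quotient3_rep_reflp[OF Quotient3_l2, of u]
  by (metis l2_rel_refl)

lemma abs_l2_add: "sq_int f \<Longrightarrow> sq_int g \<Longrightarrow> abs_l2 f + abs_l2 g = abs_l2 (\<lambda>x. f x + g x)"
  by (rule plus_l2.abs_eq) (simp_all add: l2_rel_refl)

lemma abs_l2_scaleC: "sq_int f \<Longrightarrow> c *\<^sub>C abs_l2 f = abs_l2 (\<lambda>x. c * f x)"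
  by (rule scaleC.abs_eq) (simp add: l2_rel_refl)

lemma uminus_l2_eq: "- u = (- 1) *\<^sub>C (u :: l2)"
  by (rule uminus_l2_def)

lemma abs_l2_diff:
  assumes "sq_int f" "sq_int g"
  shows "abs_l2 f - abs_l2 g = abs_l2 (\<lambda>x. f x - g x)"
  using abs_l2_add[OF assms(1) sq_int_cmult[OF assms(2), of "-1"]]
  by (simp add: minus_l2_def uminus_l2_eq abs_l2_scaleC assms)

lemma sq_int_diff: "sq_int f \<Longrightarrow> sq_int g \<Longrightarrow> sq_int (\<lambda>x. f x - g x)"
  using sq_int_add[of f "\<lambda>x. -1 * g x"] sq_int_cmult[of g "-1"] by simp

lemma abs_l2_zero: "0 = abs_l2 (\<lambda>_. 0)"
  by (simp add: zero_l2_def)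

lemma cinner_abs_l2: "sq_int f \<Longrightarrow> sq_int g \<Longrightarrow> cinner (abs_l2 f) (abs_l2 g) = (LINT x|mu. f x * cnj (g x))"
  by (rule cinner.abs_eq) (simp_all add: l2_rel_refl)

lemma norm_abs_l2_sq:
  assumes "sq_int f"
  shows "(norm (abs_l2 f))\<^sup>2 = integral {-pi..pi} (\<lambda>x. (cmod (f x))\<^sup>2)"
proof -
  have i: "integrable mu (\<lambda>x. (cmod (f x))\<^sup>2)" using assms by (simp add: sq_int_def)
  have "Re (cinner (abs_l2 f) (abs_l2 f)) = integral {-pi..pi} (\<lambda>x. (cmod (f x))\<^sup>2)"
    using assms i by (simp add: cinner_abs_l2 cinner_self_eq integral_mu_eq)
  moreover have "0 \<le> integral {-pi..pi} (\<lambda>x. (cmod (f x))\<^sup>2)"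
    by (rule Henstock_Kurzweil_Integration.integral_nonneg)
      (use sq_int_integrable_subinterval[OF assms] in auto)
  ultimately show ?thesis by (simp add: norm_l2_def inner_l2_def)
qed

lemma norm_abs_l2_le:
  assumes "sq_int f" "\<And>x. x \<in> {-pi<..<pi} \<Longrightarrow> cmod (f x) \<le> C"
  shows "norm (abs_l2 f) \<le> sqrt (2 * pi) * C"
proof -
  have C: "0 \<le> C" using assms(2)[of 0] norm_ge_zero[of "f 0"] by (auto simp del: norm_ge_zero)
  have "(norm (abs_l2 f))\<^sup>2 = integral {-pi<..<pi} (\<lambda>x. (cmod (f x))\<^sup>2)"
    by (simp add: norm_abs_l2_sq assms(1) integral_open_interval_real)
  also have "\<dots> \<le> integral {-pi<..<pi} (\<lambda>x. C\<^sup>2)"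
    using sq_int_integrable_subinterval(3)[OF assms(1), of "-pi" pi] integrable_const_ivl[of "C\<^sup>2" "-pi" "pi"] assms(2)
    by (intro integral_le power_mono) (auto simp: integrable_on_Icc_iff_Ioo)
  also have "\<dots> = (sqrt (2 * pi) * C)\<^sup>2"
    by (simp add: power_mult_distrib flip: integral_open_interval_real)
  finally show ?thesis
    using C by (simp add: power2_le_iff_abs_le)
qed

text \<open>Cauchy-Schwarz against the constant 1, obtained by integrating |f| \<le> k/2 +
  |f|^2/(2k) and optimizing in k.\<close>

lemma integral_cmod_le_norm:
  assumes f: "sq_int f" and st: "-pi \<le> s" "s \<le> t" "t \<le> pi"
  shows "integral {s..t} (\<lambda>x. cmod (f x)) \<le> sqrt (t - s) * norm (abs_l2 f)"
proof -
  let ?N = "norm (abs_l2 f)" and ?I = "integral {s..t} (\<lambda>x. cmod (f x))"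
  note int = sq_int_integrable_subinterval[OF f st(1,3)]
  have sq: "integral {s..t} (\<lambda>x. (cmod (f x))\<^sup>2) \<le> ?N\<^sup>2"
    unfolding norm_abs_l2_sq[OF f]
    using st sq_int_integrable_subinterval(3)[OF f] by (intro integral_subset_le) auto
  have bound: "?I \<le> k * (t - s) / 2 + ?N\<^sup>2 / (2 * k)" if k: "k > 0" for k
  proof -
    have "?I \<le> integral {s..t} (\<lambda>x. k / 2 + (cmod (f x))\<^sup>2 / (2 * k))"
    proof (rule integral_le)
      show "(\<lambda>x. k / 2 + (cmod (f x))\<^sup>2 / (2 * k)) integrable_on {s..t}"
        by (intro integrable_add integrable_on_divide int) auto
      fix x
      have "k\<^sup>2 + (cmod (f x))\<^sup>2 - 2 * k * cmod (f x) \<ge> 0"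
        using sum_squares_bound[of k "cmod (f x)"] by simp
      then show "cmod (f x) \<le> k / 2 + (cmod (f x))\<^sup>2 / (2 * k)"
        using k by (simp add: field_simps power2_eq_square)
    qed (rule int)
    also have "\<dots> = k * (t - s) / 2 + integral {s..t} (\<lambda>x. (cmod (f x))\<^sup>2) / (2 * k)"
      using st int by (subst integral_add) (auto intro!: integrable_on_divide)
    also have "\<dots> \<le> k * (t - s) / 2 + ?N\<^sup>2 / (2 * k)"
      using sq k by (intro add_left_mono divide_right_mono) auto
    finally show ?thesis .
  qed
  show ?thesis
  proof (cases "s = t \<or> ?N = 0")
    case False
    with st have p: "sqrt (t - s) > 0" "?N > 0" by auto
    \<comment> \<open>This \<open>k\<close> makes the two terms equal, which is the optimum; it is
      positive only if \<open>?N\<close> is nonzero and defined only if \<open>s < t\<close>, hence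
      the separate cases.\<close>
    have "?I \<le> ?N / sqrt (t - s) * (t - s) / 2 + ?N\<^sup>2 / (2 * (?N / sqrt (t - s)))"
      using p by (intro bound) auto
    also have "\<dots> = sqrt (t - s) * ?N"
    proof -
      have *: "N / q * (q * q) / 2 + N\<^sup>2 / (2 * (N / q)) = q * N" if "q > 0" "N > 0" for q N :: real
        using that by (simp add: field_simps power2_eq_square)
      have "t - s = sqrt (t - s) * sqrt (t - s)" using st by simp
      then show ?thesis using *[OF p] by simp
    qed
    finally show ?thesis .
  next
    case True
    show ?thesis
    proof (cases "s = t")
      case False
      then have N: "?N = 0" using True by simp
      have "?I \<le> 0 + e" if "e > 0" for e
      proof -
        \<comment> \<open>With zero norm only the first term of the bound is left, and this
          \<open>k\<close> makes it equal to \<open>e\<close>.\<close>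
        have "?I \<le> 2 * e / (t - s) * (t - s) / 2"
          using bound[of "2 * e / (t - s)"] that False st by (simp add: N)
        then show ?thesis using False st by simp
      qed
      then have "?I \<le> 0" by (rule field_le_epsilon)
      then show ?thesis by (simp add: N)
    qed simp
  qed
qed

section \<open>Primitives of square-integrable functions\<close>

definition prim :: "(real \<Rightarrow> complex) \<Rightarrow> real \<Rightarrow> complex" where
  "prim f x = integral {-pi..x} f"

lemma prim_start [simp]: "prim f (- pi) = 0"
  by (simp add: prim_def)

lemma prim_diff_eq:
  assumes f: "sq_int f" and "-pi \<le> s" "s \<le> t" "t \<le> pi"
  shows "prim f t - prim f s = integral {s..t} f"
  using Henstock_Kurzweil_Integration.integral_combine[of "-pi" s t f] assms sq_int_integrable_subinterval(1)[OF f, of "-pi" t]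
  by (simp add: prim_def algebra_simps)

lemma prim_variation:
  assumes f: "sq_int f" and st: "-pi \<le> s" "s \<le> t" "t \<le> pi"
  shows "cmod (prim f t - prim f s) \<le> integral {s..t} (\<lambda>x. cmod (f x))"
  unfolding prim_diff_eq[OF assms] using sq_int_integrable_subinterval[OF f st(1,3)]
  by (intro integral_norm_bound_integral) auto

lemma integral_variation_prim:
  assumes "sq_int f"
  shows "integral_variation (\<lambda>x. c + prim f x)"
  unfolding integral_variation_def using prim_variation[OF assms]
  by (intro exI[of _ "\<lambda>x. cmod (f x)"]) (use sq_int_integrable_subinterval(2)[OF assms, of "-pi" pi] in auto)

lemma abs_sin_diff_le: "\<bar>sin s - sin t\<bar> \<le> \<bar>s - t\<bar>" and abs_cos_diff_le: "\<bar>cos s - cos t\<bar> \<le> \<bar>s - t\<bar>" for s t :: real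
proof -
  have *: "\<bar>2 * u * v\<bar> \<le> \<bar>s - t\<bar>" if "\<bar>u\<bar> \<le> 1" "\<bar>v\<bar> \<le> \<bar>s - t\<bar> / 2" for u v :: real
    using mult_mono[OF that] by (simp add: abs_mult)
  have "sin s - sin t = 2 * cos ((s + t) / 2) * sin ((s - t) / 2)"
    by (simp add: sin_diff_sin)
  then show "\<bar>sin s - sin t\<bar> \<le> \<bar>s - t\<bar>"
    using abs_sin_x_le_abs_x[of "(s - t) / 2"] by (simp only:) (rule *, auto)
  have "cos s - cos t = 2 * sin ((s + t) / 2) * sin ((t - s) / 2)"
    by (rule cos_diff_cos)
  then show "\<bar>cos s - cos t\<bar> \<le> \<bar>s - t\<bar>"
    using abs_sin_x_le_abs_x[of "(t - s) / 2"] by (simp only:) (rule *, auto)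
qed

lemma sq_int_prim_continuous:
  assumes "sq_int f" shows "continuous_on {-pi..pi} (prim f)"
  using integral_variation_continuous[OF integral_variation_prim[OF assms, of 0]] by simp

lemma prim_add:
  assumes "sq_int f" "sq_int g" "x \<in> {-pi..pi}"
  shows "prim (\<lambda>x. f x + g x) x = prim f x + prim g x"
  unfolding prim_def using assms by (intro integral_add sq_int_integrable_subinterval) auto

lemma prim_mult: "prim (\<lambda>x. c * f x) x = c * prim f x"
  unfolding prim_def by (rule integral_mult_right)

lemma prim_diff:
  assumes "sq_int f" "sq_int g" "x \<in> {-pi..pi}"
  shows "prim (\<lambda>x. f x - g x) x = prim f x - prim g x"
  unfolding prim_def using assms by (intro integral_diff sq_int_integrable_subinterval) auto

lemma cmod_prim_diff_le:
  assumes "sq_int f" "-pi \<le> s" "s \<le> t" "t \<le> pi"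
  shows "cmod (prim f t - prim f s) \<le> sqrt (t - s) * norm (abs_l2 f)"
  using prim_variation[OF assms] integral_cmod_le_norm[OF assms] by linarith

lemma cmod_prim_le:
  assumes "sq_int f" "x \<in> {-pi..pi}"
  shows "cmod (prim f x) \<le> sqrt (2 * pi) * norm (abs_l2 f)"
proof -
  have "cmod (prim f x) \<le> sqrt (x + pi) * norm (abs_l2 f)"
    using cmod_prim_diff_le[OF assms(1), of "-pi" x] assms(2) by simp
  also have "\<dots> \<le> sqrt (2 * pi) * norm (abs_l2 f)"
    using assms(2) by (intro mult_right_mono) auto
  finally show ?thesis .
qed

lemma cmod_prim_le_sup:
  assumes f: "continuous_on {-pi..pi} f" and C: "\<And>x. x \<in> {-pi..pi} \<Longrightarrow> cmod (f x) \<le> C" and x: "x \<in> {-pi..pi}"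
  shows "cmod (prim f x) \<le> 2 * pi * C"
proof -
  have C0: "0 \<le> C" using C[OF x] norm_ge_zero[of "f x"] by linarith
  have "cmod (prim f x) \<le> integral {-pi..x} (\<lambda>_. C)"
    unfolding prim_def using x C
    by (intro integral_norm_bound_integral integrable_continuous_real continuous_on_subset[OF f]) auto
  also have "\<dots> = (x + pi) * C" using x by simp
  also have "\<dots> \<le> 2 * pi * C" using x C0 by (intro mult_right_mono) auto
  finally show ?thesis .
qed

section \<open>The singular first-order equation\<close>

text \<open>The bound \<open>a < 1\<close> keeps 1 - a cos x above the positive constant 1 - a and
  makes the exponent of \<open>phi\<close> at 0 positive.\<close>

locale degenerate_ode =
  fixes a b :: real
  assumes a: "0 < a" "a < 1" and b: "0 < b"
begin

text \<open>In this notation w = (1 - a cos x) y + b sin x y' reads y' = rate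
  (\<open>ratio w\<close> - y), so \<open>rate\<close> is the logarithmic derivative of an
  integrating factor.\<close>

definition rate :: "real \<Rightarrow> real" where
  "rate x = (1 - a * cos x) / (b * sin x)"

text \<open>The integrating factor: \<open>phi' = rate phi\<close> away from the singular points.\<close>

definition phi :: "real \<Rightarrow> real" where
  "phi x = sgn x * (\<bar>sin (x / 2)\<bar> powr ((1 - a) / b) * cos (x / 2) powr (- ((1 + a) / b)))"

definition psi :: "real \<Rightarrow> real" where
  "psi = inv_into {-pi<..<pi} phi"

lemma exponents_pos: "(1 - a) / b > 0" "(1 + a) / b > 0"
  using a b by auto

lemma one_minus_cos_pos: "0 < 1 - a * cos x" and one_minus_cos_ge: "1 - a \<le> 1 - a * cos x"
proof -
  show *: "1 - a \<le> 1 - a * cos x" using a by (simp add: mult_left_le)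
  show "0 < 1 - a * cos x" using * a by linarith
qed

lemma phi_zero [simp]: "phi 0 = 0" by (simp add: phi_def)

lemma phi_minus: "phi (- x) = - phi x" by (simp add: phi_def sgn_minus)

lemma phi_pos_eq: "0 \<le> x \<Longrightarrow> x < pi \<Longrightarrow> phi x = sin (x / 2) powr ((1 - a) / b) * cos (x / 2) powr (- ((1 + a) / b))"
  by (cases "x = 0") (auto simp: phi_def sin_ge_zero)

lemma phi_pos: "0 < x \<Longrightarrow> x < pi \<Longrightarrow> 0 < phi x"
  using sin_gt_zero[of "x/2"] cos_gt_zero[of "x/2"] by (simp add: phi_pos_eq)

text \<open>The exponents of \<open>phi\<close> are read off the half-angle form of
  \<open>rate\<close>. Since (1 - a) cos^2(x/2) + (1 + a) sin^2(x/2) = 1 - a cos x,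
  \<open>rate\<close> equals (1 - a)/(2b) cot(x/2) + (1 + a)/(2b) tan(x/2), the logarithmic
  derivative of the two powers.\<close>

lemma phi_deriv_pos:
  assumes x: "0 < x" "x < pi"
  shows "(phi has_real_derivative phi x * rate x) (at x)"
proof -
  let ?f = "\<lambda>x. sin (x / 2) powr ((1 - a) / b) * cos (x / 2) powr (- ((1 + a) / b))"
  have s: "0 < sin (x/2)" using x by (intro sin_gt_zero) auto
  have c: "0 < cos (x/2)" using x by (intro cos_gt_zero) auto
  have "(?f has_real_derivative ?f x * ((1 - a) / b * (cos (x/2) / 2) / sin (x/2) + (1 + a) / b * (sin (x/2) / 2) / cos (x/2))) (at x)"
    using s c
    by (auto intro!: derivative_eq_intros simp: powr_diff field_simps powr_minus)
  moreover have "(1 - a) / b * (cos (x/2) / 2) / sin (x/2) + (1 + a) / b * (sin (x/2) / 2) / cos (x/2) = rate x"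
  proof -
    let ?s = "sin (x/2)" and ?c = "cos (x/2)"
    have 1: "?s\<^sup>2 + ?c\<^sup>2 = 1" by simp
    have sx: "sin x = 2 * ?s * ?c" using sin_double[of "x/2"] by simp
    have cx: "cos x = ?c\<^sup>2 - ?s\<^sup>2" using cos_double[of "x/2"] by simp
    have "(1 - a) / b * (?c / 2) / ?s + (1 + a) / b * (?s / 2) / ?c
        = ((1 - a) * ?c\<^sup>2 + (1 + a) * ?s\<^sup>2) / (b * (2 * ?s * ?c))"
      using s c b by (simp add: field_simps power2_eq_square)
    also have "(1 - a) * ?c\<^sup>2 + (1 + a) * ?s\<^sup>2 = (?s\<^sup>2 + ?c\<^sup>2) - a * (?c\<^sup>2 - ?s\<^sup>2)"
      by (simp add: algebra_simps)
    also have "\<dots> = 1 - a * cos x" by (simp only: 1 cx)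
    finally show ?thesis by (simp add: rate_def sx)
  qed
  ultimately have "(?f has_real_derivative phi x * rate x) (at x)"
    using x by (simp add: phi_pos_eq)
  then show ?thesis
    by (rule has_field_derivative_transform_within_open[of _ _ _ "{0<..<pi}"]) (use x phi_pos_eq in auto)
qed

lemma rate_pos: "0 < x \<Longrightarrow> x < pi \<Longrightarrow> 0 < rate x"
  using one_minus_cos_pos b sin_gt_zero by (simp add: rate_def)

lemma rate_minus: "rate (- x) = - rate x" by (simp add: rate_def)

text \<open>Continuity at 0 rests on the positive exponent (1 - a)/b of the sine, that is, on a <
  1.\<close>

lemma phi_continuous_nonneg: "continuous_on {0..<pi} phi"
proof -
  have s: "0 \<le> sin (x/2)" and c: "0 < cos (x/2)" if "x \<in> {0..<pi}" for x
    using that by (auto intro!: sin_ge_zero cos_gt_zero_pi)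
  have "continuous_on {0..<pi} (\<lambda>x. sin (x / 2) powr ((1 - a) / b))"
    using s exponents_pos by (intro continuous_on_powr' continuous_intros) auto
  moreover have "continuous_on {0..<pi} (\<lambda>x. cos (x / 2) powr (- ((1 + a) / b)))"
    using c by (intro continuous_on_powr continuous_intros) (auto simp: less_le)
  ultimately have "continuous_on {0..<pi} (\<lambda>x. sin (x / 2) powr ((1 - a) / b) * cos (x / 2) powr (- ((1 + a) / b)))"
    by (rule continuous_on_mult)
  then show ?thesis by (rule continuous_on_eq) (simp add: phi_pos_eq)
qed

lemma phi_continuous: "continuous_on {-pi<..<pi} phi"
proof -
  have "continuous_on {-pi<..0} (\<lambda>x. - phi (- x))"
    by (intro continuous_intros continuous_on_compose2[OF phi_continuous_nonneg]) auto
  then have "continuous_on {-pi<..0} phi" by (simp add: phi_minus)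
  moreover have "closedin (top_of_set ({-pi<..0} \<union> {0..<pi})) {-pi<..0}"
    unfolding closedin_closed by (intro exI[of _ "{..0}"]) auto
  moreover have "closedin (top_of_set ({-pi<..0} \<union> {0..<pi})) {0..<pi}"
    unfolding closedin_closed by (intro exI[of _ "{0..}"]) auto
  ultimately have "continuous_on ({-pi<..0} \<union> {0..<pi}) phi"
    using phi_continuous_nonneg by (intro continuous_on_Un_local)
  also have "{-pi<..0} \<union> {0..<pi} = {-pi<..<pi}" by auto
  finally show ?thesis .
qed

lemma phi_less_nonneg:
  assumes "0 \<le> x" "x < y" "y < pi"
  shows "phi x < phi y"
proof (rule DERIV_pos_imp_increasing_open[OF assms(2)])
  fix t assume "x < t" "t < y"
  then show "\<exists>d. (phi has_real_derivative d) (at t) \<and> 0 < d"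
    using assms by (intro exI[of _ "phi t * rate t"] conjI phi_deriv_pos mult_pos_pos phi_pos rate_pos) auto
qed (use assms in \<open>auto intro: continuous_on_subset[OF phi_continuous_nonneg]\<close>)

lemma phi_strict_mono: "strict_mono_on {-pi<..<pi} phi"
proof (rule strict_mono_onI)
  fix x y assume xy: "x \<in> {-pi<..<pi}" "y \<in> {-pi<..<pi}" "x < y"
  consider "0 \<le> x" | "y \<le> 0" | "x < 0" "0 < y" by linarith
  then show "phi x < phi y"
  proof cases
    case 1 then show ?thesis using xy phi_less_nonneg by auto
  next
    case 2 then show ?thesis using xy phi_less_nonneg[of "-y" "-x"] by (auto simp: phi_minus)
  next
    case 3 then show ?thesis using xy phi_pos[of y] phi_pos[of "-x"] by (auto simp: phi_minus)
  qed
qed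

lemma phi_unbounded: obtains x where "0 < x" "x < pi" "s < phi x"
proof -
  let ?k = "(1 - a) / b" and ?l = "(1 + a) / b"
  \<comment> \<open>The point is sought with \<open>cos (x / 2) = e\<close> and
    \<open>e powr (- ?l) = S\<close>. The first entry of the maximum forces
    \<open>e \<le> 1/2\<close>, hence \<open>sin (x / 2) \<ge> 1/2\<close>; the second compensates
    the factor \<open>(1/2) powr ?k\<close> that this lower bound for the sine costs.\<close>
  define S where "S = max (2 powr ?l) (2 powr ?k * (\<bar>s\<bar> + 1))"
  define e where "e = S powr (- (1 / ?l))"
  have S: "S > 0" by (simp add: S_def less_max_iff_disj)
  have e0: "e > 0" using S by (simp add: e_def)
  have eS: "e powr (- ?l) = S" using S a b by (simp add: e_def powr_powr)
  have e2: "e \<le> 1/2"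
  proof (rule ccontr)
    assume "\<not> e \<le> 1/2"
    then have "e powr (- ?l) < (1/2) powr (- ?l)"
      using exponents_pos(2) by (intro powr_less_mono2_neg) auto
    also have "\<dots> = 2 powr ?l" by (simp add: powr_minus powr_divide)
    finally show False by (simp add: eS S_def)
  qed
  define x where "x = 2 * arccos e"
  have cx: "cos (x/2) = e" using e0 e2 by (simp add: x_def)
  have x: "0 < x" "x < pi"
    using e0 e2 arccos_lt_bounded[of e] arccos_less_arccos[of 0 e] by (auto simp: x_def)
  have "sin (x/2) = sqrt (1 - e\<^sup>2)" using e0 e2 by (simp add: x_def sin_arccos)
  also have "\<dots> \<ge> sqrt ((1/2)\<^sup>2)"
    using e0 e2 power_mono[of e "1/2" 2] by (intro real_sqrt_le_mono) (simp add: power2_eq_square)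
  finally have sx: "1/2 \<le> sin (x/2)" by simp
  have "s < \<bar>s\<bar> + 1" by linarith
  also have "\<dots> = (1/2) powr ?k * (2 powr ?k * (\<bar>s\<bar> + 1))"
    by (simp add: powr_divide)
  also have "\<dots> \<le> sin (x/2) powr ?k * S"
    using sx exponents_pos(1) by (intro mult_mono powr_mono2) (auto simp: S_def)
  also have "\<dots> = phi x" using x by (simp add: phi_pos_eq cx eS)
  finally show ?thesis using x that by blast
qed

lemma phi_image: "phi ` {-pi<..<pi} = UNIV"
proof -
  have pos: "\<exists>x\<in>{0..<pi}. phi x = s" if s: "0 \<le> s" for s
  proof -
    obtain y where y: "0 < y" "y < pi" "s < phi y" using phi_unbounded by blast
    have "\<exists>x. 0 \<le> x \<and> x \<le> y \<and> phi x = s"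
      using y s by (intro IVT') (auto intro: continuous_on_subset[OF phi_continuous_nonneg])
    then show ?thesis using y by auto
  qed
  have "\<exists>x\<in>{-pi<..<pi}. s = phi x" for s
  proof (cases "0 \<le> s")
    case True then show ?thesis using pos[of s] by force
  next
    case False
    then obtain x where "x \<in> {0..<pi}" "phi x = - s" using pos[of "-s"] by auto
    then show ?thesis by (intro bexI[of _ "-x"]) (auto simp: phi_minus)
  qed
  then show ?thesis by auto
qed

lemma phi_inj: "inj_on phi {-pi<..<pi}"
  using phi_strict_mono by (rule strict_mono_on_imp_inj_on)

lemma psi_phi [simp]: "-pi < x \<Longrightarrow> x < pi \<Longrightarrow> psi (phi x) = x"
  using phi_inj by (simp add: psi_def)

lemma psi_bounds [simp]: "-pi < psi s" "psi s < pi" and phi_psi [simp]: "phi (psi s) = s"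
proof -
  have s: "s \<in> phi ` {-pi<..<pi}" by (simp add: phi_image)
  show "-pi < psi s" "psi s < pi" using inv_into_into[OF s] by (auto simp: psi_def)
  show "phi (psi s) = s" using f_inv_into_f[OF s] by (simp add: psi_def)
qed

lemma psi_less: "s < t \<Longrightarrow> psi s < psi t"
proof (rule ccontr)
  assume "s < t" "\<not> psi s < psi t"
  then have "phi (psi t) \<le> phi (psi s)"
    using strict_mono_on_leD[OF phi_strict_mono, of "psi t" "psi s"] by simp
  with \<open>s < t\<close> show False by simp
qed

lemma psi_le: "s \<le> t \<Longrightarrow> psi s \<le> psi t"
  using psi_less[of s t] by (cases "s = t") auto

lemma psi_zero [simp]: "psi 0 = 0" using psi_phi[of 0] by simp

lemma psi_minus: "psi (- s) = - psi s"
  using psi_phi[of "- psi s"] psi_bounds[of s] by (simp add: phi_minus)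

lemma psi_continuous: "continuous_on UNIV psi"
  using continuous_on_inverse_open[of "{-pi<..<pi}" phi psi] phi_continuous phi_inj phi_image
  by (simp add: psi_def)

lemma psi_tendsto_pi: "(psi \<longlongrightarrow> pi) at_top"
proof (rule order_tendstoI)
  fix c assume c: "c < pi"
  have "psi s > c" if "s > phi (max c 0)" for s
  proof -
    have "psi (phi (max c 0)) = max c 0" using c by (intro psi_phi) (auto simp: less_max_iff_disj)
    then show ?thesis using psi_less[OF that] by simp
  qed
  then show "\<forall>\<^sub>F s in at_top. c < psi s"
    by (rule eventually_mono[OF eventually_gt_at_top[of "phi (max c 0)"]])
next
  fix c assume "pi < c"
  then show "\<forall>\<^sub>F s in at_top. psi s < c"
    by (intro always_eventually allI) (use psi_bounds in \<open>meson order_less_trans\<close>)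
qed

lemma phi_at_top: "filterlim phi at_top (at_left pi)"
  unfolding filterlim_at_top_dense
proof
  fix s
  have "s < phi x" if "psi s < x" "x < pi" for x
    using strict_mono_onD[OF phi_strict_mono, of "psi s" x] that psi_bounds[of s] by auto
  then show "\<forall>\<^sub>F x in at_left pi. s < phi x"
    unfolding eventually_at_left_field using psi_bounds(2)[of s] by blast
qed

section \<open>Means in the variable \<open>phi\<close>\<close>

text \<open>At +-pi, where \<open>phi\<close> has the default value 0 of \<open>powr\<close>, the
  end point itself is substituted. It is the limit of the interior formula for every
  \<open>r > 0\<close>, so that means are continuous up to the ends.\<close>

definition theta :: "real \<Rightarrow> real \<Rightarrow> real" where
  "theta x r = (if x = pi then pi else if x = - pi then - pi else psi (r * phi x))"

text \<open>With respect to the variable \<open>phi\<close>, the solution of the singular equation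
  \<open>y + y' / rate = v\<close> that is regular at 0 is the mean of \<open>v\<close> over the segment from 0.\<close>

definition avg :: "(real \<Rightarrow> 'a::euclidean_space) \<Rightarrow> real \<Rightarrow> 'a" where
  "avg v x = integral {0..1} (\<lambda>r. v (theta x r))"

lemma theta_pi [simp]: "theta pi r = pi" "theta (- pi) r = - pi"
  by (auto simp: theta_def)

lemma theta_zero [simp]: "theta 0 r = 0" by (simp add: theta_def)

lemma theta_interior: "-pi < x \<Longrightarrow> x < pi \<Longrightarrow> theta x r = psi (r * phi x)"
  by (simp add: theta_def)

lemma theta_mem: "theta x r \<in> {-pi..pi}"
  using psi_bounds[of "r * phi x"] by (auto simp: theta_def simp del: psi_bounds)

lemma theta_minus: "theta (- x) r = - theta x r"
  by (auto simp: theta_def phi_minus psi_minus)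

lemma theta_mono:
  assumes "0 \<le> r" "-pi \<le> x" "x \<le> y" "y \<le> pi"
  shows "theta x r \<le> theta y r"
proof (cases "x = - pi \<or> y = pi")
  case True then show ?thesis using theta_mem[of x r] theta_mem[of y r] by auto
next
  case False
  then have "phi x \<le> phi y"
    using assms strict_mono_on_leD[OF phi_strict_mono, of x y] by auto
  then show ?thesis using False assms by (auto simp: theta_interior intro!: psi_le mult_left_mono)
qed

lemma theta_le: "0 \<le> x \<Longrightarrow> x < pi \<Longrightarrow> r \<le> 1 \<Longrightarrow> theta x r \<le> x"
  using psi_le[of "r * phi x" "phi x"] phi_pos[of x]
  by (cases "x = 0") (auto simp: theta_interior mult_le_cancel_right1)

lemma theta_continuous: "continuous_on A (theta x)"
proof -
  have "continuous_on A (\<lambda>r. psi (r * phi x))"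
    by (intro continuous_on_compose2[OF psi_continuous] continuous_intros) auto
  moreover have "theta x = (if x = pi then (\<lambda>_. pi) else if x = - pi then (\<lambda>_. - pi) else (\<lambda>r. psi (r * phi x)))"
    by (simp add: theta_def fun_eq_iff)
  ultimately show ?thesis by simp
qed

lemma theta_continuous_left:
  assumes "0 < r" shows "continuous_on {-pi..pi} (\<lambda>x. theta x r)"
  unfolding continuous_on_eq_continuous_within
proof
  have right: "((\<lambda>x. theta x r) \<longlongrightarrow> pi) (at_left pi)"
  proof -
    have "filterlim (\<lambda>x. r * phi x) at_top (at_left pi)"
      using phi_at_top assms by (intro filterlim_tendsto_pos_mult_at_top[OF tendsto_const]) auto
    then have "((\<lambda>x. psi (r * phi x)) \<longlongrightarrow> pi) (at_left pi)"
      by (rule filterlim_compose[OF psi_tendsto_pi])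
    moreover have "\<forall>\<^sub>F x in at_left pi. psi (r * phi x) = theta x r"
      unfolding eventually_at_left_field by (intro exI[of _ 0]) (auto simp: theta_interior)
    ultimately show ?thesis by (rule Lim_transform_eventually)
  qed
  have left: "((\<lambda>x. theta x r) \<longlongrightarrow> - pi) (at_right (- pi))"
  proof -
    have "((\<lambda>x. - theta (- x) r) \<longlongrightarrow> - pi) (at_right (- pi))"
      using right by (intro tendsto_minus) (simp add: filterlim_at_left_to_right)
    then show ?thesis by (simp add: theta_minus)
  qed
  fix x assume x: "x \<in> {-pi..pi}"
  show "continuous (at x within {-pi..pi}) (\<lambda>x. theta x r)"
  proof -
    consider "x = pi" | "x = -pi" | "x \<in> {-pi<..<pi}" using x by force
    then show ?thesis
    proof cases
      case 1
      then show ?thesis using right by (simp add: continuous_within at_within_Icc_at_left)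
    next
      case 2
      then show ?thesis using left by (simp add: continuous_within at_within_Icc_at_right)
    next
      case 3
      have "continuous_on {-pi<..<pi} (\<lambda>x. psi (r * phi x))"
        by (intro continuous_on_compose2[OF psi_continuous] continuous_intros phi_continuous) auto
      then have "continuous_on {-pi<..<pi} (\<lambda>x. theta x r)"
        by (rule continuous_on_eq) (auto simp: theta_interior)
      then have "isCont (\<lambda>x. theta x r) x" using 3 by (simp add: continuous_on_eq_continuous_at)
      then show ?thesis by (rule continuous_at_imp_continuous_within)
    qed
  qed
qed

lemma avg_integrable:
  fixes v :: "real \<Rightarrow> 'a::euclidean_space"
  assumes "continuous_on {-pi..pi} v"
  shows "(\<lambda>r. v (theta x r)) integrable_on {0..1}"
  by (intro integrable_continuous_real continuous_on_compose2[OF assms theta_continuous])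
    (use theta_mem in blast)

lemma avg_const [simp]: "avg (\<lambda>_. c) x = c" by (simp add: avg_def)

lemma avg_pi [simp]: "avg v pi = v pi" "avg v (- pi) = v (- pi)" by (simp_all add: avg_def)

lemma avg_zero [simp]: "avg v 0 = v 0" by (simp add: avg_def)

lemma avg_minus: "avg v (- x) = avg (\<lambda>x. v (- x)) x"
  by (simp add: avg_def theta_minus)

lemma avg_cong: "(\<And>x. x \<in> {-pi..pi} \<Longrightarrow> u x = v x) \<Longrightarrow> avg u x = avg v x"
  unfolding avg_def by (intro integral_cong) (use theta_mem in blast)

lemma avg_add:
  assumes "continuous_on {-pi..pi} u" "continuous_on {-pi..pi} v"
  shows "avg (\<lambda>x. u x + v x) x = avg u x + avg v x"
  unfolding avg_def by (rule integral_add[OF avg_integrable avg_integrable]) (use assms in auto)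

lemma avg_diff:
  assumes "continuous_on {-pi..pi} u" "continuous_on {-pi..pi} v"
  shows "avg (\<lambda>x. u x - v x) x = avg u x - avg v x"
  unfolding avg_def by (rule integral_diff[OF avg_integrable avg_integrable]) (use assms in auto)

lemma avg_mult:
  fixes v :: "real \<Rightarrow> complex"
  shows "avg (\<lambda>x. c * v x) x = c * avg v x"
  unfolding avg_def by (rule integral_mult_right)

lemma avg_norm_le:
  assumes "continuous_on {-pi..pi} v" "\<And>x. x \<in> {-pi..pi} \<Longrightarrow> norm (v x) \<le> C"
  shows "norm (avg v x) \<le> C"
proof -
  have "norm (avg v x) \<le> integral {0..1::real} (\<lambda>r. C)"
    unfolding avg_def
  proof (rule integral_norm_bound_integral[OF avg_integrable[OF assms(1)]])
    show "norm (v (theta x r)) \<le> C" for r by (rule assms(2)[OF theta_mem])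
  qed auto
  then show ?thesis by simp
qed

lemma avg_real_le:
  fixes u v :: "real \<Rightarrow> real"
  assumes "continuous_on {-pi..pi} u" "continuous_on {-pi..pi} v"
    "\<And>r. \<lbrakk>0 \<le> r; r \<le> 1\<rbrakk> \<Longrightarrow> u (theta x r) \<le> v (theta y r)"
  shows "avg u x \<le> avg v y"
  unfolding avg_def using assms by (intro integral_le avg_integrable) auto

text \<open>Dominated convergence in \<open>r\<close>. The mean is rewritten over the open unit
  interval because for \<open>r = 0\<close> the function \<open>theta x r\<close> of x jumps at
  +-pi.\<close>

lemma avg_continuous:
  assumes v: "continuous_on {-pi..pi} v"
  shows "continuous_on {-pi..pi} (avg v)"
  unfolding continuous_on_sequentially
proof (intro allI ballI impI; elim conjE)
  fix X x assume x: "x \<in> {-pi..pi}" and X: "\<forall>n. X n \<in> {-pi..pi}" and lim: "X \<longlonglongrightarrow> x"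
  obtain C where C: "\<And>x. x \<in> {-pi..pi} \<Longrightarrow> norm (v x) \<le> C"
    using compact_continuous_image[OF v compact_Icc] compact_imp_bounded bounded_iff by (metis imageI)
  have eq: "avg v y = integral {0<..<1} (\<lambda>r. v (theta y r))" for y
    by (simp add: avg_def integral_open_interval_real)
  have "(\<lambda>n. integral {0<..<1} (\<lambda>r. v (theta (X n) r))) \<longlonglongrightarrow> integral {0<..<1} (\<lambda>r. v (theta x r))"
  proof (rule dominated_convergence(2)[where h = "\<lambda>_. C"])
    show "(\<lambda>r. v (theta (X n) r)) integrable_on {0<..<1}" for n
      using avg_integrable[OF v, of "X n"] by (simp add: integrable_on_Icc_iff_Ioo)
    show "(\<lambda>_::real. C) integrable_on {0<..<1}"
      using integrable_const_ivl[of C 0 "1::real"] by (simp add: integrable_on_Icc_iff_Ioo)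
    show "norm (v (theta (X n) r)) \<le> C" for n r by (rule C[OF theta_mem])
    fix r :: real assume r: "r \<in> {0<..<1}"
    have "continuous_on {-pi..pi} (\<lambda>x. v (theta x r))"
      by (intro continuous_on_compose2[OF v] theta_continuous_left) (use r theta_mem in auto)
    then show "(\<lambda>n. v (theta (X n) r)) \<longlonglongrightarrow> v (theta x r)"
      using x X lim unfolding continuous_on_sequentially by (auto simp: o_def)
  qed
  then show "(avg v \<circ> X) \<longlonglongrightarrow> avg v x" by (simp add: o_def eq)
qed

text \<open>Substituting s = r phi(x) turns the mean into 1/phi(x) times the integral of v(psi(s))
  over [0, phi(x)]; the product rule and phi' = rate phi then give the formula.\<close>

lemma avg_has_vector_derivative_pos:
  assumes v: "continuous_on {-pi..pi} v" and x: "0 < x" "x < pi"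
  shows "(avg v has_vector_derivative rate x *\<^sub>R (v x - avg v x)) (at x)"
proof -
  define V where "V s = v (psi s)" for s
  define G where "G s = integral {0..s} V" for s
  have Vc: "continuous_on A V" for A
    unfolding V_def
    by (intro continuous_on_compose2[OF v] continuous_on_subset[OF psi_continuous])
      (auto simp: less_imp_le)
  have avg_eq: "avg v y = inverse (phi y) *\<^sub>R G (phi y)" if y: "0 < y" "y < pi" for y
  proof -
    have "phi y > 0" using phi_pos y by simp
    have "(V has_integral G (phi y)) {0..phi y}"
      unfolding G_def by (intro integrable_integral integrable_continuous_real Vc)
    from has_integral_affinity'[OF this[folded box_real(2)], of "phi y" 0] \<open>phi y > 0\<close>
    have "((\<lambda>r. V (phi y * r)) has_integral inverse (phi y) *\<^sub>R G (phi y)) {0..1}" by simp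
    moreover have "(\<lambda>r. V (phi y * r)) = (\<lambda>r. v (theta y r))"
      using y by (auto simp: V_def theta_interior mult.commute)
    ultimately show ?thesis by (simp add: avg_def integral_unique)
  qed
  have p: "phi x > 0" using phi_pos x by simp
  have "(G has_vector_derivative V (phi x)) (at (phi x) within {0..phi x + 1})"
    unfolding G_def using p by (intro integral_has_vector_derivative Vc) auto
  then have "(G has_vector_derivative V (phi x)) (at (phi x))"
    using p by (simp add: at_within_Icc_at)
  then have "(G \<circ> phi has_vector_derivative (phi x * rate x) *\<^sub>R V (phi x)) (at x)"
    using phi_deriv_pos[OF x] by (intro vector_diff_chain_at) (auto simp: has_real_derivative_iff_has_vector_derivative)
  moreover have "((\<lambda>x. inverse (phi x)) has_real_derivative - (phi x * rate x) * inverse (phi x)^2) (at x)"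
    using phi_deriv_pos[OF x] p by (auto intro!: derivative_eq_intros simp: power2_eq_square)
  ultimately have "((\<lambda>x. inverse (phi x) *\<^sub>R (G \<circ> phi) x) has_vector_derivative
      inverse (phi x) *\<^sub>R ((phi x * rate x) *\<^sub>R V (phi x)) + (- (phi x * rate x) * inverse (phi x)^2) *\<^sub>R (G \<circ> phi) x) (at x)"
    by (intro has_vector_derivative_scaleR)
  moreover have "inverse (phi x) *\<^sub>R ((phi x * rate x) *\<^sub>R V (phi x)) + (- (phi x * rate x) * inverse (phi x)^2) *\<^sub>R (G \<circ> phi) x
      = rate x *\<^sub>R (v x - avg v x)"
  proof -
    have "G (phi x) = phi x *\<^sub>R avg v x" "V (phi x) = v x"
      using p x by (simp_all add: avg_eq V_def)
    moreover have "inverse (phi x) * (phi x * rate x) = rate x"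
      "- (phi x * rate x) * inverse (phi x)^2 * phi x = - rate x"
      using p by (simp_all add: power2_eq_square)
    ultimately show ?thesis by (simp only: o_apply scaleR_scaleR scaleR_diff_right scaleR_minus_left) simp
  qed
  ultimately have "((\<lambda>x. inverse (phi x) *\<^sub>R (G \<circ> phi) x) has_vector_derivative rate x *\<^sub>R (v x - avg v x)) (at x)"
    by simp
  then show ?thesis
    by (rule has_vector_derivative_transform_within_open[of _ _ _ "{0<..<pi}"]) (use x avg_eq in auto)
qed

text \<open>Negative x reduces to positive x because \<open>phi\<close> is odd, so that means
  commute with reflection.\<close>

lemma avg_has_vector_derivative:
  assumes v: "continuous_on {-pi..pi} v" and x: "-pi < x" "x < pi" "x \<noteq> 0"
  shows "(avg v has_vector_derivative rate x *\<^sub>R (v x - avg v x)) (at x)"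
proof (cases "0 < x")
  case True then show ?thesis using avg_has_vector_derivative_pos[OF v] x by simp
next
  case False
  let ?v = "\<lambda>x. v (- x)"
  have "continuous_on {-pi..pi} ?v"
    by (intro continuous_on_compose2[OF v] continuous_intros) auto
  then have "(avg ?v has_vector_derivative rate (-x) *\<^sub>R (?v (-x) - avg ?v (-x))) (at (- x))"
    using x False by (intro avg_has_vector_derivative_pos) auto
  then have "(avg ?v has_vector_derivative - (rate x *\<^sub>R (v x - avg v x))) (at (- x))"
    using avg_minus[of v "- x"] by (simp add: rate_minus)
  moreover have "(uminus has_vector_derivative (- 1 :: real)) (at x)"
    by (auto intro!: derivative_eq_intros)
  ultimately have "(avg ?v \<circ> uminus has_vector_derivative (- 1) *\<^sub>R (- (rate x *\<^sub>R (v x - avg v x)))) (at x)"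
    by (intro vector_diff_chain_at)
  moreover have "avg ?v \<circ> uminus = avg v" by (auto simp: avg_minus o_def)
  ultimately show ?thesis by simp
qed

text \<open>Means preserve the order, so a modulus of variation \<open>V\<close> of \<open>v\<close> yields the modulus
  \<open>avg V\<close> of \<open>avg v\<close>; the latter is monotone and hence has an integrable derivative.\<close>

lemma avg_abs_continuous:
  fixes v :: "real \<Rightarrow> complex" and V :: "real \<Rightarrow> real"
  assumes v: "continuous_on {-pi..pi} v" and V: "continuous_on {-pi..pi} V"
    and var: "\<And>s t. \<lbrakk>-pi \<le> s; s \<le> t; t \<le> pi\<rbrakk> \<Longrightarrow> cmod (v t - v s) \<le> V t - V s"
  shows "abs_continuous (-pi) pi (avg v)"
proof -
  have mono: "V s \<le> V t" if "-pi \<le> s" "s \<le> t" "t \<le> pi" for s t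
    using var[OF that] norm_ge_zero[of "v t - v s"] by linarith
  \<comment> \<open>The derivative of \<open>avg V\<close> off 0, integrable up to +-pi because
    \<open>avg V\<close> is continuous there. Its sign: for x > 0 the mean runs over points not
    beyond x, so \<open>avg V x \<le> V x\<close>, and \<open>rate\<close> is positive; for x < 0
    both signs reverse.\<close>
  define h where "h x = rate x * (V x - avg V x)" for x
  have h_int: "(h has_integral avg V t - avg V s) {s..t}" if "-pi \<le> s" "s \<le> t" "t \<le> pi" for s t
  proof (rule fundamental_theorem_of_calculus_interior_strong[where S = "{0}"])
    show "(avg V has_vector_derivative h x) (at x)" if "x \<in> {s<..<t} - {0}" for x
      using avg_has_vector_derivative[OF V, of x] that \<open>-pi \<le> s\<close> \<open>t \<le> pi\<close> by (simp add: h_def)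
    show "continuous_on {s..t} (avg V)"
      using that by (intro continuous_on_subset[OF avg_continuous[OF V]]) auto
  qed (use that in auto)
  have pos: "avg V x \<le> V x" if "0 \<le> x" "x < pi" for x
  proof -
    have "avg V x \<le> avg (\<lambda>_. V x) x"
      using that V theta_le[OF that] theta_mem by (intro avg_real_le mono continuous_on_const) auto
    then show ?thesis by simp
  qed
  have neg: "V x \<le> avg V x" if "x \<le> 0" "-pi < x" for x
  proof -
    have "avg (\<lambda>_. V x) x \<le> avg V x"
      using that V theta_le[of "-x"] theta_mem by (intro avg_real_le mono continuous_on_const) (auto simp: theta_minus)
    then show ?thesis by simp
  qed
  show ?thesis
  proof (rule abs_continuous_of_integral_bound[where h = h])
    show "h integrable_on {-pi..pi}" using h_int[of "-pi" pi] by (auto simp: integrable_on_def)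
    fix x assume x: "x \<in> {-pi..pi}"
    consider "x \<in> {-pi, 0, pi}" | "0 < x" "x < pi" | "-pi < x" "x < 0" using x by force
    then show "0 \<le> h x"
    proof cases
      case 1 then show ?thesis by (auto simp: h_def)
    next
      case 2 then show ?thesis using pos[of x] rate_pos[of x] by (simp add: h_def)
    next
      case 3
      then have "rate x \<le> 0" using rate_pos[of "-x"] by (simp add: rate_minus)
      then show ?thesis using 3 neg[of x] by (simp add: h_def mult_nonpos_nonpos)
    qed
  next
    fix s t assume st: "-pi \<le> s" "s \<le> t" "t \<le> pi"
    have "cmod (avg v t - avg v s) = cmod (integral {0..1} (\<lambda>r. v (theta t r) - v (theta s r)))"
      unfolding avg_def by (simp add: integral_diff avg_integrable[OF v])
    also have "\<dots> \<le> integral {0..1} (\<lambda>r. V (theta t r) - V (theta s r))"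
    proof (rule integral_norm_bound_integral)
      fix r :: real assume r: "r \<in> {0..1}"
      show "cmod (v (theta t r) - v (theta s r)) \<le> V (theta t r) - V (theta s r)"
        using theta_mem[of s r] theta_mem[of t r] theta_mono[of r s t] r st by (intro var) auto
    qed (auto intro!: integrable_diff avg_integrable v V)
    also have "\<dots> = avg V t - avg V s"
      unfolding avg_def by (rule integral_diff[OF avg_integrable[OF V] avg_integrable[OF V]])
    also have "\<dots> = integral {s..t} h" using h_int[OF st] by (simp add: integral_unique)
    finally show "cmod (avg v t - avg v s) \<le> integral {s..t} h" .
  qed
qed

section \<open>The solution operator of the first-order equation\<close>

definition ratio :: "(real \<Rightarrow> complex) \<Rightarrow> real \<Rightarrow> complex" where
  "ratio w x = w x / complex_of_real (1 - a * cos x)"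

definition K :: "(real \<Rightarrow> complex) \<Rightarrow> real \<Rightarrow> complex" where
  "K w = avg (ratio w)"

lemma denominator_nonzero: "complex_of_real (1 - a * cos x) \<noteq> 0"
  using one_minus_cos_pos[of x] by (metis of_real_eq_0_iff less_irrefl)

lemma ratio_continuous: "continuous_on S w \<Longrightarrow> continuous_on S (ratio w)"
  unfolding ratio_def using denominator_nonzero by (intro continuous_intros) auto

lemma cmod_ratio_le:
  assumes "cmod (w x) \<le> C" shows "cmod (ratio w x) \<le> C / (1 - a)"
proof -
  have "cmod (ratio w x) = cmod (w x) / (1 - a * cos x)"
    using one_minus_cos_pos[of x] unfolding ratio_def by (simp only: norm_divide norm_of_real abs_of_pos)
  also have "\<dots> \<le> C / (1 - a)"
    using assms a one_minus_cos_ge[of x] norm_ge_zero[of "w x"]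
    by (intro frac_le) (auto simp del: norm_ge_zero)
  finally show ?thesis .
qed

lemma integral_variation_ratio:
  assumes "integral_variation w"
  shows "integral_variation (ratio w)"
proof -
  obtain k where k: "k integrable_on {-pi..pi}" "\<And>x. x \<in> {-pi..pi} \<Longrightarrow> 0 \<le> k x"
     "\<And>s t. \<lbrakk>-pi \<le> s; s \<le> t; t \<le> pi\<rbrakk> \<Longrightarrow> cmod (w t - w s) \<le> integral {s..t} k"
    using integral_variationE[OF assms] by metis
  obtain M where M: "\<And>x. x \<in> {-pi..pi} \<Longrightarrow> cmod (w x) \<le> M"
    using compact_continuous_image[OF integral_variation_continuous[OF assms] compact_Icc]
      compact_imp_bounded bounded_iff by (metis imageI)
  have M0: "0 \<le> M" using M[of 0] norm_ge_zero[of "w 0"] by (auto simp del: norm_ge_zero)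
  \<comment> \<open>\<open>M\<close> times a Lipschitz constant of 1/(1 - a cos x): the denominator
    changes by at most \<open>a * (t - s)\<close>, and its values at both points are at least
    \<open>1 - a\<close>.\<close>
  define C where "C = M * a / (1 - a)\<^sup>2"
  have C0: "0 \<le> C" using M0 a by (simp add: C_def)
  show ?thesis
    unfolding integral_variation_def
  proof (intro exI[of _ "\<lambda>x. k x / (1 - a) + C"] conjI ballI allI impI)
    show "(\<lambda>x. k x / (1 - a) + C) integrable_on {-pi..pi}"
      using k by (intro integrable_add integrable_on_divide) auto
    show "0 \<le> k x / (1 - a) + C" if "x \<in> {-pi..pi}" for x using k(2)[OF that] C0 a by simp
    fix s t :: real assume st: "-pi \<le> s" "s \<le> t" "t \<le> pi"
    let ?r = "\<lambda>x. 1 - a * cos x"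
    \<comment> \<open>Both summands are again values of \<open>ratio\<close> at \<open>t\<close>, so
      one estimate serves for the change of \<open>w\<close> and for the change of the
      denominator.\<close>
    have "ratio w t - ratio w s = ratio (\<lambda>x. w t - w s) t + ratio (\<lambda>x. w s * complex_of_real (?r s - ?r t) / complex_of_real (?r s)) t"
      unfolding ratio_def using denominator_nonzero[of s] denominator_nonzero[of t]
      by (simp add: divide_simps) (simp add: algebra_simps)
    then have "cmod (ratio w t - ratio w s) \<le> cmod (ratio (\<lambda>x. w t - w s) t) +
        cmod (ratio (\<lambda>x. w s * complex_of_real (?r s - ?r t) / complex_of_real (?r s)) t)"
      by (simp only: norm_triangle_ineq)
    also have "\<dots> \<le> integral {s..t} k / (1 - a) + (M * (a * (t - s)) / (1 - a)) / (1 - a)"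
    proof (intro add_mono cmod_ratio_le k(3) st)
      have "cmod (w s * complex_of_real (?r s - ?r t) / complex_of_real (?r s)) = cmod (w s) * \<bar>?r s - ?r t\<bar> / ?r s"
        using one_minus_cos_pos[of s] by (simp only: norm_divide norm_mult norm_of_real abs_of_pos)
      also have "\<dots> \<le> M * (a * (t - s)) / (1 - a)"
      proof (intro frac_le mult_mono M one_minus_cos_ge)
        have "\<bar>?r s - ?r t\<bar> = a * \<bar>cos t - cos s\<bar>"
          using a by (simp add: abs_mult flip: right_diff_distrib)
        also have "\<dots> \<le> a * (t - s)"
          using abs_cos_diff_le[of t s] a st by (intro mult_left_mono) auto
        finally show "\<bar>?r s - ?r t\<bar> \<le> a * (t - s)" .
      qed (use st a M0 in auto)
      finally show "cmod (w s * complex_of_real (?r s - ?r t) / complex_of_real (?r s)) \<le> M * (a * (t - s)) / (1 - a)" .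
    qed
    also have "\<dots> = integral {s..t} k / (1 - a) + C * (t - s)"
      by (simp add: C_def power2_eq_square)
    also have "\<dots> = integral {s..t} (\<lambda>x. k x / (1 - a) + C)"
      using st integrable_on_subinterval[OF k(1), of s t]
      by (subst integral_add) (auto intro!: integrable_on_divide simp: mult.commute)
    finally show "cmod (ratio w t - ratio w s) \<le> integral {s..t} (\<lambda>x. k x / (1 - a) + C)" .
  qed
qed

lemma K_continuous: "continuous_on {-pi..pi} w \<Longrightarrow> continuous_on {-pi..pi} (K w)"
  unfolding K_def by (intro avg_continuous ratio_continuous)

lemma K_abs_continuous:
  assumes "integral_variation w"
  shows "abs_continuous (-pi) pi (K w)"
proof -
  obtain k where k:
     "\<And>s t. \<lbrakk>-pi \<le> s; s \<le> t; t \<le> pi\<rbrakk> \<Longrightarrow> cmod (ratio w t - ratio w s) \<le> integral {s..t} k"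
    "continuous_on {-pi..pi} (\<lambda>x. integral {-pi..x} k)"
    "\<And>s t. \<lbrakk>-pi \<le> s; s \<le> t; t \<le> pi\<rbrakk> \<Longrightarrow> integral {s..t} k = integral {-pi..t} k - integral {-pi..s} k"
    using integral_variationE[OF integral_variation_ratio[OF assms]] by metis
  show ?thesis
    unfolding K_def
    by (rule avg_abs_continuous[OF ratio_continuous[OF integral_variation_continuous[OF assms]] k(2)
        ord_le_eq_trans[OF k(1) k(3)]])
qed

lemma K_endpoints: "K w pi = w pi / complex_of_real (1 + a)" "K w (- pi) = w (- pi) / complex_of_real (1 + a)"
  by (simp_all add: K_def ratio_def)

lemma cmod_K_le:
  assumes "continuous_on {-pi..pi} w" "\<And>x. x \<in> {-pi..pi} \<Longrightarrow> cmod (w x) \<le> C"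
  shows "cmod (K w x) \<le> C / (1 - a)"
  unfolding K_def using assms by (intro avg_norm_le ratio_continuous cmod_ratio_le)

lemma K_add:
  assumes "continuous_on {-pi..pi} u" "continuous_on {-pi..pi} v"
  shows "K (\<lambda>x. u x + v x) x = K u x + K v x"
  using avg_add[OF ratio_continuous[OF assms(1)] ratio_continuous[OF assms(2)], of x]
  by (simp add: K_def ratio_def[abs_def] add_divide_distrib)

lemma K_diff:
  assumes "continuous_on {-pi..pi} u" "continuous_on {-pi..pi} v"
  shows "K (\<lambda>x. u x - v x) x = K u x - K v x"
  using avg_diff[OF ratio_continuous[OF assms(1)] ratio_continuous[OF assms(2)], of x]
  by (simp add: K_def ratio_def[abs_def] diff_divide_distrib)

lemma K_mult: "K (\<lambda>x. c * w x) x = c * K w x"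
  using avg_mult[of c "ratio w" x] by (simp add: K_def ratio_def[abs_def])

lemma K_has_vector_derivative:
  assumes w: "continuous_on {-pi..pi} w" and x: "-pi < x" "x < pi" "x \<noteq> 0"
  shows "(K w has_vector_derivative (w x - complex_of_real (1 - a * cos x) * K w x) / complex_of_real (b * sin x)) (at x)"
proof -
  have s: "sin x \<noteq> 0" using x sin_gt_zero[of x] sin_gt_zero[of "-x"] by (cases "0 < x") auto
  have "rate x *\<^sub>R (ratio w x - K w x) =
      (w x - complex_of_real (1 - a * cos x) * K w x) / complex_of_real (b * sin x)"
    unfolding rate_def ratio_def scaleR_conv_of_real using denominator_nonzero[of x] s b
    by (simp add: field_simps)
  then show ?thesis
    using avg_has_vector_derivative[OF ratio_continuous[OF w] x] by (simp add: K_def)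
qed

section \<open>Regularity and uniqueness of weak solutions\<close>

text \<open>The equation a.e. does not by itself say that \<open>y\<close> is differentiable a.e.: where it is not,
  \<open>vector_derivative\<close> takes the junk value \<open>d0\<close>, and \<open>y\<close> coincides with the a.e. differentiable
  function \<open>q\<close>.\<close>

lemma weak_solution_has_derivative:
  fixes y w g :: "real \<Rightarrow> complex"
  assumes cd: "c < d" "-pi < c" "d < pi" and sin0: "\<And>x. x \<in> {c..d} \<Longrightarrow> sin x \<noteq> 0"
    and y: "abs_continuous (-pi) pi y" and w: "integral_variation w"
    and wg: "AE x in mu. (w has_vector_derivative g x) (at x)"
    and ode: "AE x in mu. w x = complex_of_real (1 - a * cos x) * y x +
        complex_of_real (b * sin x) * vector_derivative y (at x)"
    and x0: "x0 \<in> {c<..<d}"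
  shows "(y has_vector_derivative
      (w x0 - complex_of_real (1 - a * cos x0) * y x0) / complex_of_real (b * sin x0)) (at x0)"
proof -
  define F where "F x = (w x - complex_of_real (1 - a * cos x) * y x) / complex_of_real (b * sin x)" for x
  define d0 :: complex where "d0 = (SOME d. False)"
  \<comment> \<open>\<open>q\<close> solves the relation with the derivative of \<open>y\<close>
    replaced by the constant \<open>d0\<close>; hence \<open>y = q\<close> wherever the formula
    \<open>F\<close> for the derivative has the value \<open>d0\<close>.\<close>
  define q where "q = ratio (\<lambda>x. w x - complex_of_real (b * sin x) * d0)"
  define q1 where "q1 x = ((g x - complex_of_real (b * cos x) * d0) * complex_of_real (1 - a * cos x)
      - (w x - complex_of_real (b * sin x) * d0) * complex_of_real (a * sin x)) / (complex_of_real (1 - a * cos x))\<^sup>2" for x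
  define N where "N = {x \<in> {-pi<..<pi}. \<not> (w has_vector_derivative g x) (at x)} \<union>
     {x \<in> {-pi<..<pi}. w x \<noteq> complex_of_real (1 - a * cos x) * y x +
        complex_of_real (b * sin x) * vector_derivative y (at x)}"
  define Z where "Z = {x \<in> {c..d}. F x = d0}"
  define p where "p x = y x - q x" for x
  have N: "negligible N"
    using wg ode unfolding N_def AE_mu_iff_negligible by (intro negligible_Un) auto
  have sub: "{c..d} \<subseteq> {-pi..pi}" "{c..d} \<subseteq> {-pi<..<pi}" using cd by auto
  have bs: "complex_of_real (b * sin x) \<noteq> 0" if "x \<in> {c..d}" for x
    using sin0[OF that] b by simp
  have yc: "continuous_on {c..d} y" and wc: "continuous_on {c..d} w"
    using continuous_on_subset[OF abs_continuous_imp_continuous_on[OF y] sub(1)]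
      continuous_on_subset[OF integral_variation_continuous[OF w] sub(1)] by auto
  have Fc: "continuous_on {c..d} F"
    unfolding F_def using bs by (intro continuous_intros yc wc) auto
  have F_ode: "F x = vector_derivative y (at x)" if "x \<in> {c..d} - N" for x
  proof -
    have "w x = complex_of_real (1 - a * cos x) * y x + complex_of_real (b * sin x) * vector_derivative y (at x)"
      using that sub unfolding N_def by blast
    then show ?thesis using bs[of x] that by (simp add: F_def)
  qed
  have y_or: "(y has_vector_derivative F x) (at x) \<or> F x = d0" if x: "x \<in> {c..d} - N" for x
  proof (cases "\<exists>d. (y has_vector_derivative d) (at x)")
    case True
    then have "(y has_vector_derivative vector_derivative y (at x)) (at x)"
      unfolding vector_derivative_def by (rule someI_ex)
    then show ?thesis by (simp add: F_ode[OF x])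
  next
    case False
    then have "vector_derivative y (at x) = d0" by (simp add: vector_derivative_def d0_def)
    then show ?thesis by (simp add: F_ode[OF x])
  qed
  have q_der: "(q has_vector_derivative q1 x) (at x)" if x: "x \<in> {c..d} - N" for x
  proof -
    have wx: "(w has_vector_derivative g x) (at x)" using x sub unfolding N_def by blast
    have 1: "((\<lambda>x. complex_of_real (b * sin x) * d0) has_vector_derivative complex_of_real (b * cos x) * d0) (at x)"
      by (auto intro!: derivative_eq_intros has_vector_derivative_mult_left has_vector_derivative_of_real)
    have 2: "((\<lambda>x. inverse (1 - a * cos x)) has_real_derivative - (a * sin x) / (1 - a * cos x)\<^sup>2) (at x)"
      using one_minus_cos_pos[of x] by (auto intro!: derivative_eq_intros simp: power2_eq_square field_simps)
    have "((\<lambda>x. inverse (1 - a * cos x) *\<^sub>R (w x - complex_of_real (b * sin x) * d0)) has_vector_derivative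
        inverse (1 - a * cos x) *\<^sub>R (g x - complex_of_real (b * cos x) * d0) +
        (- (a * sin x) / (1 - a * cos x)\<^sup>2) *\<^sub>R (w x - complex_of_real (b * sin x) * d0)) (at x)"
      by (intro has_vector_derivative_scaleR 2 has_vector_derivative_diff 1 wx)
    moreover have "(\<lambda>x. inverse (1 - a * cos x) *\<^sub>R (w x - complex_of_real (b * sin x) * d0)) = q"
      by (auto simp: q_def ratio_def scaleR_conv_of_real divide_simps)
    moreover have "inverse (1 - a * cos x) *\<^sub>R (g x - complex_of_real (b * cos x) * d0) +
        (- (a * sin x) / (1 - a * cos x)\<^sup>2) *\<^sub>R (w x - complex_of_real (b * sin x) * d0) = q1 x"
    proof -
      have *: "inverse r * A + (- s / r\<^sup>2) * B = (A * r - B * s) / r\<^sup>2" if "r \<noteq> 0" for r s A B :: complex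
        using that by (simp add: field_simps power2_eq_square)
      show ?thesis
        using *[OF denominator_nonzero[of x], of "g x - complex_of_real (b * cos x) * d0" "complex_of_real (a * sin x)"
            "w x - complex_of_real (b * sin x) * d0"]
        unfolding q1_def scaleR_conv_of_real by (simp only: of_real_inverse of_real_minus of_real_divide of_real_power)
    qed
    ultimately show ?thesis by simp
  qed
  have q_var: "integral_variation q"
    unfolding q_def
  proof (intro integral_variation_ratio integral_variation_diff w integral_variation_lipschitz)
    fix s t :: real assume "s \<le> t"
    have "cmod (complex_of_real (b * sin t) * d0 - complex_of_real (b * sin s) * d0) = b * \<bar>sin t - sin s\<bar> * cmod d0"
      using b by (simp add: norm_mult abs_mult flip: left_diff_distrib right_diff_distrib of_real_diff)
    also have "\<dots> \<le> b * (t - s) * cmod d0"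
      using abs_sin_diff_le[of t s] \<open>s \<le> t\<close> b by (intro mult_right_mono mult_left_mono) auto
    finally show "cmod (complex_of_real (b * sin t) * d0 - complex_of_real (b * sin s) * d0) \<le> (b * cmod d0) * (t - s)"
      by (simp add: mult_ac)
  qed
  have p_ac: "abs_continuous (-pi) pi p"
    unfolding p_def by (intro abs_continuous_diff y integral_variation_abs_continuous q_var)
  have Z_closed: "closed Z"
    unfolding Z_def using continuous_closed_preimage_constant[OF Fc closed_atLeastAtMost] by simp
  have p_zero: "p x = 0" if "x \<in> Z" for x
  proof -
    have "x \<in> {c..d}" "F x = d0" using that by (auto simp: Z_def)
    then have "w x - complex_of_real (b * sin x) * d0 = complex_of_real (1 - a * cos x) * y x"
      using bs[of x] by (simp add: F_def field_simps)
    then show ?thesis using denominator_nonzero[of x] by (simp add: p_def q_def ratio_def)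
  qed
  \<comment> \<open>Off \<open>Z\<close> the difference \<open>p = y - q\<close> is differentiable
    almost everywhere, and on \<open>Z\<close> it vanishes. So \<open>p\<close> is an indefinite
    integral, which makes \<open>p\<close>, and with it \<open>y = p + q\<close>, differentiable at
    almost every point of the window, those of \<open>Z\<close> included.\<close>
  define gp where "gp x = (if x \<in> Z then 0 else F x - q1 x)" for x
  have gp_int: "(gp has_integral (p x - p c)) {c..x}" if x: "c \<le> x" "x \<le> d" for x
    unfolding gp_def
  proof (rule fundamental_theorem_of_calculus_abs_continuous_zero_set[OF x(1) _ N Z_closed])
    show "abs_continuous c x p" using cd x by (intro abs_continuous_subinterval[OF p_ac]) auto
    fix t assume t: "t \<in> {c..x} - N - Z"
    then have "t \<in> {c..d} - N" "F t \<noteq> d0" using x by (auto simp: Z_def)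
    then have "(p has_vector_derivative F t - q1 t) (at t)"
      unfolding p_def[abs_def] using y_or[of t] q_der[of t] by (intro has_vector_derivative_diff) auto
    then show "(p has_vector_derivative F t - q1 t) (at t within {c..x})"
      by (rule has_vector_derivative_at_within)
  qed (use p_zero in auto)
  obtain N2 where N2: "negligible N2"
    and gp_der: "\<And>x. x \<in> {c<..<d} - N2 \<Longrightarrow> ((\<lambda>x. integral {c..x} gp) has_vector_derivative gp x) (at x)"
    using indefinite_integral_has_vector_derivative_ae[of gp c d] gp_int[of d] cd by (auto simp: integrable_on_def)
  have y_der: "(y has_vector_derivative F x) (at x)" if x: "x \<in> {c<..<d} - (N \<union> N2)" for x
  proof -
    have "((\<lambda>x. integral {c..x} gp + p c) has_vector_derivative gp x + 0) (at x)"
      using gp_der x by (intro has_vector_derivative_add has_vector_derivative_const) auto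
    then have "(p has_vector_derivative gp x + 0) (at x)"
    proof (rule has_vector_derivative_transform_within_open[of _ _ _ "{c<..<d}"])
      fix t assume "t \<in> {c<..<d}"
      then show "integral {c..t} gp + p c = p t" using gp_int[of t] by (simp add: integral_unique)
    qed (use x in auto)
    then have "((\<lambda>x. p x + q x) has_vector_derivative (gp x + 0) + q1 x) (at x)"
      using q_der[of x] x by (intro has_vector_derivative_add) auto
    then have y': "(y has_vector_derivative gp x + q1 x) (at x)" by (simp add: p_def)
    then have "vector_derivative y (at x) = gp x + q1 x" by (rule vector_derivative_at)
    moreover have "F x = vector_derivative y (at x)" using F_ode[of x] x by auto
    ultimately show ?thesis using y' by simp
  qed
  \<comment> \<open>Now \<open>y\<close> is an integral of the continuous function \<open>F\<close>,
    so its derivative exists at every interior point and not only almost everywhere.\<close>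
  have F_int: "(F has_integral (y x - y c)) {c..x}" if x: "x \<in> {c..d}" for x
  proof (rule fundamental_theorem_of_calculus_abs_continuous[of c x y "N \<union> N2 \<union> {c, d}"])
    show "abs_continuous c x y" using cd x by (intro abs_continuous_subinterval[OF y]) auto
    show "negligible (N \<union> N2 \<union> {c, d})" using N N2 by (intro negligible_Un) auto
    show "(y has_vector_derivative F t) (at t within {c..x})" if "t \<in> {c..x} - (N \<union> N2 \<union> {c, d})" for t
    proof -
      have "t \<in> {c<..<d} - (N \<union> N2)" using that x by auto
      then show ?thesis by (rule has_vector_derivative_at_within[OF y_der])
    qed
  qed (use x in auto)
  have "((\<lambda>u. integral {c..u} F) has_vector_derivative F x0) (at x0 within {c..d})"
    using x0 by (intro integral_has_vector_derivative Fc) auto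
  then have "((\<lambda>u. integral {c..u} F) has_vector_derivative F x0) (at x0)"
    using x0 by (simp add: at_within_Icc_at)
  then have "((\<lambda>u. integral {c..u} F + y c) has_vector_derivative F x0 + 0) (at x0)"
    by (intro has_vector_derivative_add has_vector_derivative_const)
  then have "(y has_vector_derivative F x0 + 0) (at x0)"
  proof (rule has_vector_derivative_transform_within_open[of _ _ _ "{c<..<d}"])
    fix t assume "t \<in> {c<..<d}"
    then show "integral {c..t} F + y c = y t" using F_int[of t] by (simp add: integral_unique)
  qed (use x0 in auto)
  then show ?thesis by (simp add: F_def)
qed

text \<open>The product of \<open>phi\<close> and \<open>D\<close> has derivative zero, and it
  vanishes at 0 because \<open>phi 0 = 0\<close> and \<open>D\<close> is continuous there. Since
  \<open>phi\<close> is positive inside, \<open>D\<close> vanishes, and then also at pi by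
  continuity.\<close>

lemma homogeneous_solution_zero:
  fixes D :: "real \<Rightarrow> complex"
  assumes D: "continuous_on {0..pi} D"
    and der: "\<And>x. 0 < x \<Longrightarrow> x < pi \<Longrightarrow> (D has_vector_derivative - (rate x *\<^sub>R D x)) (at x)"
    and x: "x \<in> {0..pi}"
  shows "D x = 0"
proof -
  have zero: "D x = 0" if x: "x \<in> {0<..<pi}" for x
  proof -
    let ?G = "\<lambda>x. phi x *\<^sub>R D x"
    have "((\<lambda>_. 0) has_integral (?G x - ?G 0)) {0..x}"
    proof (rule fundamental_theorem_of_calculus_interior)
      show "continuous_on {0..x} ?G"
        using x by (intro continuous_intros continuous_on_subset[OF D] continuous_on_subset[OF phi_continuous_nonneg]) auto
      fix t assume "t \<in> {0<..<x}"
      then have t: "0 < t" "t < pi" using x by auto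
      have "(?G has_vector_derivative phi t *\<^sub>R (- (rate t *\<^sub>R D t)) + (phi t * rate t) *\<^sub>R D t) (at t)"
        by (intro has_vector_derivative_scaleR phi_deriv_pos der t)
      then show "(?G has_vector_derivative 0) (at t)" by simp
    qed (use x in auto)
    then have "?G x - ?G 0 = 0" by (metis has_integral_0 has_integral_unique)
    then show ?thesis using phi_pos[of x] x by auto
  qed
  have "closure {0<..<pi} = {0..pi}" by (simp add: closure_greaterThanLessThan)
  then show ?thesis
    using continuous_constant_on_closure[of "{0<..<pi}" D 0 x] D zero x by simp
qed

text \<open>The difference of the two functions solves the homogeneous equation on each side of 0;
  the left side is handled by reflection.\<close>

lemma weak_solution_eq_K:
  fixes y w g :: "real \<Rightarrow> complex"
  assumes y: "abs_continuous (-pi) pi y" and w: "integral_variation w"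
    and wg: "AE x in mu. (w has_vector_derivative g x) (at x)"
    and ode: "AE x in mu. w x = complex_of_real (1 - a * cos x) * y x +
        complex_of_real (b * sin x) * vector_derivative y (at x)"
    and x: "x \<in> {-pi..pi}"
  shows "y x = K w x"
proof -
  define D where "D x = y x - K w x" for x
  have wc: "continuous_on {-pi..pi} w" by (rule integral_variation_continuous[OF w])
  have Dc: "continuous_on {-pi..pi} D"
    unfolding D_def by (intro continuous_intros abs_continuous_imp_continuous_on[OF y] K_continuous wc)
  have der: "(D has_vector_derivative - (rate x *\<^sub>R D x)) (at x)" if x: "-pi < x" "x < pi" "x \<noteq> 0" for x
  proof -
    have sin0: "sin t \<noteq> 0" if "-pi < t" "t < pi" "t \<noteq> 0" for t
      using that sin_gt_zero[of t] sin_gt_zero[of "-t"] by (cases "0 < t") auto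
    \<comment> \<open>The window around \<open>x\<close> reaches halfway to 0 and halfway to the end
      point on the same side, so it avoids all zeros of the sine.\<close>
    define c where "c = (if 0 < x then x / 2 else (x - pi) / 2)"
    define d where "d = (if 0 < x then (x + pi) / 2 else x / 2)"
    have cd: "-pi < c" "c < x" "x < d" "d < pi" "0 \<notin> {c..d}"
      using x by (auto simp: c_def d_def)
    have s: "sin t \<noteq> 0" if "t \<in> {c..d}" for t
    proof (rule sin0)
      show "t \<noteq> 0" using that cd(5) by metis
    qed (use that cd in auto)
    have "c < d" "x \<in> {c<..<d}" using cd by auto
    then have "(y has_vector_derivative
      (w x - complex_of_real (1 - a * cos x) * y x) / complex_of_real (b * sin x)) (at x)"
      by (intro weak_solution_has_derivative[OF _ cd(1,4) s y w wg ode])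
    then have "(D has_vector_derivative
      (w x - complex_of_real (1 - a * cos x) * y x) / complex_of_real (b * sin x) -
      (w x - complex_of_real (1 - a * cos x) * K w x) / complex_of_real (b * sin x)) (at x)"
      unfolding D_def[abs_def] by (intro has_vector_derivative_diff K_has_vector_derivative wc x)
    moreover have "(w x - complex_of_real (1 - a * cos x) * y x) / complex_of_real (b * sin x) -
      (w x - complex_of_real (1 - a * cos x) * K w x) / complex_of_real (b * sin x) = - (rate x *\<^sub>R D x)"
    proof -
      have *: "(W - r * Y) / s - (W - r * Y') / s = - (r / s * (Y - Y'))" for W r s Y Y' :: complex
        by (simp add: diff_divide_distrib add_divide_distrib algebra_simps)
      show ?thesis unfolding rate_def D_def scaleR_conv_of_real of_real_divide by (rule *)
    qed
    ultimately show ?thesis by simp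
  qed
  have "D x = 0"
  proof (cases "0 \<le> x")
    case True
    then show ?thesis
      using x by (intro homogeneous_solution_zero[OF continuous_on_subset[OF Dc] der]) auto
  next
    case False
    have "(\<lambda>x. D (- x)) (- x) = 0"
    proof (rule homogeneous_solution_zero[of "\<lambda>x. D (- x)" "- x"])
      show "continuous_on {0..pi} (\<lambda>x. D (- x))"
        by (intro continuous_on_compose2[OF Dc] continuous_intros) auto
      fix t assume t: "0 < t" "t < pi"
      have "(D has_vector_derivative - (rate (- t) *\<^sub>R D (- t))) (at (- t))" using t by (intro der) auto
      moreover have "(uminus has_vector_derivative (- 1 :: real)) (at t)"
        by (auto intro!: derivative_eq_intros)
      ultimately have "(D \<circ> uminus has_vector_derivative (- 1) *\<^sub>R (- (rate (- t) *\<^sub>R D (- t)))) (at t)"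
        by (intro vector_diff_chain_at)
      then show "((\<lambda>x. D (- x)) has_vector_derivative - (rate t *\<^sub>R D (- t))) (at t)"
        by (simp add: o_def rate_minus)
    qed (use x False in auto)
    then show ?thesis by simp
  qed
  then show ?thesis by (simp add: D_def)
qed

text \<open>No derivative occurs in this description, so linearity and norm estimates of the
  operator reduce to \<open>K\<close> and \<open>prim\<close>. The periodicity of y becomes
  \<open>prim f pi = 0\<close> because \<open>K\<close> divides both end values of w by the same
  nonzero number.\<close>

lemma L_graph_iff:
  "L_graph a b u v \<longleftrightarrow> (\<exists>f c. sq_int f \<and> v = abs_l2 f \<and> prim f pi = 0 \<and> u = abs_l2 (K (\<lambda>x. c + prim f x)))"
  (is "_ \<longleftrightarrow> ?R")
proof
  assume "L_graph a b u v"
  then obtain y w g where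
    y: "abs_continuous (-pi) pi y" "y (-pi) = y pi" "u = abs_l2 y" and w: "abs_continuous (-pi) pi w"
    and ode: "AE x in mu. w x = complex_of_real (1 - a * cos x) * y x +
        complex_of_real (b * sin x) * vector_derivative y (at x)"
    and wg: "AE x in mu. (w has_vector_derivative g x) (at x)" and g: "sq_int g" "v = abs_l2 g"
    unfolding L_graph_def by blast
  define N where "N = {x \<in> {-pi<..<pi}. \<not> (w has_vector_derivative g x) (at x)} \<union> {-pi, pi}"
  have N: "negligible N" unfolding N_def using wg by (intro negligible_Un) (auto simp: AE_mu_iff_negligible)
  have w_eq: "w x = w (-pi) + prim g x" if x: "x \<in> {-pi..pi}" for x
  proof -
    have "(g has_integral (w x - w (-pi))) {-pi..x}"
    proof (rule fundamental_theorem_of_calculus_abs_continuous[OF _ _ N])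
      show "abs_continuous (-pi) x w" using x by (intro abs_continuous_subinterval[OF w]) auto
      fix t assume t: "t \<in> {-pi..x} - N"
      then have "(w has_vector_derivative g t) (at t)" using x by (auto simp: N_def)
      then show "(w has_vector_derivative g t) (at t within {-pi..x})" by (rule has_vector_derivative_at_within)
    qed (use x in auto)
    then show ?thesis by (simp add: prim_def integral_unique)
  qed
  have var: "integral_variation w"
  proof -
    obtain k where k: "k integrable_on {-pi..pi}" "\<forall>x\<in>{-pi..pi}. 0 \<le> k x"
      "\<forall>s t. -pi \<le> s \<longrightarrow> s \<le> t \<longrightarrow> t \<le> pi \<longrightarrow> cmod ((w (-pi) + prim g t) - (w (-pi) + prim g s)) \<le> integral {s..t} k"
      using integral_variation_prim[OF g(1), of "w (-pi)"] unfolding integral_variation_def by blast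
    have "cmod (w t - w s) \<le> integral {s..t} k" if st: "-pi \<le> s" "s \<le> t" "t \<le> pi" for s t
    proof -
      have m: "s \<in> {-pi..pi}" "t \<in> {-pi..pi}" using st by auto
      show ?thesis unfolding w_eq[OF m(1)] w_eq[OF m(2)] using k(3) st by blast
    qed
    with k(1,2) show ?thesis unfolding integral_variation_def by blast
  qed
  have yK: "y x = K (\<lambda>x. w (-pi) + prim g x) x" if "x \<in> {-pi..pi}" for x
  proof -
    have "y x = K w x" by (rule weak_solution_eq_K[OF y(1) var wg ode that])
    also have "\<dots> = K (\<lambda>x. w (-pi) + prim g x) x"
      unfolding K_def ratio_def by (rule avg_cong) (subst w_eq, assumption, rule refl)
    finally show ?thesis .
  qed
  have "complex_of_real (1 + a) \<noteq> 0" using a by (metis add_pos_pos less_irrefl of_real_eq_0_iff zero_less_one)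
  then have "prim g pi = 0"
    using y(2) yK[of pi] yK[of "-pi"] by (simp add: K_endpoints divide_simps)
  moreover have "u = abs_l2 (K (\<lambda>x. w (-pi) + prim g x))"
  proof -
    have "sq_int (K (\<lambda>x. w (-pi) + prim g x))"
      by (intro sq_int_continuous K_continuous integral_variation_continuous integral_variation_prim g)
    moreover have "AE x in mu. y x = K (\<lambda>x. w (-pi) + prim g x) x"
      by (rule AE_I2) (use yK in auto)
    ultimately show ?thesis
      using abs_l2_eq_iff[OF abs_continuous_imp_sq_int[OF y(1)]] y(3) by simp
  qed
  ultimately show ?R using g by blast
next
  assume ?R
  then obtain f c where f: "sq_int f" "v = abs_l2 f" "prim f pi = 0" "u = abs_l2 (K (\<lambda>x. c + prim f x))"
    by blast
  let ?w = "\<lambda>x. c + prim f x"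
  have var: "integral_variation ?w" by (rule integral_variation_prim[OF f(1)])
  have wc: "continuous_on {-pi..pi} ?w" by (rule integral_variation_continuous[OF var])
  show "L_graph a b u v"
    unfolding L_graph_def
  proof (rule exI[of _ "K ?w"], rule exI[of _ ?w], rule exI[of _ f], intro conjI f(1,2,4))
    show "abs_continuous (-pi) pi (K ?w)" by (rule K_abs_continuous[OF var])
    show "abs_continuous (-pi) pi ?w" by (rule integral_variation_abs_continuous[OF var])
    show "K ?w (-pi) = K ?w pi" by (simp add: K_endpoints f(3))
    show "AE x in mu. ?w x = complex_of_real (1 - a * cos x) * K ?w x +
        complex_of_real (b * sin x) * vector_derivative (K ?w) (at x)"
      unfolding AE_mu_iff_negligible
    \<comment> \<open>The derivative formula for \<open>K ?w\<close> excludes 0; at every other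
      interior point the relation holds exactly.\<close>
    proof (rule negligible_subset[of "{0}"])
      show "{x \<in> {-pi<..<pi}. \<not> (?w x = complex_of_real (1 - a * cos x) * K ?w x +
        complex_of_real (b * sin x) * vector_derivative (K ?w) (at x))} \<subseteq> {0}"
      proof (rule subsetI, rule ccontr)
        fix x assume x: "x \<in> {x \<in> {-pi<..<pi}. \<not> (?w x = complex_of_real (1 - a * cos x) * K ?w x +
           complex_of_real (b * sin x) * vector_derivative (K ?w) (at x))}" "x \<notin> {0}"
        then have x': "-pi < x" "x < pi" "x \<noteq> 0" by auto
        have s: "complex_of_real (b * sin x) \<noteq> 0"
          using x' b sin_gt_zero[of x] sin_gt_zero[of "-x"] by (cases "0 < x") auto
        have "vector_derivative (K ?w) (at x) = (?w x - complex_of_real (1 - a * cos x) * K ?w x) / complex_of_real (b * sin x)"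
          by (rule vector_derivative_at[OF K_has_vector_derivative[OF wc x']])
        then show False using x(1) s by simp
      qed
    qed simp
    obtain N where N: "negligible N"
      "\<And>x. x \<in> {-pi<..<pi} - N \<Longrightarrow> ((\<lambda>x. integral {-pi..x} f) has_vector_derivative f x) (at x)"
      using indefinite_integral_has_vector_derivative_ae[OF sq_int_integrable_subinterval(1)[OF f(1) order_refl order_refl]]
      by blast
    have "(?w has_vector_derivative f x) (at x)" if "x \<in> {-pi<..<pi} - N" for x
    proof -
      have "((\<lambda>x. c + integral {-pi..x} f) has_vector_derivative 0 + f x) (at x)"
        by (intro has_vector_derivative_add has_vector_derivative_const N(2) that)
      then show ?thesis by (simp add: prim_def)
    qed
    then show "AE x in mu. (?w has_vector_derivative f x) (at x)"
      unfolding AE_mu_iff_negligible by (intro negligible_subset[OF N(1)]) auto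
  qed
qed

end

section \<open>Hilbert-Schmidt and compact operators\<close>

lemma scaleC_add_right: "c *\<^sub>C (u + v) = c *\<^sub>C u + c *\<^sub>C (v :: l2)"
proof -
  obtain f g where fg: "sq_int f" "u = abs_l2 f" "sq_int g" "v = abs_l2 g" by (metis l2_representative)
  then have "c *\<^sub>C (u + v) = abs_l2 (\<lambda>x. c * (f x + g x))" by (simp add: abs_l2_add abs_l2_scaleC sq_int_add)
  also have "\<dots> = abs_l2 (\<lambda>x. c * f x + c * g x)" by (simp add: distrib_left)
  also have "\<dots> = c *\<^sub>C u + c *\<^sub>C v" using fg by (simp add: abs_l2_add abs_l2_scaleC sq_int_cmult)
  finally show ?thesis .
qed

lemma scaleC_scaleC: "c *\<^sub>C d *\<^sub>C u = (c * d) *\<^sub>C (u :: l2)"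
proof -
  obtain f where "sq_int f" "u = abs_l2 f" by (metis l2_representative)
  then show ?thesis by (simp add: abs_l2_scaleC sq_int_cmult mult.assoc)
qed

lemma scaleC_diff_right: "c *\<^sub>C (u - v) = c *\<^sub>C u - c *\<^sub>C (v :: l2)"
  by (simp add: minus_l2_def uminus_l2_eq scaleC_add_right scaleC_scaleC mult.commute)

lemma cinner_self: "cinner u u = complex_of_real ((norm u)\<^sup>2)"
proof -
  have "Im (cinner u u) = 0" using cinner_commute[of u u] by (simp add: complex_eq_iff)
  moreover have "Re (cinner u u) = (norm u)\<^sup>2"
    by (simp add: power2_norm_eq_inner inner_l2_def)
  ultimately show ?thesis by (simp add: complex_eq_iff)
qed

lemma cinner_scaleC_right: "cinner u (c *\<^sub>C v) = cnj c * cinner u v"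
  using cinner_commute[of u "c *\<^sub>C v"] cinner_commute[of v u] by (simp add: cinner_scaleC_left)

lemma cinner_add_right: "cinner u (v + w) = cinner u v + cinner u w"
  using cinner_commute[of u "v + w"] cinner_commute[of v u] cinner_commute[of w u] by (simp add: cinner_add_left)

lemma cinner_zero_left [simp]: "cinner 0 u = 0"
  using cinner_add_left[of 0 0 u] by simp

lemma cinner_zero_right [simp]: "cinner u 0 = 0"
  using cinner_commute[of u 0] by simp

lemma cinner_sum_left: "cinner (\<Sum>e\<in>F. g e) u = (\<Sum>e\<in>F. cinner (g e) u)"
  by (induction F rule: infinite_finite_induct) (auto simp: cinner_add_left)

lemma cinner_sum_right: "cinner u (\<Sum>e\<in>F. g e) = (\<Sum>e\<in>F. cinner u (g e))"
  by (induction F rule: infinite_finite_induct) (auto simp: cinner_add_right)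

lemma cmod_power2_complex: "(complex_of_real (cmod z))\<^sup>2 = z * cnj z"
  by (simp only: of_real_power[symmetric] complex_norm_square)

lemma norm_scaleC: "norm (c *\<^sub>C u) = cmod c * norm (u :: l2)"
proof -
  have "complex_of_real ((norm (c *\<^sub>C u))\<^sup>2) = complex_of_real ((cmod c * norm u)\<^sup>2)"
    unfolding cinner_self[symmetric] cinner_scaleC_left cinner_scaleC_right
    by (simp add: cinner_self power_mult_distrib cmod_power2_complex[of c] mult.assoc mult.left_commute[of "cnj c"])
  then have "(norm (c *\<^sub>C u))\<^sup>2 = (cmod c * norm u)\<^sup>2" by (simp only: of_real_eq_iff)
  then show ?thesis by (simp add: power2_eq_iff_nonneg)
qed

lemma norm_orthonormal_sum:
  assumes F: "finite F" and on: "\<And>e f. \<lbrakk>e \<in> F; f \<in> F\<rbrakk> \<Longrightarrow> cinner e f = (if e = f then 1 else 0)"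
  shows "(norm (\<Sum>e\<in>F. c e *\<^sub>C e))\<^sup>2 = (\<Sum>e\<in>F. (cmod (c e))\<^sup>2)"
proof -
  have "complex_of_real ((norm (\<Sum>e\<in>F. c e *\<^sub>C e))\<^sup>2) = (\<Sum>e\<in>F. \<Sum>f\<in>F. c e * cnj (c f) * cinner e f)"
    unfolding cinner_self[symmetric]
    by (simp only: cinner_sum_left)
      (simp add: cinner_sum_right cinner_scaleC_left cinner_scaleC_right sum_distrib_left mult_ac)
  also have "\<dots> = (\<Sum>e\<in>F. \<Sum>f\<in>F. if e = f then c e * cnj (c f) else 0)"
    by (intro sum.cong refl) (auto simp: on)
  also have "\<dots> = (\<Sum>e\<in>F. complex_of_real ((cmod (c e))\<^sup>2))"
    using F by (intro sum.cong refl) (simp add: sum.delta' cmod_power2_complex)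
  also have "\<dots> = complex_of_real (\<Sum>e\<in>F. (cmod (c e))\<^sup>2)" by simp
  finally show ?thesis by (simp only: of_real_eq_iff)
qed

text \<open>By Zorn's lemma there is a maximal orthonormal set. Its orthogonal complement is
  trivial, since a nonzero vector in it could be normalized and adjoined.\<close>

lemma orthonormal_basis_exists: "\<exists>E. orthonormal_basis E"
proof -
  define A where "A = {E :: l2 set. \<forall>e\<in>E. \<forall>f\<in>E. cinner e f = (if e = f then 1 else 0)}"
  have "\<exists>M\<in>A. \<forall>X\<in>A. M \<subseteq> X \<longrightarrow> X = M"
  proof (rule subset_Zorn)
    fix C assume C: "subset.chain A C"
    have "\<Union>C \<in> A"
      unfolding A_def
    proof (intro CollectI ballI)
      fix e f assume "e \<in> \<Union>C" "f \<in> \<Union>C"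
      then obtain X Y where XY: "X \<in> C" "e \<in> X" "Y \<in> C" "f \<in> Y" by blast
      then have "X \<subseteq> Y \<or> Y \<subseteq> X" using C unfolding subset.chain_def subset_chain_def by blast
      then obtain W where "W \<in> C" "e \<in> W" "f \<in> W" using XY by blast
      moreover have "W \<in> A" using C \<open>W \<in> C\<close> by (auto simp: subset_chain_def)
      ultimately show "cinner e f = (if e = f then 1 else 0)" by (auto simp: A_def)
    qed
    then show "\<exists>U\<in>A. \<forall>X\<in>C. X \<subseteq> U" by blast
  qed
  then obtain M where M: "M \<in> A" "\<And>X. X \<in> A \<Longrightarrow> M \<subseteq> X \<Longrightarrow> X = M" by blast
  have "u = 0" if u: "\<forall>e\<in>M. cinner u e = 0" for u
  proof (rule ccontr)
    assume "u \<noteq> 0"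
    then have n: "norm u \<noteq> 0" by simp
    define e where "e = complex_of_real (1 / norm u) *\<^sub>C u"
    have ee: "cinner e e = 1"
      using n by (simp add: e_def cinner_self norm_scaleC norm_divide)
    have ef: "cinner e f = 0" if "f \<in> M" for f using u that by (simp add: e_def cinner_scaleC_left)
    have fe: "cinner f e = 0" if "f \<in> M" for f using ef[OF that] cinner_commute[of f e] by simp
    have "e \<notin> M" using ee ef by auto
    moreover have "insert e M \<in> A" using M(1) ee ef fe \<open>e \<notin> M\<close> by (auto simp: A_def)
    ultimately show False using M(2)[of "insert e M"] by blast
  qed
  then show ?thesis using M(1) unfolding orthonormal_basis_def A_def by blast
qed

lemma abs_l2_sum:
  assumes "finite F" "\<And>e. e \<in> F \<Longrightarrow> sq_int (g e)"
  shows "sq_int (\<lambda>x. \<Sum>e\<in>F. g e x) \<and> (\<Sum>e\<in>F. abs_l2 (g e)) = abs_l2 (\<lambda>x. \<Sum>e\<in>F. g e x)"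
  using assms
  by (induction F rule: finite_induct) (auto simp: sq_int_zero abs_l2_zero sq_int_add abs_l2_add)

text \<open>Evaluation at a point is a bounded functional on the range of \<open>T\<close>, so Bessel's inequality
  bounds the sum of the squares of \<open>T e\<close> pointwise.\<close>

lemma hilbert_schmidt_if_pointwise_bounded:
  assumes T: "bounded_clinear T" and C: "0 \<le> C"
    and rep: "\<And>h. \<exists>y. continuous_on {-pi..pi} y \<and> T h = abs_l2 y \<and> (\<forall>x\<in>{-pi..pi}. cmod (y x) \<le> C * norm h)"
  shows "hilbert_schmidt T"
proof -
  obtain E where E: "orthonormal_basis E" using orthonormal_basis_exists by blast
  have on: "cinner e f = (if e = f then 1 else 0)" if "e \<in> E" "f \<in> E" for e f
    using E that by (simp add: orthonormal_basis_def)
  obtain Y where Y: "\<And>h. continuous_on {-pi..pi} (Y h)" "\<And>h. T h = abs_l2 (Y h)"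
    "\<And>h x. x \<in> {-pi..pi} \<Longrightarrow> cmod (Y h x) \<le> C * norm h"
    using rep by metis
  have Ysq: "sq_int (Y h)" for h by (rule sq_int_continuous[OF Y(1)])
  have lin: "linear T" and clin: "T (c *\<^sub>C u) = c *\<^sub>C T u" for c u
    using T by (auto simp: bounded_clinear_def bounded_linear.linear)
  have pointwise: "(\<Sum>e\<in>F. (cmod (Y e x))\<^sup>2) \<le> C\<^sup>2" if F: "finite F" "F \<subseteq> E" and x: "x \<in> {-pi<..<pi}" for F x
  proof -
    define S where "S = (\<Sum>e\<in>F. (cmod (Y e x))\<^sup>2)"
    \<comment> \<open>The extremal vector for Bessel's inequality: the value at \<open>x\<close> of
      the representative of \<open>T h\<close> is \<open>S\<close>, while \<open>norm h\<close> is
      the square root of \<open>S\<close>, so S \<le> C sqrt(S).\<close>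
    define h where "h = (\<Sum>e\<in>F. cnj (Y e x) *\<^sub>C e)"
    have S0: "0 \<le> S" unfolding S_def by (intro sum_nonneg) auto
    have nh: "(norm h)\<^sup>2 = S"
      using norm_orthonormal_sum[OF F(1), of "\<lambda>e. cnj (Y e x)"] on F(2) by (simp add: h_def S_def subset_iff)
    have sum: "sq_int (\<lambda>t. \<Sum>e\<in>F. cnj (Y e x) * Y e t)"
       "(\<Sum>e\<in>F. abs_l2 (\<lambda>t. cnj (Y e x) * Y e t)) = abs_l2 (\<lambda>t. \<Sum>e\<in>F. cnj (Y e x) * Y e t)"
      using abs_l2_sum[OF F(1), of "\<lambda>e t. cnj (Y e x) * Y e t"] by (auto intro: sq_int_cmult Ysq)
    have "abs_l2 (Y h) = T h" by (simp add: Y(2))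
    also have "\<dots> = (\<Sum>e\<in>F. cnj (Y e x) *\<^sub>C T e)"
      unfolding h_def by (simp add: linear_sum[OF lin] clin)
    also have "\<dots> = (\<Sum>e\<in>F. abs_l2 (\<lambda>t. cnj (Y e x) * Y e t))"
      by (intro sum.cong refl) (simp add: Y(2) abs_l2_scaleC Ysq)
    finally have "abs_l2 (Y h) = abs_l2 (\<lambda>t. \<Sum>e\<in>F. cnj (Y e x) * Y e t)" by (simp only: sum)
    \<comment> \<open>Equality in \<open>l2\<close> gives the identity almost everywhere; continuity
      of both sides makes it valid at the chosen point \<open>x\<close>.\<close>
    then have "AE t in mu. Y h t = (\<Sum>e\<in>F. cnj (Y e x) * Y e t)"
      using abs_l2_eq_iff[OF Ysq sum(1)] by simp
    then have "Y h x = (\<Sum>e\<in>F. cnj (Y e x) * Y e x)"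
      by (rule AE_mu_eq_imp_eq[rotated 2]) (use x in \<open>auto intro!: continuous_intros continuous_on_subset[OF Y(1)]\<close>)
    also have "\<dots> = complex_of_real S"
      by (simp add: S_def cmod_power2_complex mult.commute)
    finally have "S = cmod (Y h x)" using S0 by simp
    also have "\<dots> \<le> C * norm h" using x by (intro Y(3)) auto
    finally have "S\<^sup>2 \<le> C\<^sup>2 * S"
      using power_mono[of S "C * norm h" 2] S0 by (simp add: power_mult_distrib nh)
    then have "S \<le> C\<^sup>2"
      using S0 by (cases "S = 0") (auto simp: power2_eq_square)
    then show ?thesis by (simp only: S_def)
  qed
  have "(\<lambda>e. (norm (T e))\<^sup>2) summable_on E"
  proof (rule nonneg_bdd_above_summable_on)
    show "bdd_above (sum (\<lambda>e. (norm (T e))\<^sup>2) ` {F. F \<subseteq> E \<and> finite F})"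
    proof (rule bdd_aboveI2)
      fix F assume "F \<in> {F. F \<subseteq> E \<and> finite F}"
      then have F: "finite F" "F \<subseteq> E" by auto
      have int: "(\<lambda>x. (cmod (Y e x))\<^sup>2) integrable_on {-pi..pi}" for e
        using sq_int_integrable_subinterval(3)[OF Ysq] by simp
      have "(\<Sum>e\<in>F. (norm (T e))\<^sup>2) = (\<Sum>e\<in>F. integral {-pi..pi} (\<lambda>x. (cmod (Y e x))\<^sup>2))"
        by (simp add: Y(2) norm_abs_l2_sq Ysq)
      also have "\<dots> = integral {-pi..pi} (\<lambda>x. \<Sum>e\<in>F. (cmod (Y e x))\<^sup>2)"
        using F int by (intro integral_sum[symmetric]) auto
      also have "\<dots> = integral {-pi<..<pi} (\<lambda>x. \<Sum>e\<in>F. (cmod (Y e x))\<^sup>2)"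
        by (simp add: integral_open_interval_real)
      also have "\<dots> \<le> integral {-pi<..<pi} (\<lambda>_. C\<^sup>2)"
      proof (rule integral_le)
        show "(\<lambda>x. \<Sum>e\<in>F. (cmod (Y e x))\<^sup>2) integrable_on {-pi<..<pi}"
          using integrable_sum[OF F(1) int] by (simp add: integrable_on_Icc_iff_Ioo)
        show "(\<lambda>_. C\<^sup>2) integrable_on {-pi<..<pi}"
          using integrable_const_ivl[of "C\<^sup>2" "-pi" pi] by (simp add: integrable_on_Icc_iff_Ioo)
      qed (rule pointwise[OF F])
      finally show "(\<Sum>e\<in>F. (norm (T e))\<^sup>2) \<le> integral {-pi<..<pi} (\<lambda>_. C\<^sup>2)" .
    qed
  qed simp
  then show ?thesis using T E unfolding hilbert_schmidt_def by blast
qed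

section \<open>Compactness by subsequences and a fixed-point theorem\<close>

text \<open>A sequence in the closure is approximated by one in \<open>S\<close> with errors tending
  to 0; along the chosen subsequence both have the same limit.\<close>

lemma compact_closure_if_subsequences:
  fixes S :: "'a::metric_space set"
  assumes "\<And>t :: nat \<Rightarrow> 'a. (\<And>n. t n \<in> S) \<Longrightarrow> \<exists>l r. strict_mono r \<and> (t \<circ> r) \<longlonglongrightarrow> l"
  shows "compact (closure S)"
  unfolding compact_eq_seq_compact_metric seq_compact_def
proof (intro allI impI)
  fix s :: "nat \<Rightarrow> 'a" assume s: "\<forall>n. s n \<in> closure S"
  have "\<exists>t\<in>S. dist t (s n) < inverse (real (Suc n))" for n
    using s closure_approachable[of "s n" S] by auto
  then obtain t where t: "\<And>n. t n \<in> S" "\<And>n. dist (t n) (s n) < inverse (real (Suc n))" by metis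
  obtain l r where r: "strict_mono r" "(t \<circ> r) \<longlonglongrightarrow> l" using assms[of t, OF t(1)] by blast
  have d: "(\<lambda>n. dist (t n) (s n)) \<longlonglongrightarrow> 0"
    by (rule tendsto_sandwich[OF _ _ tendsto_const LIMSEQ_inverse_real_of_nat])
      (intro always_eventually allI zero_le_dist less_imp_le[OF t(2)])+
  have "(\<lambda>n. dist ((s \<circ> r) n) l) \<longlonglongrightarrow> 0"
  proof (rule tendsto_sandwich[OF _ _ tendsto_const])
    have "(\<lambda>n. dist (t (r n)) (s (r n))) \<longlonglongrightarrow> 0"
      using LIMSEQ_subseq_LIMSEQ[OF d r(1)] by (simp add: o_def)
    moreover have "(\<lambda>n. dist (t (r n)) l) \<longlonglongrightarrow> 0"
      using tendsto_dist_iff[THEN iffD1, OF r(2)] by (simp add: o_def)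
    ultimately show "(\<lambda>n. dist (t (r n)) (s (r n)) + dist (t (r n)) l) \<longlonglongrightarrow> 0"
      using tendsto_add by fastforce
    show "\<forall>\<^sub>F n in sequentially. dist ((s \<circ> r) n) l \<le> dist (t (r n)) (s (r n)) + dist (t (r n)) l"
      by (intro always_eventually allI) (simp add: dist_triangle3)
  qed auto
  then have "(s \<circ> r) \<longlonglongrightarrow> l" by (rule tendsto_dist_iff[THEN iffD2])
  moreover from this have "l \<in> closure S"
    using s closed_sequentially[of "closure S" "s \<circ> r" l] by auto
  ultimately show "\<exists>l\<in>closure S. \<exists>r. strict_mono r \<and> (s \<circ> r) \<longlonglongrightarrow> l" using r(1) by blast
qed

text \<open>Banach's theorem is applied to bounded continuous functions on the whole line: composing
  with the clamp \<open>cl\<close> extends the values of \<Phi> on \<open>{p..q}\<close> to such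
  functions without enlarging their distances.\<close>

lemma continuous_fixed_point:
  fixes \<Phi> :: "(real \<Rightarrow> complex) \<Rightarrow> real \<Rightarrow> complex"
  assumes pq: "p \<le> q" and c: "0 \<le> c" "c < 1"
    and cont: "\<And>h. continuous_on {p..q} h \<Longrightarrow> continuous_on {p..q} (\<Phi> h)"
    and contr: "\<And>h k C x. \<lbrakk>continuous_on {p..q} h; continuous_on {p..q} k;
       \<And>x. x \<in> {p..q} \<Longrightarrow> cmod (h x - k x) \<le> C; x \<in> {p..q}\<rbrakk> \<Longrightarrow> cmod (\<Phi> h x - \<Phi> k x) \<le> c * C"
  obtains h where "continuous_on {p..q} h" "\<And>x. x \<in> {p..q} \<Longrightarrow> h x = \<Phi> h x"
proof -
  define cl where "cl x = max p (min q x)" for x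
  have cl: "cl x \<in> {p..q}" for x using pq by (auto simp: cl_def)
  have cl_id: "cl x = x" if "x \<in> {p..q}" for x using that by (auto simp: cl_def)
  have clc: "continuous_on UNIV cl" unfolding cl_def by (intro continuous_intros)
  have hc: "continuous_on {p..q} (apply_bcontfun h)" for h :: "real \<Rightarrow>\<^sub>C complex"
    by (rule continuous_on_apply_bcontfun)
  define \<Psi> where "\<Psi> h = Bcontfun (\<lambda>x. \<Phi> (apply_bcontfun h) (cl x))" for h
  have \<Psi>: "apply_bcontfun (\<Psi> h) = (\<lambda>x. \<Phi> (apply_bcontfun h) (cl x))" for h
    unfolding \<Psi>_def
  proof (rule Bcontfun_inverse)
    have *: "continuous_on {p..q} (\<Phi> (apply_bcontfun h))" by (rule cont[OF hc])
    obtain M where "\<And>x. x \<in> {p..q} \<Longrightarrow> cmod (\<Phi> (apply_bcontfun h) x) \<le> M"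
      using compact_continuous_image[OF * compact_Icc] compact_imp_bounded bounded_iff by (metis imageI)
    then show "(\<lambda>x. \<Phi> (apply_bcontfun h) (cl x)) \<in> bcontfun"
      using cl by (intro bcontfun_normI[where b = M] continuous_on_compose2[OF * clc]) auto
  qed
  have "\<exists>!h. \<Psi> h = h"
  proof (rule banach_fix_type[OF c])
    show "\<forall>h k. dist (\<Psi> h) (\<Psi> k) \<le> c * dist h k"
    proof (intro allI dist_bound)
      fix h k x
      show "dist (\<Psi> h x) (\<Psi> k x) \<le> c * dist h k"
        unfolding \<Psi> dist_norm using dist_bounded[of h _ k] by (intro contr hc cl) (simp add: dist_norm)
    qed
  qed
  then obtain h where h: "\<Psi> h = h" by blast
  show ?thesis
  proof (rule that[OF hc[of h]])
    fix x assume "x \<in> {p..q}"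
    then show "h x = \<Phi> h x" using \<Psi>[of h] cl_id by (metis h)
  qed
qed

section \<open>The resolvent\<close>

context degenerate_ode
begin

section \<open>Linearity of the graph and a criterion for resolvent points\<close>

lemma L_graph_add:
  assumes "L_graph a b u v" "L_graph a b u' v'"
  shows "L_graph a b (u + u') (v + v')"
proof -
  obtain f c where f: "sq_int f" "v = abs_l2 f" "prim f pi = 0" "u = abs_l2 (K (\<lambda>x. c + prim f x))"
    using assms(1) unfolding L_graph_iff by blast
  obtain f' c' where f': "sq_int f'" "v' = abs_l2 f'" "prim f' pi = 0" "u' = abs_l2 (K (\<lambda>x. c' + prim f' x))"
    using assms(2) unfolding L_graph_iff by blast
  have wc: "continuous_on {-pi..pi} (\<lambda>x. c + prim f x)" "continuous_on {-pi..pi} (\<lambda>x. c' + prim f' x)"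
    by (intro continuous_intros sq_int_prim_continuous f f')+
  have "K (\<lambda>x. (c + c') + prim (\<lambda>x. f x + f' x) x) = (\<lambda>x. K (\<lambda>x. c + prim f x) x + K (\<lambda>x. c' + prim f' x) x)"
  proof
    fix x
    have "K (\<lambda>x. (c + c') + prim (\<lambda>x. f x + f' x) x) x = K (\<lambda>x. (c + prim f x) + (c' + prim f' x)) x"
      unfolding K_def ratio_def by (rule avg_cong) (simp add: prim_add f f')
    then show "K (\<lambda>x. (c + c') + prim (\<lambda>x. f x + f' x) x) x = K (\<lambda>x. c + prim f x) x + K (\<lambda>x. c' + prim f' x) x"
      by (simp add: K_add wc)
  qed
  then have "u + u' = abs_l2 (K (\<lambda>x. (c + c') + prim (\<lambda>x. f x + f' x) x))"
    by (simp add: f f' abs_l2_add sq_int_continuous K_continuous wc)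
  moreover have "v + v' = abs_l2 (\<lambda>x. f x + f' x)" by (simp add: f f' abs_l2_add)
  moreover have "prim (\<lambda>x. f x + f' x) pi = 0" by (simp add: prim_add f f')
  ultimately show ?thesis unfolding L_graph_iff using sq_int_add[OF f(1) f'(1)] by blast
qed

lemma L_graph_scaleC:
  assumes "L_graph a b u v"
  shows "L_graph a b (d *\<^sub>C u) (d *\<^sub>C v)"
proof -
  obtain f c where f: "sq_int f" "v = abs_l2 f" "prim f pi = 0" "u = abs_l2 (K (\<lambda>x. c + prim f x))"
    using assms unfolding L_graph_iff by blast
  have wc: "continuous_on {-pi..pi} (\<lambda>x. c + prim f x)"
    by (intro continuous_intros sq_int_prim_continuous f)
  have "K (\<lambda>x. d * c + prim (\<lambda>x. d * f x) x) = (\<lambda>x. d * K (\<lambda>x. c + prim f x) x)"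
    unfolding K_mult[symmetric] by (simp add: prim_mult distrib_left K_def)
  then have "d *\<^sub>C u = abs_l2 (K (\<lambda>x. d * c + prim (\<lambda>x. d * f x) x))"
    by (simp add: f abs_l2_scaleC sq_int_continuous K_continuous wc)
  moreover have "d *\<^sub>C v = abs_l2 (\<lambda>x. d * f x)" by (simp add: f abs_l2_scaleC)
  moreover have "prim (\<lambda>x. d * f x) pi = 0" by (simp add: prim_mult f)
  ultimately show ?thesis unfolding L_graph_iff using sq_int_cmult[OF f(1), of d] by blast
qed

lemma L_graph_diff:
  assumes "L_graph a b u v" "L_graph a b u' v'"
  shows "L_graph a b (u - u') (v - v')"
  using L_graph_add[OF assms(1) L_graph_scaleC[OF assms(2), of "-1"]]
  by (simp add: minus_l2_def uminus_l2_eq)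

lemma L_dom_graph: "u \<in> L_dom a b \<Longrightarrow> L_graph a b u (L_op a b u)"
  unfolding L_dom_def using L_op_eq by blast

lemma L_graph_dom: "L_graph a b u v \<Longrightarrow> u \<in> L_dom a b"
  by (auto simp: L_dom_def)

text \<open>Solutions are required only for each right-hand side separately; linearity of the
  inverse follows from uniqueness, because the graph is a linear subspace.\<close>

lemma resolvent_setI:
  assumes surj: "\<And>h. \<exists>u. L_graph a b u (h + z *\<^sub>C u) \<and> norm u \<le> C * norm h"
    and inj: "\<And>u. L_graph a b u (z *\<^sub>C u) \<Longrightarrow> u = 0"
  shows "z \<in> resolvent_set (L_dom a b) (L_op a b)"
proof -
  let ?D = "L_dom a b" and ?M = "\<lambda>u. L_op a b u - z *\<^sub>C u" and ?R = "resolvent (L_dom a b) (L_op a b) z"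
  have inj_M: "inj_on ?M ?D"
  proof (rule inj_onI)
    fix u u' assume uu: "u \<in> ?D" "u' \<in> ?D" "?M u = ?M u'"
    have "L_op a b u - L_op a b u' = z *\<^sub>C (u - u')"
      using uu(3) by (simp add: scaleC_diff_right algebra_simps)
    then have "L_graph a b (u - u') (z *\<^sub>C (u - u'))"
      using L_graph_diff[OF L_dom_graph[OF uu(1)] L_dom_graph[OF uu(2)]] by simp
    then show "u = u'" using inj[of "u - u'"] by simp
  qed
  have R: "?R h = u" if "L_graph a b u (h + z *\<^sub>C u)" for h u
  proof -
    have "?M u = h" using L_op_eq[OF that] by simp
    then show ?thesis
      unfolding resolvent_def using inv_into_f_f[OF inj_M L_graph_dom[OF that]] by simp
  qed
  have RG: "L_graph a b (?R h) (h + z *\<^sub>C ?R h) \<and> norm (?R h) \<le> C * norm h" for h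
    using surj[of h] R by auto
  have "?M ` ?D = UNIV"
  proof -
    have "h \<in> ?M ` ?D" for h
      using L_op_eq[OF conjunct1[OF RG[of h]]] L_graph_dom[OF conjunct1[OF RG[of h]]]
      by (intro image_eqI[of _ _ "?R h"]) auto
    then show ?thesis by blast
  qed
  then have bij: "bij_betw ?M ?D UNIV" using inj_M by (simp add: bij_betw_def)
  have scale: "?R (c *\<^sub>C h) = c *\<^sub>C ?R h" for c h
    using L_graph_scaleC[OF conjunct1[OF RG[of h]], of c]
    by (intro R) (simp add: scaleC_add_right scaleC_scaleC mult.commute)
  have "bounded_linear ?R"
  proof (rule bounded_linear_intro)
    show "?R (h + h') = ?R h + ?R h'" for h h'
      using L_graph_add[OF conjunct1[OF RG[of h]] conjunct1[OF RG[of h']]]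
      by (intro R) (simp add: scaleC_add_right add_ac)
    show "?R (r *\<^sub>R h) = r *\<^sub>R ?R h" for r h by (simp add: scaleR_l2_def scale)
    show "norm (?R h) \<le> norm h * C" for h using RG[of h] by (simp add: mult.commute)
  qed
  then show ?thesis using bij scale by (simp add: resolvent_set_def bounded_clinear_def)
qed

section \<open>The kernel function and the mapping properties of resolvents\<close>

text \<open>Spans the kernel of the operator, which corresponds to constant w.\<close>

definition k1 :: "real \<Rightarrow> complex" where "k1 = K (\<lambda>_. 1)"

lemma k1_continuous: "continuous_on {-pi..pi} k1"
  unfolding k1_def by (intro K_continuous continuous_intros)

lemma K_const_add:
  assumes "continuous_on {-pi..pi} w"
  shows "K (\<lambda>x. c + w x) x = c * k1 x + K w x"
  using K_add[of "\<lambda>_. c" w x] K_mult[of c "\<lambda>_. 1" x] assms by (simp add: k1_def continuous_on_const)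

lemma cmod_k1_le: "cmod (k1 x) \<le> 1 / (1 - a)"
  unfolding k1_def by (intro cmod_K_le) (auto intro: continuous_intros)

text \<open>A mean of 1/(1 - a cos x) inherits its lower bound. Positivity is what makes both the
  integral and the norm of \<open>k1\<close> nonzero.\<close>

lemma k1_positive: obtains r where "k1 = (\<lambda>x. complex_of_real (r x))" "\<And>x. r x \<ge> 1 / (1 + a)"
proof
  let ?v = "\<lambda>x. 1 / (1 - a * cos x)"
  have c: "continuous_on {-pi..pi} ?v"
    using one_minus_cos_pos by (intro continuous_intros) (auto simp: less_le)
  show "k1 = (\<lambda>x. complex_of_real (avg ?v x))"
  proof
    fix x
    have "((\<lambda>r. complex_of_real (?v (theta x r))) has_integral complex_of_real (avg ?v x)) {0..1}"
      unfolding avg_def by (intro has_integral_of_real integrable_integral avg_integrable c)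
    then show "k1 x = complex_of_real (avg ?v x)"
      by (simp add: k1_def K_def ratio_def avg_def integral_unique)
  qed
  fix x
  have "avg (\<lambda>_. 1 / (1 + a)) x \<le> avg ?v x"
  proof (rule avg_real_le[OF continuous_on_const c])
    fix r
    have "1 - a * cos (theta x r) \<le> 1 + a"
      using a cos_ge_minus_one[of "theta x r"] mult_left_mono[of "-1" "cos (theta x r)" a] by simp
    then show "1 / (1 + a) \<le> 1 / (1 - a * cos (theta x r))"
      by (intro frac_le one_minus_cos_pos) auto
  qed
  then show "avg ?v x \<ge> 1 / (1 + a)" by simp
qed

text \<open>Functions in the range of the operator have integral zero, so this places the kernel
  function outside the range. It allows the constant in w to be adjusted until w is
  periodic.\<close>

lemma prim_k1_nonzero: "prim k1 pi \<noteq> 0"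
proof -
  obtain r where r: "k1 = (\<lambda>x. complex_of_real (r x))" "\<And>x. r x \<ge> 1 / (1 + a)"
    using k1_positive by blast
  have "continuous_on {-pi..pi} (\<lambda>x. Re (k1 x))" by (intro continuous_intros k1_continuous)
  then have rc: "r integrable_on {-pi..pi}" by (intro integrable_continuous_real) (simp add: r(1))
  have "integral {-pi..pi} (\<lambda>_. 1 / (1 + a)) \<le> integral {-pi..pi} r"
    using rc r(2) by (intro integral_le) auto
  moreover have "0 < integral {-pi..pi} (\<lambda>_::real. 1 / (1 + a))" using a by simp
  ultimately have "integral {-pi..pi} r \<noteq> 0" by linarith
  moreover have "prim k1 pi = complex_of_real (integral {-pi..pi} r)"
    unfolding prim_def r(1) by (intro integral_unique has_integral_of_real integrable_integral rc)
  ultimately show ?thesis by simp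
qed

lemma norm_k1_pos: "0 < norm (abs_l2 k1)"
proof (rule ccontr)
  assume "\<not> 0 < norm (abs_l2 k1)"
  then have "abs_l2 k1 = abs_l2 (\<lambda>_. 0)" by (simp flip: abs_l2_zero)
  then have ae: "AE x in mu. k1 x = 0"
    using abs_l2_eq_iff[OF sq_int_continuous[OF k1_continuous] sq_int_zero] by simp
  have "k1 0 = 0"
    by (rule AE_mu_eq_imp_eq[OF continuous_on_subset[OF k1_continuous] continuous_on_const ae]) auto
  moreover obtain r where "k1 = (\<lambda>x. complex_of_real (r x))" "\<And>x. r x \<ge> 1 / (1 + a)"
    using k1_positive by blast
  ultimately have "1 / (1 + a) \<le> (0::real)" by (metis of_real_eq_0_iff)
  then show False using a by (simp add: field_simps)
qed

text \<open>By linearity K(c + prim f) = c k1 + K(prim f), so c is recovered by dividing by the norm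
  of \<open>k1\<close>. The factor 2 pi is sqrt(2 pi) twice: from the bound on the primitive and
  from passing from the supremum to the norm.\<close>

lemma constant_bound:
  assumes f: "sq_int f"
  shows "cmod c \<le> (norm (abs_l2 (K (\<lambda>x. c + prim f x))) + 2 * pi / (1 - a) * norm (abs_l2 f)) / norm (abs_l2 k1)"
proof -
  have pc: "continuous_on {-pi..pi} (prim f)" by (rule sq_int_prim_continuous[OF f])
  have sq: "sq_int k1" "sq_int (K (prim f))" "sq_int (K (\<lambda>x. c + prim f x))"
    by (intro sq_int_continuous k1_continuous K_continuous pc continuous_intros)+
  have "c *\<^sub>C abs_l2 k1 = abs_l2 (K (\<lambda>x. c + prim f x)) - abs_l2 (K (prim f))"
    using sq by (simp add: abs_l2_scaleC abs_l2_diff K_const_add[OF pc])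
  then have "cmod c * norm (abs_l2 k1) \<le> norm (abs_l2 (K (\<lambda>x. c + prim f x))) + norm (abs_l2 (K (prim f)))"
    by (metis norm_scaleC norm_triangle_ineq4)
  also have "norm (abs_l2 (K (prim f))) \<le> sqrt (2 * pi) * (sqrt (2 * pi) * norm (abs_l2 f) / (1 - a))"
    by (intro norm_abs_l2_le sq cmod_K_le pc cmod_prim_le f)
  also have "\<dots> = (sqrt (2 * pi) * sqrt (2 * pi)) / (1 - a) * norm (abs_l2 f)" by simp
  also have "sqrt (2 * pi) * sqrt (2 * pi) = 2 * pi" by simp
  finally show ?thesis using norm_k1_pos by (simp add: pos_le_divide_eq)
qed

text \<open>Quantitative form of \<open>T = K \<circ> (bounded map into the Sobolev space H^1)\<close>.\<close>

definition smoothing :: "(l2 \<Rightarrow> l2) \<Rightarrow> bool" where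
  "smoothing T \<longleftrightarrow> (\<exists>C\<ge>0. \<forall>h. \<exists>f c. sq_int f \<and> T h = abs_l2 (K (\<lambda>x. c + prim f x)) \<and>
     cmod c \<le> C * norm h \<and> norm (abs_l2 f) \<le> C * norm h)"

text \<open>For u = (L - z)^{-1} h the function f is L u = h + z u, bounded because the resolvent is
  bounded; the constant is then controlled by \<open>constant_bound\<close>. \<open>C\<close> is the
  larger of the two resulting factors.\<close>

lemma resolvent_smoothing:
  assumes z: "z \<in> resolvent_set (L_dom a b) (L_op a b)"
  shows "smoothing (resolvent (L_dom a b) (L_op a b) z)"
proof -
  let ?D = "L_dom a b" and ?M = "\<lambda>u. L_op a b u - z *\<^sub>C u" and ?R = "resolvent (L_dom a b) (L_op a b) z"
  have bij: "bij_betw ?M ?D UNIV" and "bounded_linear ?R"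
    using z by (auto simp: resolvent_set_def bounded_clinear_def)
  then obtain B where B: "\<And>h. norm (?R h) \<le> B * norm h" "B > 0"
    using bounded_linear.pos_bounded[of ?R] by (metis mult.commute)
  define C where "C = max (1 + cmod z * B) ((B + 2 * pi / (1 - a) * (1 + cmod z * B)) / norm (abs_l2 k1))"
  show ?thesis
    unfolding smoothing_def
  proof (intro exI[of _ C] conjI allI)
    show "0 \<le> C" using B(2) by (simp add: C_def le_max_iff_disj)
    fix h
    have D: "?R h \<in> ?D" and M: "?M (?R h) = h"
      using bij unfolding resolvent_def bij_betw_def by (auto intro: inv_into_into f_inv_into_f)
    obtain f c where f: "sq_int f" "L_op a b (?R h) = abs_l2 f" "?R h = abs_l2 (K (\<lambda>x. c + prim f x))"
      using L_dom_graph[OF D] unfolding L_graph_iff by blast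
    have "abs_l2 f = h + z *\<^sub>C ?R h" using M by (simp add: f(2)[symmetric] algebra_simps)
    then have "norm (abs_l2 f) \<le> norm h + cmod z * norm (?R h)"
      using norm_triangle_ineq[of h "z *\<^sub>C ?R h"] by (simp add: norm_scaleC)
    also have "\<dots> \<le> norm h + cmod z * (B * norm h)" using B by (intro add_left_mono mult_left_mono) auto
    finally have nf: "norm (abs_l2 f) \<le> (1 + cmod z * B) * norm h" by (simp add: algebra_simps)
    also have "\<dots> \<le> C * norm h" by (intro mult_right_mono) (auto simp: C_def)
    finally have 1: "norm (abs_l2 f) \<le> C * norm h" .
    have "cmod c \<le> (norm (?R h) + 2 * pi / (1 - a) * norm (abs_l2 f)) / norm (abs_l2 k1)"
      using constant_bound[OF f(1), of c] by (simp add: f(3))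
    also have "\<dots> \<le> (B * norm h + 2 * pi / (1 - a) * ((1 + cmod z * B) * norm h)) / norm (abs_l2 k1)"
      using a norm_k1_pos by (intro divide_right_mono add_mono mult_left_mono B nf) auto
    also have "\<dots> = (B + 2 * pi / (1 - a) * (1 + cmod z * B)) / norm (abs_l2 k1) * norm h"
      by (simp add: field_simps)
    also have "\<dots> \<le> C * norm h" by (intro mult_right_mono) (auto simp: C_def)
    finally show "\<exists>f c. sq_int f \<and> ?R h = abs_l2 (K (\<lambda>x. c + prim f x)) \<and>
     cmod c \<le> C * norm h \<and> norm (abs_l2 f) \<le> C * norm h"
      using f(1,3) 1 by blast
  qed
qed

lemma smoothing_hilbert_schmidt:
  assumes T: "bounded_clinear T" and s: "smoothing T"
  shows "hilbert_schmidt T"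
proof -
  obtain C where C: "0 \<le> C" and rep: "\<And>h. \<exists>f c. sq_int f \<and> T h = abs_l2 (K (\<lambda>x. c + prim f x)) \<and>
     cmod c \<le> C * norm h \<and> norm (abs_l2 f) \<le> C * norm h"
    using s unfolding smoothing_def by blast
  show ?thesis
  proof (rule hilbert_schmidt_if_pointwise_bounded[OF T])
    show "0 \<le> (C + sqrt (2 * pi) * C) / (1 - a)" using C a by simp
    fix h
    obtain f c where f: "sq_int f" "T h = abs_l2 (K (\<lambda>x. c + prim f x))"
      "cmod c \<le> C * norm h" "norm (abs_l2 f) \<le> C * norm h" using rep[of h] by blast
    have wc: "continuous_on {-pi..pi} (\<lambda>x. c + prim f x)"
      by (intro continuous_intros sq_int_prim_continuous f)
    have "cmod (c + prim f x) \<le> (C + sqrt (2 * pi) * C) * norm h" if x: "x \<in> {-pi..pi}" for x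
    proof -
      have "cmod (c + prim f x) \<le> cmod c + cmod (prim f x)" by (rule norm_triangle_ineq)
      also have "\<dots> \<le> C * norm h + sqrt (2 * pi) * (C * norm h)"
        using f(3,4) order_trans[OF cmod_prim_le[OF f(1) x] mult_left_mono[OF f(4)]] by (intro add_mono) auto
      finally show ?thesis by (simp add: algebra_simps)
    qed
    then have "cmod (K (\<lambda>x. c + prim f x) x) \<le> (C + sqrt (2 * pi) * C) * norm h / (1 - a)" for x
      by (intro cmod_K_le wc)
    then show "\<exists>y. continuous_on {-pi..pi} y \<and> T h = abs_l2 y \<and>
        (\<forall>x\<in>{-pi..pi}. cmod (y x) \<le> (C + sqrt (2 * pi) * C) / (1 - a) * norm h)"
      using f(2) K_continuous[OF wc] by (intro exI[of _ "K (\<lambda>x. c + prim f x)"]) auto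
  qed
qed

text \<open>Arzela-Ascoli is applied to the functions w rather than to their images: Cauchy-Schwarz
  makes them uniformly Hoelder continuous with exponent 1/2, and \<open>K\<close> preserves uniform
  convergence.\<close>

lemma smoothing_compact:
  assumes T: "bounded_clinear T" and s: "smoothing T"
  shows "compact_operator T"
  unfolding compact_operator_def
proof (intro conjI T allI impI)
  fix B :: "l2 set" assume "bounded B"
  then obtain M where M: "\<And>h. h \<in> B \<Longrightarrow> norm h \<le> M" unfolding bounded_iff by blast
  obtain C where C: "0 \<le> C" and rep: "\<And>h. \<exists>f c. sq_int f \<and> T h = abs_l2 (K (\<lambda>x. c + prim f x)) \<and>
     cmod c \<le> C * norm h \<and> norm (abs_l2 f) \<le> C * norm h"
    using s unfolding smoothing_def by blast
  show "compact (closure (T ` B))"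
  proof (rule compact_closure_if_subsequences)
    fix t :: "nat \<Rightarrow> l2" assume t: "\<And>n. t n \<in> T ` B"
    have "\<exists>f c. sq_int f \<and> t n = abs_l2 (K (\<lambda>x. c + prim f x)) \<and> cmod c \<le> C * M \<and> norm (abs_l2 f) \<le> C * M" for n
    proof -
      obtain h where h: "h \<in> B" "t n = T h" using t[of n] by blast
      have "C * norm h \<le> C * M" using M[OF h(1)] C by (rule mult_left_mono)
      then show ?thesis using rep[of h] h(2) by (metis order_trans)
    qed
    then obtain f c where f: "\<And>n. sq_int (f n)" and tn: "\<And>n. t n = abs_l2 (K (\<lambda>x. c n + prim (f n) x))"
      and c: "\<And>n. cmod (c n) \<le> C * M" and nf: "\<And>n. norm (abs_l2 (f n)) \<le> C * M" by metis
    define w where "w n x = c n + prim (f n) x" for n x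
    have wc: "continuous_on {-pi..pi} (w n)" for n
      unfolding w_def by (intro continuous_intros sq_int_prim_continuous f)
    have hoelder: "cmod (w n x - w n y) \<le> sqrt \<bar>x - y\<bar> * (C * M)" if "x \<in> {-pi..pi}" "y \<in> {-pi..pi}" for n x y
    proof -
      have *: "cmod (w n t - w n s) \<le> sqrt (t - s) * (C * M)" if "-pi \<le> s" "s \<le> t" "t \<le> pi" for s t
      proof -
        have "cmod (w n t - w n s) \<le> sqrt (t - s) * norm (abs_l2 (f n))"
          using cmod_prim_diff_le[OF f that] by (simp add: w_def)
        also have "\<dots> \<le> sqrt (t - s) * (C * M)" using nf that by (intro mult_left_mono) auto
        finally show ?thesis .
      qed
      show ?thesis
        using *[of x y] *[of y x] that by (cases "x \<le> y") (auto simp: norm_minus_commute)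
    qed
    obtain g r where g: "continuous_on {-pi..pi} g" "strict_mono (r :: nat \<Rightarrow> nat)"
      "\<And>e. 0 < e \<Longrightarrow> \<exists>N. \<forall>n x. n \<ge> N \<and> x \<in> {-pi..pi} \<longrightarrow> cmod (w (r n) x - g x) < e"
    proof (rule Arzela_Ascoli[of "{-pi..pi}" w "C * M + sqrt (2 * pi) * (C * M)"])
      show "cmod (w n x) \<le> C * M + sqrt (2 * pi) * (C * M)" if "x \<in> {-pi..pi}" for n x
      proof -
        have "cmod (w n x) \<le> cmod (c n) + cmod (prim (f n) x)" unfolding w_def by (rule norm_triangle_ineq)
        also have "\<dots> \<le> C * M + sqrt (2 * pi) * (C * M)"
          using order_trans[OF cmod_prim_le[OF f that] mult_left_mono[OF nf]] by (intro add_mono c) auto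
        finally show ?thesis .
      qed
      fix x e :: real assume x: "x \<in> {-pi..pi}" and e: "0 < e"
      have CM: "0 \<le> C * M" using nf[of 0] norm_ge_zero[of "abs_l2 (f 0)"] by linarith
      show "\<exists>d>0. \<forall>n y. y \<in> {-pi..pi} \<and> norm (x - y) < d \<longrightarrow> cmod (w n x - w n y) < e"
      \<comment> \<open>This inverts the Hoelder modulus; the added 1 admits
        \<open>C * M = 0\<close> and makes the final inequality strict.\<close>
      proof (intro exI[of _ "(e / (C * M + 1))\<^sup>2"] conjI allI impI; (elim conjE)?)
        show "0 < (e / (C * M + 1))\<^sup>2" using e CM by simp
        fix n y assume y: "y \<in> {-pi..pi}" "norm (x - y) < (e / (C * M + 1))\<^sup>2"
        have "sqrt \<bar>x - y\<bar> \<le> e / (C * M + 1)"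
          using y(2) e CM by (intro real_le_lsqrt) auto
        then have "cmod (w n x - w n y) \<le> e / (C * M + 1) * (C * M)"
          using hoelder[OF x y(1), of n] mult_right_mono[OF _ CM] order_trans by blast
        also have "\<dots> < e" using e CM by (simp add: field_simps)
        finally show "cmod (w n x - w n y) < e" .
      qed
    qed auto
    have "(t \<circ> r) \<longlonglongrightarrow> abs_l2 (K g)"
    proof (rule LIMSEQ_I)
      fix e :: real assume e: "0 < e"
      \<comment> \<open>Applying \<open>K\<close> costs the factor 1/(1 - a) and passing from the
        supremum to the norm costs sqrt(2 pi); the bound that results is e/2.\<close>
      define e' where "e' = e * (1 - a) / (2 * sqrt (2 * pi))"
      have e': "0 < e'" using e a by (simp add: e'_def)
      obtain N where N: "\<And>n x. n \<ge> N \<Longrightarrow> x \<in> {-pi..pi} \<Longrightarrow> cmod (w (r n) x - g x) < e'"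
        using g(3)[OF e'] by blast
      have "norm ((t \<circ> r) n - abs_l2 (K g)) < e" if n: "n \<ge> N" for n
      proof -
        have sq: "sq_int (K (w (r n)))" "sq_int (K g)" by (intro sq_int_continuous K_continuous wc g)+
        have "(t \<circ> r) n - abs_l2 (K g) = abs_l2 (\<lambda>x. K (w (r n)) x - K g x)"
          using sq by (simp add: tn abs_l2_diff flip: w_def)
        also have "norm \<dots> \<le> sqrt (2 * pi) * (e' / (1 - a))"
        proof (rule norm_abs_l2_le)
          show "sq_int (\<lambda>x. K (w (r n)) x - K g x)" using sq by (rule sq_int_diff)
          fix x
          have "cmod (K (\<lambda>x. w (r n) x - g x) x) \<le> e' / (1 - a)"
            using N[OF n] by (intro cmod_K_le continuous_intros wc g) (auto intro: less_imp_le)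
          then show "cmod (K (w (r n)) x - K g x) \<le> e' / (1 - a)" by (simp add: K_diff wc g)
        qed
        also have "\<dots> < e" using e a by (simp add: e'_def)
        finally show ?thesis .
      qed
      then show "\<exists>N. \<forall>n\<ge>N. norm ((t \<circ> r) n - abs_l2 (K g)) < e" by blast
    qed
    then show "\<exists>l r. strict_mono r \<and> (t \<circ> r) \<longlonglongrightarrow> l" using g(2) by blast
  qed
qed

section \<open>A point of the resolvent set\<close>

text \<open>Writing \<open>w = c + h\<close> with \<open>h(-pi) = 0\<close> and choosing \<open>c\<close> such that \<open>w\<close> is periodic turns
  \<open>w' = z K w + f\<close> into \<open>h = h0 + z B h\<close> with the following \<open>h0 = mean_free_prim f\<close> and
  \<open>B h = mean_free_prim (K h)\<close>, which is a contraction for small \<open>z\<close>.\<close>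

definition mean_free_prim :: "(real \<Rightarrow> complex) \<Rightarrow> real \<Rightarrow> complex" where
  "mean_free_prim f x = prim f x - prim f pi / prim k1 pi * prim k1 x"

text \<open>The second summand accounts for the correction by \<open>prim k1\<close>: as |k1| \<le>
  1/(1 - a), its primitive is at most 2 pi/(1 - a).\<close>

definition mean_free_bound :: real where
  "mean_free_bound = 1 + 2 * pi / (1 - a) / cmod (prim k1 pi)"

lemma mean_free_bound_pos: "0 < mean_free_bound"
  unfolding mean_free_bound_def using a by (intro add_pos_nonneg) auto

lemma cmod_mean_free_prim_le:
  assumes "\<And>x. x \<in> {-pi..pi} \<Longrightarrow> cmod (prim f x) \<le> C" "x \<in> {-pi..pi}"
  shows "cmod (mean_free_prim f x) \<le> mean_free_bound * C"
proof -
  have k: "cmod (prim k1 x) \<le> 2 * pi * (1 / (1 - a))"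
    by (rule cmod_prim_le_sup[OF k1_continuous cmod_k1_le assms(2)])
  have C: "0 \<le> C" using assms norm_ge_zero order_trans by blast
  have "cmod (mean_free_prim f x) \<le> cmod (prim f x) + cmod (prim f pi) / cmod (prim k1 pi) * cmod (prim k1 x)"
    unfolding mean_free_prim_def by (metis norm_divide norm_mult norm_triangle_ineq4)
  also have "\<dots> \<le> C + C / cmod (prim k1 pi) * (2 * pi * (1 / (1 - a)))"
    using assms k C by (intro add_mono mult_mono divide_right_mono) auto
  also have "\<dots> = mean_free_bound * C"
    by (simp add: mean_free_bound_def algebra_simps)
  finally show ?thesis .
qed

lemma mean_free_prim_continuous: "sq_int f \<Longrightarrow> continuous_on {-pi..pi} (mean_free_prim f)"
  unfolding mean_free_prim_def[abs_def]
  by (intro continuous_intros sq_int_prim_continuous sq_int_continuous[OF k1_continuous])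

lemma K_sq_int: "continuous_on {-pi..pi} w \<Longrightarrow> sq_int (K w)"
  by (intro sq_int_continuous K_continuous)

lemma cmod_mean_free_prim_K_le:
  assumes "continuous_on {-pi..pi} h" "\<And>x. x \<in> {-pi..pi} \<Longrightarrow> cmod (h x) \<le> C" "x \<in> {-pi..pi}"
  shows "cmod (mean_free_prim (K h) x) \<le> mean_free_bound * (2 * pi * (C / (1 - a)))"
  using assms by (intro cmod_mean_free_prim_le cmod_prim_le_sup K_continuous cmod_K_le)

text \<open>Chosen so that the contraction factor in the supremum norm,
  \<open>z0 * mean_free_bound * (2 * pi / (1 - a))\<close>, equals 1/2.\<close>

definition z0 :: real where
  "z0 = (1 - a) / (4 * pi * mean_free_bound)"

lemma z0_pos: "0 < z0"
  unfolding z0_def using a mean_free_bound_pos by simp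

lemma cmod_z0_mean_free_prim_K_le:
  assumes "continuous_on {-pi..pi} h" "\<And>x. x \<in> {-pi..pi} \<Longrightarrow> cmod (h x) \<le> C" "x \<in> {-pi..pi}"
  shows "cmod (complex_of_real z0 * mean_free_prim (K h) x) \<le> 1 / 2 * C"
proof -
  have "cmod (complex_of_real z0 * mean_free_prim (K h) x) = z0 * cmod (mean_free_prim (K h) x)"
    using z0_pos by (simp add: norm_mult)
  also have "\<dots> \<le> z0 * (mean_free_bound * (2 * pi * (C / (1 - a))))"
    using z0_pos by (intro mult_left_mono cmod_mean_free_prim_K_le assms) auto
  also have "\<dots> = 1 / 2 * C"
    using a mean_free_bound_pos by (simp add: z0_def field_simps)
  finally show ?thesis .
qed

lemma mean_free_prim_K_diff:
  assumes "continuous_on {-pi..pi} h" "continuous_on {-pi..pi} k" "x \<in> {-pi..pi}"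
  shows "mean_free_prim (K (\<lambda>x. h x - k x)) x = mean_free_prim (K h) x - mean_free_prim (K k) x"
proof -
  have "K (\<lambda>x. h x - k x) = (\<lambda>x. K h x - K k x)" using assms by (auto simp: K_diff)
  then show ?thesis
    using assms by (simp add: mean_free_prim_def prim_diff K_sq_int diff_divide_distrib algebra_simps)
qed

lemma continuous_bound:
  fixes h :: "real \<Rightarrow> complex"
  assumes "continuous_on {-pi..pi} h"
  obtains x where "x \<in> {-pi..pi}" "\<And>t. t \<in> {-pi..pi} \<Longrightarrow> cmod (h t) \<le> cmod (h x)"
proof -
  have "continuous_on {-pi..pi} (\<lambda>x. cmod (h x))" by (intro continuous_intros assms)
  from continuous_attains_sup[OF compact_Icc _ this] show ?thesis using that by auto
qed

text \<open>With the above choice of \<open>c\<close>, the right-hand side \<open>f + z K w\<close> integrates to \<open>h\<close>.\<close>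

lemma prim_rhs:
  assumes f: "sq_int f" and h: "continuous_on {-pi..pi} h" and z: "z \<noteq> 0"
    and c: "c = - (prim f pi / z + prim (K h) pi) / prim k1 pi"
    and x: "x \<in> {-pi..pi}"
  shows "prim (\<lambda>t. f t + z * K (\<lambda>x. c + h x) t) x = mean_free_prim f x + z * mean_free_prim (K h) x"
proof -
  have 1: "K (\<lambda>x. c + h x) = (\<lambda>t. c * k1 t + K h t)" by (auto simp: K_const_add[OF h])
  have sq: "sq_int (\<lambda>t. c * k1 t)" "sq_int (K h)" "sq_int (\<lambda>t. z * (c * k1 t + K h t))"
    by (intro sq_int_cmult sq_int_add K_sq_int h sq_int_continuous k1_continuous)+
  have "prim (\<lambda>t. f t + z * K (\<lambda>x. c + h x) t) x = prim f x + z * (c * prim k1 x + prim (K h) x)"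
    unfolding 1 by (simp only: prim_add[OF f sq(3) x] prim_mult prim_add[OF sq(1,2) x])
  also have "\<dots> = mean_free_prim f x + z * mean_free_prim (K h) x"
    using z prim_k1_nonzero unfolding c mean_free_prim_def by (simp add: field_simps)
  finally show ?thesis .
qed

text \<open>The fixed point supplies a solution for every right-hand side, and the same contraction
  estimate with zero right-hand side supplies uniqueness.\<close>

lemma z0_in_resolvent_set: "complex_of_real z0 \<in> resolvent_set (L_dom a b) (L_op a b)"
proof -
  let ?z = "complex_of_real z0"
  have z: "?z \<noteq> 0" using z0_pos by simp
  let ?P = "sqrt (2 * pi)" and ?m = "prim k1 pi"
  \<comment> \<open>The fixed-point equation bounds the maximum of |h| by
    \<open>mean_free_bound * ?P\<close> times the norm of the data plus half of that maximum;
    absorbing the half gives \<open>H\<close>. In \<open>C\<close>, the bounds for c and h are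
    added, \<open>K\<close> contributes 1/(1 - a), and passing to the norm contributes
    \<open>?P\<close>.\<close>
  define H where "H = 2 * mean_free_bound * ?P"
  define C where "C = ?P * (((?P / z0 + 2 * pi / (1 - a) * H) / cmod ?m + H) / (1 - a))"
  show ?thesis
  proof (rule resolvent_setI[where C = C])
    fix hh :: l2
    obtain f where f: "sq_int f" "hh = abs_l2 f" by (rule l2_representative)
    let ?N = "norm (abs_l2 f)"
    obtain h where h: "continuous_on {-pi..pi} h"
      "\<And>x. x \<in> {-pi..pi} \<Longrightarrow> h x = mean_free_prim f x + ?z * mean_free_prim (K h) x"
    proof (rule continuous_fixed_point[of "-pi" pi "1/2" "\<lambda>h x. mean_free_prim f x + ?z * mean_free_prim (K h) x"])
      show "continuous_on {-pi..pi} (\<lambda>x. mean_free_prim f x + ?z * mean_free_prim (K h) x)"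
        if "continuous_on {-pi..pi} h" for h
        by (intro continuous_intros mean_free_prim_continuous f K_sq_int that)
      fix h k D x
      assume hk: "continuous_on {-pi..pi} h" "continuous_on {-pi..pi} k"
        "\<And>x. x \<in> {-pi..pi} \<Longrightarrow> cmod (h x - k x) \<le> D" "x \<in> {-pi..pi}"
      have "mean_free_prim f x + ?z * mean_free_prim (K h) x - (mean_free_prim f x + ?z * mean_free_prim (K k) x) =
          ?z * mean_free_prim (K (\<lambda>x. h x - k x)) x"
        unfolding mean_free_prim_K_diff[OF hk(1,2,4)] by (simp add: algebra_simps)
      then show "cmod (mean_free_prim f x + ?z * mean_free_prim (K h) x -
          (mean_free_prim f x + ?z * mean_free_prim (K k) x)) \<le> 1/2 * D"
        using cmod_z0_mean_free_prim_K_le[of "\<lambda>x. h x - k x" D x] hk by (simp add: continuous_on_diff)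
    qed auto
    \<comment> \<open>The solution of prim f(pi) + z (c prim k1(pi) + prim (K h)(pi)) = 0, so that
      the new right-hand side \<open>F\<close> has integral zero.\<close>
    define c where "c = - (prim f pi / ?z + prim (K h) pi) / ?m"
    define F where "F t = f t + ?z * K (\<lambda>x. c + h x) t" for t
    have wc: "continuous_on {-pi..pi} (\<lambda>x. c + h x)" by (intro continuous_intros h)
    have F: "sq_int F" unfolding F_def by (intro sq_int_add f sq_int_cmult K_sq_int wc)
    have primF: "prim F x = h x" if "x \<in> {-pi..pi}" for x
      using prim_rhs[OF f(1) h(1) z c_def that] h(2)[OF that] by (simp add: F_def[abs_def])
    have "h pi = 0"
      unfolding h(2)[of pi, simplified] using prim_k1_nonzero by (simp add: mean_free_prim_def)
    then have F0: "prim F pi = 0" using primF[of pi] by simp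
    have KK: "K (\<lambda>x. c + prim F x) = K (\<lambda>x. c + h x)"
      unfolding K_def ratio_def[abs_def] by (intro ext avg_cong) (simp add: primF)
    let ?u = "abs_l2 (K (\<lambda>x. c + h x))"
    have "abs_l2 F = hh + ?z *\<^sub>C ?u"
      unfolding f(2) F_def[abs_def] by (simp add: abs_l2_add abs_l2_scaleC f K_sq_int wc sq_int_cmult)
    then have graph: "L_graph a b ?u (hh + ?z *\<^sub>C ?u)"
      unfolding L_graph_iff using F F0 KK by metis
    obtain x1 where x1: "x1 \<in> {-pi..pi}" "\<And>t. t \<in> {-pi..pi} \<Longrightarrow> cmod (h t) \<le> cmod (h x1)"
      using continuous_bound[OF h(1)] by blast
    have "cmod (h x1) \<le> cmod (mean_free_prim f x1) + cmod (?z * mean_free_prim (K h) x1)"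
      unfolding h(2)[OF x1(1)] by (rule norm_triangle_ineq)
    also have "\<dots> \<le> mean_free_bound * (?P * ?N) + 1/2 * cmod (h x1)"
      by (intro add_mono cmod_mean_free_prim_le cmod_z0_mean_free_prim_K_le cmod_prim_le f h x1)
    finally have hb: "cmod (h x1) \<le> H * ?N" by (simp add: H_def)
    have hx: "cmod (h x) \<le> H * ?N" if "x \<in> {-pi..pi}" for x using x1(2)[OF that] hb by linarith
    have "cmod (prim f pi / ?z + prim (K h) pi) \<le> cmod (prim f pi) / z0 + cmod (prim (K h) pi)"
      using norm_triangle_ineq[of "prim f pi / ?z" "prim (K h) pi"] z0_pos by (simp add: norm_divide)
    also have "\<dots> \<le> ?P * ?N / z0 + 2 * pi * (H * ?N / (1 - a))"
      using z0_pos by (intro add_mono divide_right_mono cmod_prim_le cmod_prim_le_sup f K_continuous h cmod_K_le hx) auto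
    also have "\<dots> = (?P / z0 + 2 * pi / (1 - a) * H) * ?N" by (simp add: field_simps)
    finally have "cmod (prim f pi / ?z + prim (K h) pi) / cmod ?m \<le> (?P / z0 + 2 * pi / (1 - a) * H) * ?N / cmod ?m"
      by (intro divide_right_mono) auto
    then have cb: "cmod c \<le> (?P / z0 + 2 * pi / (1 - a) * H) * ?N / cmod ?m"
      by (simp add: c_def norm_divide norm_minus_commute del: minus_add_distrib)
    have wb: "cmod (c + h x) \<le> ((?P / z0 + 2 * pi / (1 - a) * H) / cmod ?m + H) * ?N" if "x \<in> {-pi..pi}" for x
      using norm_triangle_ineq[of c "h x"] cb hx[OF that] by (simp add: distrib_right)
    have "norm ?u \<le> ?P * (((?P / z0 + 2 * pi / (1 - a) * H) / cmod ?m + H) * ?N / (1 - a))"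
      by (intro norm_abs_l2_le K_sq_int wc cmod_K_le wb)
    then have "norm ?u \<le> C * norm hh" by (simp add: C_def f(2))
    with graph show "\<exists>u. L_graph a b u (hh + ?z *\<^sub>C u) \<and> norm u \<le> C * norm hh" by blast
  next
    fix u assume "L_graph a b u (?z *\<^sub>C u)"
    then obtain f c where f: "sq_int f" "?z *\<^sub>C u = abs_l2 f" "prim f pi = 0" "u = abs_l2 (K (\<lambda>x. c + prim f x))"
      unfolding L_graph_iff by blast
    let ?h = "prim f"
    have h: "continuous_on {-pi..pi} ?h" by (rule sq_int_prim_continuous[OF f(1)])
    have wc: "continuous_on {-pi..pi} (\<lambda>x. c + ?h x)" by (intro continuous_intros h)
    let ?G = "\<lambda>x. ?z * K (\<lambda>x. c + ?h x) x"
    have "abs_l2 f = abs_l2 ?G" using f by (simp add: abs_l2_scaleC K_sq_int wc)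
    then have "AE x in mu. f x = ?G x" using abs_l2_eq_iff[OF f(1) sq_int_cmult[OF K_sq_int[OF wc]]] by blast
    then have neg: "negligible ({x \<in> {-pi<..<pi}. f x \<noteq> ?G x} \<union> {-pi, pi})"
      by (intro negligible_Un) (auto simp: AE_mu_iff_negligible)
    \<comment> \<open>The identity for \<open>f\<close> holds only almost everywhere, but its
      primitive is determined at every point.\<close>
    have hG': "?h x = prim ?G x" if "x \<in> {-pi..pi}" for x
    proof -
      have "integral {-pi..x} f = integral {-pi..x} ?G"
        using that by (intro integral_spike[OF neg]) auto
      then show ?thesis by (simp only: prim_def)
    qed
    have hG: "?h x = ?z * (c * prim k1 x + prim (K ?h) x)" if "x \<in> {-pi..pi}" for x
    proof -
      have 1: "K (\<lambda>x. c + ?h x) = (\<lambda>t. c * k1 t + K ?h t)" by (auto simp: K_const_add[OF h])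
      have "sq_int (\<lambda>t. c * k1 t)" by (intro sq_int_cmult sq_int_continuous k1_continuous)
      then show ?thesis
        using hG'[OF that] that
        by (simp add: prim_mult 1 prim_add K_sq_int h)
    qed
    have "?z * (c * ?m + prim (K ?h) pi) = 0" using hG[of pi] f(3) by simp
    then have "c * ?m + prim (K ?h) pi = 0" using z by (metis mult_eq_0_iff)
    then have c: "c = - prim (K ?h) pi / ?m"
      using prim_k1_nonzero by (simp add: field_simps eq_neg_iff_add_eq_0)
    have h_eq: "?h x = ?z * mean_free_prim (K ?h) x" if "x \<in> {-pi..pi}" for x
      using hG[OF that] by (simp add: c mean_free_prim_def)
    obtain x1 where x1: "x1 \<in> {-pi..pi}" "\<And>t. t \<in> {-pi..pi} \<Longrightarrow> cmod (?h t) \<le> cmod (?h x1)"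
      using continuous_bound[OF h] by blast
    \<comment> \<open>At a maximum point the modulus is at most half of itself, so \<open>?h\<close>
      vanishes identically; then \<open>K ?h\<close> vanishes, and with it the constant.\<close>
    have "cmod (?h x1) \<le> 1/2 * cmod (?h x1)"
      using cmod_z0_mean_free_prim_K_le[OF h x1(2) x1(1)] h_eq[OF x1(1)] by simp
    then have h0: "?h x = 0" if "x \<in> {-pi..pi}" for x using x1(2)[OF that] by simp
    have "cmod (prim (K ?h) pi) \<le> 2 * pi * (0 / (1 - a))"
      by (intro cmod_prim_le_sup K_continuous h cmod_K_le) (simp_all add: h0)
    then have "c = 0" by (simp add: c)
    then have "K (\<lambda>x. c + ?h x) = (\<lambda>_. 0)"
      unfolding K_def ratio_def[abs_def] using avg_cong[of "\<lambda>x. (c + ?h x) / complex_of_real (1 - a * cos x)" "\<lambda>_. 0"]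
      by (intro ext) (simp add: h0)
    then show "u = 0" by (simp add: f(4) abs_l2_zero)
  qed
qed

end

theorem theorem2:
  fixes a b :: real
  assumes "a > 0" and "b > 0" and "2 * a + b < 2"
  shows "resolvent_set (L_dom a b) (L_op a b) \<noteq> {} \<and>
    (\<forall>z \<in> resolvent_set (L_dom a b) (L_op a b).
       hilbert_schmidt (resolvent (L_dom a b) (L_op a b) z) \<and>
       compact_operator (resolvent (L_dom a b) (L_op a b) z))"
proof -
  \<comment> \<open>From \<open>b > 0\<close> and \<open>2 * a + b < 2\<close> follows
    \<open>a < 1\<close>.\<close>
  interpret degenerate_ode a b
    using assms by unfold_locales auto
  show ?thesis
  proof (intro conjI ballI)
    show "resolvent_set (L_dom a b) (L_op a b) \<noteq> {}" using z0_in_resolvent_set by blast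
  next
    fix z assume z: "z \<in> resolvent_set (L_dom a b) (L_op a b)"
    then have "bounded_clinear (resolvent (L_dom a b) (L_op a b) z)" by (simp add: resolvent_set_def)
    then show "hilbert_schmidt (resolvent (L_dom a b) (L_op a b) z)"
      "compact_operator (resolvent (L_dom a b) (L_op a b) z)"
      using resolvent_smoothing[OF z] smoothing_hilbert_schmidt smoothing_compact by blast+
  qed
qed

end
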